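(* Let $(p,q)\in\mathcal{C}^0$ be a path in $T^*Q$. The minimization of $\Delta\mapsto\mathcal{F}(\Delta,p,q)$ over $\mathcal{M}_0(D)$ is a convex minimization problem, and if $\mathcal{F}(\cdot,p,q)$ has a minimum at $\Delta=0$ then it is the unique minimum.
   Context: $D=[0,1]^2$ with points $(t,x)$ (time, space); dots are time derivatives. For $q\in L^2([0,1])$ put $\eta(q)(x)=\exp(\int_0^xq(u)\,du)$, $\varphi(q)(x)=\int_0^x\eta(q)(y)\,dy$ (argument $q$ often omitted). $Q=\{q\in L^2([0,1]):\int_0^1q\,dx=0,\ \int_0^1\eta(q)\,dx=1\}$, with Riemannian metric $G(q)(X,X)=\int_0^1X^2/\eta(q)\,dx$. Write $\langle f,g\rangle_\eta=\int_0^1fg\,\eta\,dx$, $H_2=\begin{bmatrix}1&1/2\\1/2&1/3\end{bmatrix}$, $\pi_q^*(p)=p-\begin{bmatrix}1&\varphi\end{bmatrix}H_2^{-1}\begin{bmatrix}\langle p,1\rangle_\eta\\ \langle p,\varphi\rangle_\eta\end{bmatrix}$. $T_q^*Q$ is identified with the range of $\pi_q^*$, i.e. $\{p\in L^2:\langle p,1\rangle_\eta=\langle p,\varphi\rangle_\eta=0\}$, with norm $\|p\|_q^2=\int_0^1\eta\,p^2dx$; $X^\flat=X/\eta$ for $X\in T_qQ$. Given $q_0\in Q$, $p_0\in T_{q_0}^*Q$, $\mathcal{C}^0$ is the set of curves $(p(t),q(t))\in T^*Q$, $t\in[0,1]$, with $q\in H^2([0,1],L^2([0,1]))$, $\dot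 q=\eta(q)p$, $q(0)=q_0$, $p(0)=p_0$. $\frac{D}{Dt}\dot q$ is the covariant derivative of $\dot q$ along $q$ for $(Q,G)$; explicitly, with $\mathcal{U}(f,q)(x)=\frac12\int_x^1\eta(q)f\,dy$ and $b=\frac32\int_0^1(\int_0^xp\circ\varphi^{-1}dy)^2dx$, $$\Big(\tfrac{D}{Dt}\dot q\Big)^\flat=\dot p+\mathcal{U}(p^2,q)-\begin{bmatrix}1&\varphi\end{bmatrix}H_2^{-1}\begin{bmatrix}0\\ b\end{bmatrix}-(\mathrm{id}-\pi_q^* )(\mathcal{U}(p^2,q)).$$ For a measure $\Delta=\Delta_t\,dt$ on $D$, $\mathcal{U}(\Delta,q)(t,x)=\frac12\int_x^1\eta(q(t))\,d\Delta_t$. Fisher-Rao functional: $r(x,y)=\frac14\frac{y^2}{x}$ if $x>0$, $r(0,0)=0$, $r=+\infty$ otherwise; for finite signed Radon measures $\mu,\nu$ on $D$ and $f\in C^0(D,(0,\infty))$, $\mathrm{FR}_f(\mu,\nu)=\int_Dr(\frac{d\mu}{d\lambda},\frac{d\nu}{d\lambda})f\,d\lambda$ for any positive $\lambda$ dominating $\mu,\nu$. $\mathcal{M}_0(D)$ is the set of positive finite Radon measures $\Delta$ on $D$ with $\Delta_{t=0}=0$. The conditions $\Delta_{t=0}=0$ and $\partial_t\Delta=\delta$ are understood weakly: $\int_D\partial_tf\,d\Delta+\int_Df\,d\delta=0$ for all continuous $f$ on $D$ that are $C^1$ in $t$ with $f(1,x)=0$ for all $x$. The functional is $$\mathcal{F}(\Delta,p,q)=\mathrm{FR}_\eta(\Delta,\partial_t\Delta)+\int_0^1\Big\|\Big(\tfrac{D}{Dt}\dot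 q\Big)^\flat+\pi_q^*(\mathcal{U}(\Delta,q))\Big\|_q^2dt+P(p(1),q(1)),$$ with value $+\infty$ if $\partial_t\Delta$ is not a finite Radon measure; $P$ is a real-valued functional on $T^*Q$. *)

theory Defs
  imports "HOL-Analysis.Analysis"
begin

text \<open>
  Elements of \<open>L\<^sup>2([0,1])\<close> are given by Borel representatives \<open>real \<Rightarrow> real\<close>, curves
  \<open>t \<mapsto> u(t)\<close> in \<open>L\<^sup>2([0,1])\<close> by functions \<open>u t x\<close>. Identities between elements of
  \<open>L\<^sup>2\<close> hold almost everywhere in \<open>x\<close>, and values outside \<open>[0,1]\<close> are irrelevant.
\<close>

section \<open>The manifold \<open>Q\<close> and its cotangent bundle\<close>

abbreviation leb01 :: "real measure" where
  "leb01 \<equiv> restrict_space lborel {0..1}"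

definition L2 :: "(real \<Rightarrow> real) \<Rightarrow> bool" where
  "L2 f \<longleftrightarrow> f \<in> borel_measurable leb01 \<and> integrable leb01 (\<lambda>x. (f x)\<^sup>2)"

definition eta :: "(real \<Rightarrow> real) \<Rightarrow> real \<Rightarrow> real" where
  "eta q x = exp (LINT u:{0..x}|lborel. q u)"

definition phi :: "(real \<Rightarrow> real) \<Rightarrow> real \<Rightarrow> real" where
  "phi q x = (LINT y:{0..x}|lborel. eta q y)"

definition Q :: "(real \<Rightarrow> real) set" where
  "Q = {q. L2 q \<and> (LINT x|leb01. q x) = 0 \<and> (LINT x|leb01. eta q x) = 1}"

definition eta_inner :: "(real \<Rightarrow> real) \<Rightarrow> (real \<Rightarrow> real) \<Rightarrow> (real \<Rightarrow> real) \<Rightarrow> real" where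
  "eta_inner q f g = (LINT x|leb01. f x * g x * eta q x)"

definition H2 :: "real ^ 2 ^ 2" where
  "H2 = vector [vector [1, 1/2], vector [1/2, 1/3]]"

text \<open>The function \<open>[1 \<phi>] H\<^sub>2\<^sup>-\<^sup>1 w\<close> on \<open>[0,1]\<close>.\<close>

definition H2inv_comb :: "(real \<Rightarrow> real) \<Rightarrow> real ^ 2 \<Rightarrow> real \<Rightarrow> real" where
  "H2inv_comb q w x = (vector [1, phi q x] :: real ^ 2) \<bullet> (matrix_inv H2 *v w)"

definition pi_star :: "(real \<Rightarrow> real) \<Rightarrow> (real \<Rightarrow> real) \<Rightarrow> real \<Rightarrow> real" where
  "pi_star q p x =
     p x - H2inv_comb q (vector [eta_inner q p (\<lambda>_. 1), eta_inner q p (phi q)]) x"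

definition Tstar :: "(real \<Rightarrow> real) \<Rightarrow> (real \<Rightarrow> real) set" where
  "Tstar q = {p. L2 p \<and> eta_inner q p (\<lambda>_. 1) = 0 \<and> eta_inner q p (phi q) = 0}"

definition TstarQ :: "((real \<Rightarrow> real) \<times> (real \<Rightarrow> real)) set" where
  "TstarQ = {(p, q). q \<in> Q \<and> p \<in> Tstar q}"

definition cotangent_norm_sq :: "(real \<Rightarrow> real) \<Rightarrow> (real \<Rightarrow> real) \<Rightarrow> ennreal" where
  "cotangent_norm_sq q p = (\<integral>\<^sup>+x. ennreal (eta q x * (p x)\<^sup>2) \<partial>leb01)"


section \<open>Sobolev curves in \<open>L\<^sup>2([0,1])\<close>\<close>

text \<open>\<open>L\<^sup>2([0,1], L\<^sup>2([0,1])) = L\<^sup>2([0,1]\<^sup>2)\<close>.\<close>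

definition L2_L2 :: "(real \<Rightarrow> real \<Rightarrow> real) \<Rightarrow> bool" where
  "L2_L2 u \<longleftrightarrow> case_prod u \<in> borel_measurable (leb01 \<Otimes>\<^sub>M leb01) \<and>
     integrable (leb01 \<Otimes>\<^sub>M leb01) (\<lambda>z. (case_prod u z)\<^sup>2)"

definition C0_L2 :: "(real \<Rightarrow> real \<Rightarrow> real) \<Rightarrow> bool" where
  "C0_L2 u \<longleftrightarrow> (\<forall>t\<in>{0..1}. L2 (u t) \<and>
     ((\<lambda>s. LINT x|leb01. (u s x - u t x)\<^sup>2) \<longlongrightarrow> 0) (at t within {0..1}))"

text \<open>\<open>\<psi> \<in> C\<^sup>1\<^sub>c((0,1))\<close> with derivative \<open>\<psi>'\<close>.\<close>

definition C1c :: "(real \<Rightarrow> real) \<Rightarrow> (real \<Rightarrow> real) \<Rightarrow> bool" where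
  "C1c \<psi> \<psi>' \<longleftrightarrow> (\<forall>t. (\<psi> has_real_derivative \<psi>' t) (at t)) \<and> continuous_on UNIV \<psi>' \<and>
     (\<exists>a b. 0 < a \<and> b < 1 \<and> (\<forall>t. t \<notin> {a..b} \<longrightarrow> \<psi> t = 0))"

text \<open>
  The weak derivative in \<open>H\<^sup>1([0,1], L\<^sup>2([0,1]))\<close>: both sides of the equation are elements of
  \<open>L\<^sup>2([0,1])\<close>, so the exceptional null set of \<open>x\<close> may depend on the test function.
\<close>

definition weak_deriv :: "(real \<Rightarrow> real \<Rightarrow> real) \<Rightarrow> (real \<Rightarrow> real \<Rightarrow> real) \<Rightarrow> bool" where
  "weak_deriv u v \<longleftrightarrow> L2_L2 u \<and> L2_L2 v \<and>
     (\<forall>\<psi> \<psi>'. C1c \<psi> \<psi>' \<longrightarrow>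
        (AE x in leb01. (LINT t|leb01. \<psi>' t * u t x) = - (LINT t|leb01. \<psi> t * v t x)))"

text \<open>Unique up to null sets of \<open>[0,1]\<^sup>2\<close>, if it exists.\<close>

definition time_deriv :: "(real \<Rightarrow> real \<Rightarrow> real) \<Rightarrow> real \<Rightarrow> real \<Rightarrow> real" where
  "time_deriv u = (SOME v. weak_deriv u v)"

text \<open>
  Since \<open>H\<^sup>2([0,1], L\<^sup>2) \<subseteq> C\<^sup>1([0,1], L\<^sup>2)\<close>, a curve \<open>q\<close> and its velocity have well-defined
  values at every time. The continuity requirements select these representatives.
\<close>

definition H2_L2 :: "(real \<Rightarrow> real \<Rightarrow> real) \<Rightarrow> bool" where
  "H2_L2 q \<longleftrightarrow> C0_L2 q \<and> (\<exists>v a. weak_deriv q v \<and> weak_deriv v a)"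

definition C0_paths ::
  "(real \<Rightarrow> real) \<Rightarrow> (real \<Rightarrow> real) \<Rightarrow> ((real \<Rightarrow> real \<Rightarrow> real) \<times> (real \<Rightarrow> real \<Rightarrow> real)) set" where
  "C0_paths q0 p0 = {(p, q). (\<forall>t\<in>{0..1}. (p t, q t) \<in> TstarQ) \<and> H2_L2 q \<and>
     C0_L2 (\<lambda>t x. eta (q t) x * p t x) \<and> weak_deriv q (\<lambda>t x. eta (q t) x * p t x) \<and>
     (AE x in leb01. q 0 x = q0 x) \<and> (AE x in leb01. p 0 x = p0 x)}"


section \<open>The covariant acceleration\<close>

definition U_fun :: "(real \<Rightarrow> real) \<Rightarrow> (real \<Rightarrow> real) \<Rightarrow> real \<Rightarrow> real" where
  "U_fun f q x = 1/2 * (LINT y:{x..1}|lborel. eta q y * f y)"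

definition b_coeff :: "(real \<Rightarrow> real) \<Rightarrow> (real \<Rightarrow> real) \<Rightarrow> real" where
  "b_coeff p q = 3/2 *
     (LINT x|leb01. (LINT y:{0..x}|lborel. p (the_inv_into {0..1} (phi q) y))\<^sup>2)"

text \<open>\<open>(D/Dt q\<^sup>\<cdot>)\<^sup>\<flat>\<close> at time \<open>t\<close>, expressed through \<open>p\<close> where \<open>q\<^sup>\<cdot> = \<eta>(q) p\<close>.\<close>

definition acc_flat ::
  "(real \<Rightarrow> real \<Rightarrow> real) \<Rightarrow> (real \<Rightarrow> real \<Rightarrow> real) \<Rightarrow> real \<Rightarrow> real \<Rightarrow> real" where
  "acc_flat p q t x =
     (let V = U_fun (\<lambda>y. (p t y)\<^sup>2) (q t) in
      time_deriv p t x + V x - H2inv_comb (q t) (vector [0, b_coeff (p t) (q t)]) x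
        - (V x - pi_star (q t) V x))"


section \<open>Measures on \<open>D\<close>\<close>

abbreviation D :: "(real \<times> real) set" where
  "D \<equiv> {0..1} \<times> {0..1}"

text \<open>Finite Borel measures on the compact metric space \<open>D\<close> are Radon measures.\<close>

definition radon_pos :: "(real \<times> real) measure \<Rightarrow> bool" where
  "radon_pos M \<longleftrightarrow> sets M = sets (restrict_space borel D) \<and> finite_measure M"

text \<open>
  A finite signed measure \<open>\<nu> = \<nu>\<^sub>1 - \<nu>\<^sub>2\<close> is represented by a pair \<open>(\<nu>\<^sub>1, \<nu>\<^sub>2)\<close> of finite positive
  measures, not necessarily its Jordan decomposition; the notions below depend only on the difference.
\<close>

type_synonym signed_meas = "(real \<times> real) measure \<times> (real \<times> real) measure"

definition radon_signed :: "signed_meas \<Rightarrow> bool" where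
  "radon_signed \<nu> \<longleftrightarrow> radon_pos (fst \<nu>) \<and> radon_pos (snd \<nu>)"

definition smeasure :: "signed_meas \<Rightarrow> (real \<times> real) set \<Rightarrow> real" where
  "smeasure \<nu> A = measure (fst \<nu>) A - measure (snd \<nu>) A"

definition sintegral :: "signed_meas \<Rightarrow> (real \<times> real \<Rightarrow> real) \<Rightarrow> real" where
  "sintegral \<nu> f = (LINT z|fst \<nu>. f z) - (LINT z|snd \<nu>. f z)"

definition zero_meas :: "(real \<times> real) measure" where
  "zero_meas = null_measure (restrict_space borel D)"

definition signed_of :: "(real \<times> real) measure \<Rightarrow> signed_meas" where
  "signed_of \<Delta> = (\<Delta>, zero_meas)"

definition has_density :: "signed_meas \<Rightarrow> (real \<times> real) measure \<Rightarrow> (real \<times> real \<Rightarrow> real) \<Rightarrow> bool" where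
  "has_density \<nu> m g \<longleftrightarrow> integrable m g \<and> (\<forall>A\<in>sets m. smeasure \<nu> A = (LINT z:A|m. g z))"

definition r :: "real \<Rightarrow> real \<Rightarrow> ennreal" where
  "r x y = (if x > 0 then ennreal (1/4 * (y\<^sup>2 / x)) else if x = 0 \<and> y = 0 then 0 else \<infinity>)"

text \<open>
  By homogeneity of \<open>r\<close> the value is the same for all dominating finite measures \<open>m\<close>.
\<close>

definition FR :: "(real \<times> real \<Rightarrow> real) \<Rightarrow> signed_meas \<Rightarrow> signed_meas \<Rightarrow> ennreal" where
  "FR f \<mu> \<nu> = (THE c. \<exists>m g h. radon_pos m \<and> has_density \<mu> m g \<and> has_density \<nu> m h \<and>
     c = (\<integral>\<^sup>+z. r (g z) (h z) * ennreal (f z) \<partial>m))"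

definition C1_test :: "(real \<times> real \<Rightarrow> real) \<Rightarrow> (real \<times> real \<Rightarrow> real) \<Rightarrow> bool" where
  "C1_test f ft \<longleftrightarrow> continuous_on D f \<and> continuous_on D ft \<and>
     (\<forall>t\<in>{0..1}. \<forall>x\<in>{0..1}.
        ((\<lambda>s. f (s, x)) has_real_derivative ft (t, x)) (at t within {0..1})) \<and>
     (\<forall>x\<in>{0..1}. f (1, x) = 0)"

text \<open>
  \<open>\<partial>\<^sub>t\<Delta> = \<delta>\<close> together with \<open>\<Delta>\<^sub>t\<^sub>=\<^sub>0 = 0\<close>. The test functions vanish at \<open>t = 1\<close>, so the weak formula
  leaves \<open>\<delta>\<close> undetermined on \<open>{1} \<times> [0,1]\<close>; there \<open>\<delta>\<close> is taken to be zero. Any other choice of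
  \<open>\<delta>\<close> has infinite Fisher-Rao energy, since the weak formula forces \<open>\<Delta>({1} \<times> [0,1]) = 0\<close>.
\<close>

definition has_dt :: "(real \<times> real) measure \<Rightarrow> signed_meas \<Rightarrow> bool" where
  "has_dt \<Delta> \<delta> \<longleftrightarrow> radon_signed \<delta> \<and>
     (\<forall>f ft. C1_test f ft \<longrightarrow> (LINT z|\<Delta>. ft z) + sintegral \<delta> f = 0) \<and>
     emeasure (fst \<delta>) ({1} \<times> {0..1}) = 0 \<and> emeasure (snd \<delta>) ({1} \<times> {0..1}) = 0"

definition dt_meas :: "(real \<times> real) measure \<Rightarrow> signed_meas" where
  "dt_meas \<Delta> = (SOME \<delta>. has_dt \<Delta> \<delta>)"

text \<open>
  \<open>\<Delta>\<^sub>t\<^sub>=\<^sub>0 = 0\<close>, in a form that also makes sense if \<open>\<partial>\<^sub>t\<Delta>\<close> is not a measure. It results from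
  testing the weak formula with \<open>f(t,x) = max (1 - t/\<epsilon>) 0 * g(x)\<close> and \<open>\<epsilon> \<longrightarrow> 0\<close>: if the formula
  holds with a finite measure \<open>\<delta>\<close>, then the limit below is the integral of \<open>g\<close> against
  \<open>\<delta>\<close> on \<open>{0} \<times> [0,1]\<close>, i.e. against the initial jump of \<open>\<Delta>\<close>.
\<close>

definition vanishes_at_0 :: "(real \<times> real) measure \<Rightarrow> bool" where
  "vanishes_at_0 \<Delta> \<longleftrightarrow> (\<forall>g. continuous_on {0..1} g \<longrightarrow>
     ((\<lambda>\<epsilon>. 1/\<epsilon> * (LINT z:{0..\<epsilon>}\<times>{0..1}|\<Delta>. g (snd z))) \<longlongrightarrow> 0) (at_right 0))"

definition M0 :: "(real \<times> real) measure set" where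
  "M0 = {\<Delta>. radon_pos \<Delta> \<and> vanishes_at_0 \<Delta>}"

text \<open>
  A disintegration \<open>\<Delta> = \<Delta>\<^sub>t dt\<close> into finite measures on \<open>[0,1]\<close>. It exists whenever \<open>\<partial>\<^sub>t\<Delta>\<close>
  is a finite measure in the above sense.
\<close>

definition disintegrates :: "(real \<times> real) measure \<Rightarrow> (real \<Rightarrow> real measure) \<Rightarrow> bool" where
  "disintegrates \<Delta> \<kappa> \<longleftrightarrow>
     (\<forall>t\<in>{0..1}. sets (\<kappa> t) = sets (restrict_space borel {0..1}) \<and> finite_measure (\<kappa> t)) \<and>
     (\<forall>A\<in>sets (restrict_space borel D).
        (\<lambda>t. emeasure (\<kappa> t) (Pair t -` A)) \<in> borel_measurable leb01 \<and>
        emeasure \<Delta> A = (\<integral>\<^sup>+t. emeasure (\<kappa> t) (Pair t -` A) \<partial>leb01))"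

definition slice :: "(real \<times> real) measure \<Rightarrow> real \<Rightarrow> real measure" where
  "slice \<Delta> = (SOME \<kappa>. disintegrates \<Delta> \<kappa>)"

definition U_meas :: "(real \<times> real) measure \<Rightarrow> (real \<Rightarrow> real \<Rightarrow> real) \<Rightarrow> real \<Rightarrow> real \<Rightarrow> real" where
  "U_meas \<Delta> q t x = 1/2 * (LINT y:{x..1}|slice \<Delta> t. eta (q t) y)"


section \<open>The functional and the minimization problem\<close>

definition F_functional ::
  "((real \<Rightarrow> real) \<times> (real \<Rightarrow> real) \<Rightarrow> real) \<Rightarrow> (real \<times> real) measure \<Rightarrow>
   (real \<Rightarrow> real \<Rightarrow> real) \<Rightarrow> (real \<Rightarrow> real \<Rightarrow> real) \<Rightarrow> ereal" where
  "F_functional P \<Delta> p q =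
     (if \<exists>\<delta>. has_dt \<Delta> \<delta> then
        enn2ereal (FR (\<lambda>(t, x). eta (q t) x) (signed_of \<Delta>) (dt_meas \<Delta>))
        + enn2ereal (\<integral>\<^sup>+t. cotangent_norm_sq (q t)
            (\<lambda>x. acc_flat p q t x + pi_star (q t) (U_meas \<Delta> q t) x) \<partial>leb01)
        + ereal (P (p 1, q 1))
      else \<infinity>)"

definition mix_meas :: "real \<Rightarrow> 'a measure \<Rightarrow> 'a measure \<Rightarrow> 'a measure" where
  "mix_meas s M N = measure_of (space M) (sets M)
     (\<lambda>A. ennreal (1 - s) * emeasure M A + ennreal s * emeasure N A)"

definition convex_problem :: "('a measure \<Rightarrow> ereal) \<Rightarrow> 'a measure set \<Rightarrow> bool" where
  "convex_problem F S \<longleftrightarrow> (\<forall>M\<in>S. \<forall>N\<in>S. \<forall>s\<in>{0..1}. mix_meas s M N \<in> S \<and>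
     F (mix_meas s M N) \<le> ereal (1 - s) * F M + ereal s * F N)"

definition minimizer_on :: "('a measure \<Rightarrow> ereal) \<Rightarrow> 'a measure set \<Rightarrow> 'a measure \<Rightarrow> bool" where
  "minimizer_on F S M \<longleftrightarrow> M \<in> S \<and> (\<forall>N\<in>S. F M \<le> F N)"

end

theory Submission
  imports Defs
begin

text \<open>
  The functional is the Fisher-Rao term, a squared norm of a function that is affine in \<open>\<Delta>\<close>, and a
  constant. The first is convex because \<open>r\<close> is subadditive and positively homogeneous. If both \<open>0\<close>
  and \<open>\<Delta>\<close> are minimizers, the parallelogram identity at their midpoint shows that
  \<open>\<pi>\<^sup>*(\<U>(\<Delta>, q))\<close> vanishes, so the norm terms agree; being finite, they cancel and leave
  \<open>FR(\<Delta>, \<partial>\<^sub>t\<Delta>) = 0\<close>. Hence \<open>\<partial>\<^sub>t\<Delta> = 0\<close>, and testing with \<open>f(t, x) = t - 1\<close> yields \<open>\<Delta>(D) = 0\<close>.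

  The disintegration is explicit: integrating \<open>\<partial>\<^sub>t\<Delta> = \<delta>\<close> in time gives \<open>\<Delta>\<^sub>t = \<delta>([0, t] \<times> \<cdot>)\<close>.
  The cancellation requires the acceleration to be square integrable, hence that \<open>p\<close> has a weak time
  derivative. This follows from the product rule for \<open>p = exp (- \<integral>\<^sub>0\<^sup>x q) \<partial>\<^sub>tq\<close>, whose first factor is
  continuously differentiable in time by the lemma of du Bois-Reymond.
\<close>

section \<open>Finite measures on the unit square\<close>

text \<open>The Fisher-Rao term is linear along rays, so it offers no strict convexity. Uniqueness
  holds at zero because that term vanishes there: at the midpoint it is at most half its value at
  \<Delta>, which is exactly what the minimality of \<Delta> can absorb. The functional contains
  three choices: the description in \<open>FR\<close>, the pair picked by \<open>dt_meas\<close> and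
  the disintegration picked by \<open>slice\<close>. Convexity compares the choices made for two
  measures and for their mixture, which are a priori unrelated. Each choice is therefore shown to be
  unique in a suitable sense: \<open>FR\<close> as a value, \<open>dt_meas\<close> as a set
  function, \<open>slice\<close> at almost every time. The antiderivative in time is a difference of
  positive measures, and its positivity at each single time has to be derived from that of \<Delta>.
  Signed identities are rewritten as equalities between sums of positive measures, realised by
  \<open>mix_meas\<close> with weight 1/2. Energies are compared in \<open>ennreal\<close> by
  identities free of subtraction, which admit infinite values.\<close>

abbreviation borel_D :: "(real \<times> real) measure" where
  "borel_D \<equiv> restrict_space borel D"

section \<open>Convex combinations of measures\<close>

lemma sets_mix_meas [simp]: "sets (mix_meas s M N) = sets M"
  by (simp add: mix_meas_def)

lemma space_mix_meas [simp]: "space (mix_meas s M N) = space M"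
  by (simp add: mix_meas_def)

lemma measurable_mix_meas [simp]: "measurable (mix_meas s M N) L = measurable M L"
  by (rule measurable_cong_sets) simp_all

lemma emeasure_mix_meas:
  assumes "sets N = sets M" "A \<in> sets M"
  shows "emeasure (mix_meas s M N) A = ennreal (1 - s) * emeasure M A + ennreal s * emeasure N A"
proof (rule emeasure_measure_of[OF mix_meas_def])
  show "sets M \<subseteq> Pow (space M)" by (rule sets.space_closed)
  show "positive (sets (mix_meas s M N)) (\<lambda>A. ennreal (1 - s) * emeasure M A + ennreal s * emeasure N A)"
    by (simp add: positive_def)
  show "countably_additive (sets (mix_meas s M N))
      (\<lambda>A. ennreal (1 - s) * emeasure M A + ennreal s * emeasure N A)"
  proof (rule countably_additiveI)
    fix B :: "nat \<Rightarrow> 'a set"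
    assume B: "range B \<subseteq> sets (mix_meas s M N)" "disjoint_family B"
    then have "(\<Sum>i. emeasure M (B i)) = emeasure M (\<Union>i. B i)"
      "(\<Sum>i. emeasure N (B i)) = emeasure N (\<Union>i. B i)"
      using assms by (auto intro!: suminf_emeasure)
    then show "(\<Sum>i. ennreal (1 - s) * emeasure M (B i) + ennreal s * emeasure N (B i)) =
        ennreal (1 - s) * emeasure M (\<Union> (range B)) + ennreal s * emeasure N (\<Union> (range B))"
      by (simp add: suminf_add[symmetric])
  qed
  show "A \<in> sets (mix_meas s M N)" using assms by simp
qed

lemma nn_integral_mix_meas:
  assumes sets: "sets N = sets M" and f: "f \<in> borel_measurable M"
  shows "(\<integral>\<^sup>+x. f x \<partial>mix_meas s M N) =
    ennreal (1 - s) * (\<integral>\<^sup>+x. f x \<partial>M) + ennreal s * (\<integral>\<^sup>+x. f x \<partial>N)"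
  using f
proof (induction f rule: borel_measurable_induct)
  case (cong f g)
  have "space N = space M" using sets by (rule sets_eq_imp_space_eq)
  then have eqs: "integral\<^sup>N M f = integral\<^sup>N M g" "integral\<^sup>N N f = integral\<^sup>N N g"
    "integral\<^sup>N (mix_meas s M N) f = integral\<^sup>N (mix_meas s M N) g"
    by (intro nn_integral_cong; simp add: cong(3) \<open>space N = space M\<close>)+
  show ?case unfolding eqs by fact
next
  case (set A)
  with sets show ?case by (simp add: emeasure_mix_meas)
next
  case (mult u c)
  have "u \<in> borel_measurable N" "u \<in> borel_measurable (mix_meas s M N)"
    using mult sets by (simp_all cong: measurable_cong_sets)
  with mult show ?case by (simp add: nn_integral_cmult algebra_simps)
next
  case (add u v)
  have "u \<in> borel_measurable N" "u \<in> borel_measurable (mix_meas s M N)"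
    "v \<in> borel_measurable N" "v \<in> borel_measurable (mix_meas s M N)"
    using add sets by (simp_all cong: measurable_cong_sets)
  with add show ?case by (simp add: nn_integral_add algebra_simps)
next
  case (seq U)
  have m: "U i \<in> borel_measurable N" "U i \<in> borel_measurable (mix_meas s M N)" for i
    using seq sets by (simp_all cong: measurable_cong_sets)
  have "incseq (\<lambda>i. \<integral>\<^sup>+x. U i x \<partial>M)" "incseq (\<lambda>i. \<integral>\<^sup>+x. U i x \<partial>N)"
    using \<open>incseq U\<close> by (auto simp: incseq_def le_fun_def intro!: nn_integral_mono)
  then show ?case
    using seq m
    by (simp add: nn_integral_monotone_convergence_SUP SUP_mult_left_ennreal ennreal_SUP_add
        incseq_def mult_left_mono image_comp)
qed

lemma integrable_mix_meas:
  fixes f :: "'a \<Rightarrow> real"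
  assumes sets: "sets N = sets M" and f: "integrable M f" "integrable N f"
  shows "integrable (mix_meas s M N) f"
proof -
  have "(\<integral>\<^sup>+x. ennreal (norm (f x)) \<partial>mix_meas s M N) < \<infinity>"
    using f by (subst nn_integral_mix_meas[OF sets])
      (auto simp: integrable_iff_bounded ennreal_mult_less_top)
  with f show ?thesis by (auto simp: integrable_iff_bounded)
qed

text \<open>The range of \<open>s\<close> matters here: \<open>mix_meas\<close> truncates negative
  weights to 0 through \<open>ennreal\<close>, so a formula with real weights needs both of them
  nonnegative.\<close>

lemma integral_mix_meas:
  fixes f :: "'a \<Rightarrow> real"
  assumes sets: "sets N = sets M" and f: "integrable M f" "integrable N f" and s: "s \<in> {0..1}"
  shows "(LINT x|mix_meas s M N. f x) = (1 - s) * (LINT x|M. f x) + s * (LINT x|N. f x)"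
proof -
  have fin: "(\<integral>\<^sup>+x. ennreal (f x) \<partial>M) < \<infinity>" "(\<integral>\<^sup>+x. ennreal (f x) \<partial>N) < \<infinity>"
    "(\<integral>\<^sup>+x. ennreal (- f x) \<partial>M) < \<infinity>" "(\<integral>\<^sup>+x. ennreal (- f x) \<partial>N) < \<infinity>"
    using f by (auto simp: real_integrable_def less_top)
  have [measurable]: "f \<in> borel_measurable M" using f by auto
  show ?thesis
    using s fin f
    by (simp add: real_lebesgue_integral_def integrable_mix_meas[OF sets] nn_integral_mix_meas[OF sets]
        enn2real_plus enn2real_mult ennreal_mult_less_top algebra_simps)
qed

lemma measure_mix_meas:
  assumes "sets N = sets M" "finite_measure M" "finite_measure N" "s \<in> {0..1}" "A \<in> sets M"
  shows "measure (mix_meas s M N) A = (1 - s) * measure M A + s * measure N A"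
proof -
  interpret M: finite_measure M by fact
  interpret N: finite_measure N by fact
  show ?thesis
    using assms by (simp add: measure_def emeasure_mix_meas enn2real_plus enn2real_mult
        M.emeasure_finite N.emeasure_finite less_top[symmetric] ennreal_mult_eq_top_iff)
qed

lemma finite_measure_mix_meas:
  assumes "sets N = sets M" "finite_measure M" "finite_measure N"
  shows "finite_measure (mix_meas s M N)"
proof
  interpret M: finite_measure M by fact
  interpret N: finite_measure N by fact
  have "space N = space M" using assms(1) by (rule sets_eq_imp_space_eq)
  then show "emeasure (mix_meas s M N) (space (mix_meas s M N)) \<noteq> \<infinity>"
    using assms M.emeasure_finite[of "space M"] N.emeasure_finite[of "space M"]
    by (simp add: emeasure_mix_meas ennreal_mult_eq_top_iff)
qed

lemma mix_meas_0: "sets N = sets M \<Longrightarrow> mix_meas 0 M N = M"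
  by (rule measure_eqI) (simp_all add: emeasure_mix_meas)

lemma mix_meas_1: "sets N = sets M \<Longrightarrow> mix_meas 1 M N = N"
  by (rule measure_eqI) (simp_all add: emeasure_mix_meas)

section \<open>Radon measures on the square and the quadrants that determine them\<close>

lemma space_borel_D [simp]: "space borel_D = D"
  by (simp add: space_restrict_space)

lemma D_in_borel [measurable, simp]: "D \<in> sets borel"
  by (intro borel_closed closed_Times closed_atLeastAtMost)

lemma sets_borel_D: "A \<in> sets borel_D \<longleftrightarrow> A \<in> sets borel \<and> A \<subseteq> D"
  by (subst sets_restrict_space_iff) auto

lemma radon_posD:
  assumes "radon_pos M"
  shows "sets M = sets borel_D" "space M = D" "finite_measure M"
    "measurable M = measurable borel_D"
  using assms sets_eq_imp_space_eq[of M borel_D] by (auto simp: radon_pos_def intro!: ext measurable_cong_sets)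

lemma radon_pos_mix:
  assumes "radon_pos M" "radon_pos N"
  shows "radon_pos (mix_meas s M N)"
  using assms by (auto simp: radon_pos_def intro!: finite_measure_mix_meas)

lemma radon_pos_zero: "radon_pos zero_meas"
  by (auto simp: radon_pos_def zero_meas_def intro!: finite_measureI)

lemma radon_pos_emeasure_finite: "radon_pos M \<Longrightarrow> emeasure M A \<noteq> \<infinity>"
  by (simp add: radon_pos_def finite_measure.emeasure_finite)

lemma radon_pos_integrable_bounded:
  fixes f :: "real \<times> real \<Rightarrow> real"
  assumes M: "radon_pos M" and f: "f \<in> borel_measurable borel_D" and b: "\<And>z. z \<in> D \<Longrightarrow> \<bar>f z\<bar> \<le> B"
  shows "integrable M f"
proof -
  interpret finite_measure M using radon_posD[OF M] by simp
  show ?thesis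
    by (rule integrable_const_bound[of _ B])
      (use f b radon_posD[OF M] in \<open>auto intro!: AE_I2\<close>)
qed

lemma radon_pos_integrable_continuous:
  fixes f :: "real \<times> real \<Rightarrow> real"
  assumes M: "radon_pos M" and f: "continuous_on D f"
  shows "integrable M f"
proof -
  have "compact (f ` D)"
    using f by (intro compact_continuous_image compact_Times compact_Icc)
  then obtain B where "\<And>z. z \<in> D \<Longrightarrow> \<bar>f z\<bar> \<le> B"
    by (metis (no_types, lifting) bounded_iff compact_imp_bounded image_eqI real_norm_def)
  moreover have "f \<in> borel_measurable borel_D"
    using f by (rule borel_measurable_continuous_on_restrict)
  ultimately show ?thesis using M by (intro radon_pos_integrable_bounded)
qed

text \<open>Quadrants are closed under intersection, and their indicators are limits of products of
  one-variable cutoffs, which can serve as test functions. The rays with natural endpoints supply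
  the countable cover needed for a product of generated sigma-algebras.\<close>

lemma borel_pair_generated_by_lessThan:
  "sets (borel :: (real \<times> real) measure) =
    sigma_sets UNIV ((\<lambda>(a, c). {..<a} \<times> {..<c}) ` UNIV)"
proof -
  let ?E = "range (lessThan :: real \<Rightarrow> real set)"
  have cov: "countable (range (\<lambda>n::nat. {..<real n}))" "(\<Union>(range (\<lambda>n::nat. {..<real n}))) = UNIV"
    by (auto simp: reals_Archimedean2)
  have "sets (borel \<Otimes>\<^sub>M borel :: (real \<times> real) measure) =
      sets (sigma UNIV ?E \<Otimes>\<^sub>M sigma UNIV ?E)"
    by (intro sets_pair_measure_cong) (simp_all add: borel_Iio)
  also have "\<dots> = sets (sigma (UNIV \<times> UNIV) {a \<times> b | a b. a \<in> ?E \<and> b \<in> ?E})"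
    using cov by (subst sets_pair_eq[where Ca = "range (\<lambda>n::nat. {..<real n})" and Cb = "range (\<lambda>n::nat. {..<real n})"]) auto
  also have "{a \<times> b | a b. a \<in> ?E \<and> b \<in> ?E} = (\<lambda>(a, c). {..<a} \<times> {..<c}) ` UNIV"
    by auto
  finally show ?thesis unfolding borel_prod by simp
qed

text \<open>The uniqueness argument is carried out for the push-forwards to the plane, where
  quadrants generate the Borel sets and exhaust the space. Evaluating these on subsets of
  \<open>D\<close> recovers the original measures.\<close>

lemma measure_D_eqI:
  assumes M: "radon_pos M" and N: "radon_pos N"
    and eq: "\<And>a c. measure M (D \<inter> {..<a} \<times> {..<c}) = measure N (D \<inter> {..<a} \<times> {..<c})"
  shows "M = N"
proof -
  interpret M: finite_measure M using radon_posD[OF M] by simp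
  interpret N: finite_measure N using radon_posD[OF N] by simp
  let ?E = "(\<lambda>(a::real, c::real). {..<a} \<times> {..<c}) ` UNIV"
  let ?M = "distr M borel (\<lambda>z. z)" and ?N = "distr N borel (\<lambda>z. z)"
  have meas: "(\<lambda>z. z) \<in> measurable M borel" "(\<lambda>z. z) \<in> measurable N borel"
    by (simp_all add: radon_posD[OF M] radon_posD[OF N] measurable_restrict_space1)
  have em: "emeasure ?M A = emeasure M (D \<inter> A)" "emeasure ?N A = emeasure N (D \<inter> A)"
    if "A \<in> sets borel" for A
    using that meas radon_posD[OF M] radon_posD[OF N] by (auto simp: emeasure_distr Int_commute)
  have "?M = ?N"
  proof (rule measure_eqI_generator_eq[where E = ?E and \<Omega> = UNIV and A = "\<lambda>n. {..<real n} \<times> {..<real n}"])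
    show "Int_stable ?E"
    proof (rule Int_stableI_image)
      fix i j :: "real \<times> real"
      show "\<exists>k\<in>UNIV. (case i of (a, c) \<Rightarrow> {..<a} \<times> {..<c}) \<inter> (case j of (a, c) \<Rightarrow> {..<a} \<times> {..<c}) =
          (case k of (a, c) \<Rightarrow> {..<a} \<times> {..<c})"
        by (rule bexI[of _ "(min (fst i) (fst j), min (snd i) (snd j))"])
          (auto split: prod.splits)
    qed
    show "emeasure ?M X = emeasure ?N X" if X: "X \<in> ?E" for X
    proof -
      obtain a c where X: "X = {..<a} \<times> {..<c}" using X by (elim imageE) (auto split: prod.splits)
      then have "X \<in> sets borel" by (simp add: borel_open open_Times)
      with eq show ?thesis
        by (simp add: em X M.emeasure_eq_measure N.emeasure_eq_measure)
    qed
    show "(\<Union>i. {..<real i} \<times> {..<real i}) = UNIV"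
    proof -
      have "\<exists>i. x < real i \<and> y < real i" for x y
        using reals_Archimedean2[of "max x y"] by auto
      then show ?thesis by auto
    qed
    show "emeasure ?M ({..<real i} \<times> {..<real i}) \<noteq> \<infinity>" for i
      by (simp add: em borel_open open_Times)
  qed (auto simp: borel_pair_generated_by_lessThan)
  show ?thesis
  proof (rule measure_eqI)
    show "sets M = sets N" using radon_posD[OF M] radon_posD[OF N] by simp
    fix A assume "A \<in> sets M"
    then have "A \<in> sets borel" "A \<subseteq> D" using radon_posD[OF M] by (auto simp: sets_borel_D)
    then show "emeasure M A = emeasure N A"
      using em[of A] \<open>?M = ?N\<close> by (simp add: Int_absorb1)
  qed
qed

lemma lower_rect_in_sets: "D \<inter> {..<a} \<times> {..<c} \<in> sets borel_D"
proof -
  have "open ({..<a} \<times> {..<c})" by (intro open_Times open_lessThan)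
  then have "D \<inter> {..<a} \<times> {..<c} \<in> sets borel" by (intro sets.Int D_in_borel borel_open)
  then show ?thesis unfolding sets_borel_D by blast
qed

text \<open>
  A continuously differentiable approximation of the indicator of \<open>{..<a}\<close> that vanishes for
  \<open>t \<ge> a\<close>, and is therefore admissible in the weak formula for \<open>\<partial>\<^sub>t\<Delta>\<close> if \<open>a \<le> 1\<close>.
\<close>

definition cutoff :: "real \<Rightarrow> nat \<Rightarrow> real \<Rightarrow> real" where
  "cutoff a n t = 1 - exp (- (real n * (max 0 (a - t))\<^sup>2))"

lemma cutoff_bounds: "0 \<le> cutoff a n t" "cutoff a n t \<le> 1" "\<bar>cutoff a n t\<bar> \<le> 1"
  by (simp_all add: cutoff_def)

lemma continuous_on_cutoff [continuous_intros]:
  "continuous_on S f \<Longrightarrow> continuous_on S (\<lambda>z. cutoff a n (f z))"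
  unfolding cutoff_def by (intro continuous_intros)

lemma cutoff_measurable [measurable]: "cutoff a n \<in> borel_measurable borel"
  by (intro borel_measurable_continuous_onI continuous_intros)

lemma cutoff_eq_0: "a \<le> t \<Longrightarrow> cutoff a n t = 0"
  by (simp add: cutoff_def)

lemma cutoff_tendsto: "(\<lambda>n. cutoff a n t) \<longlonglongrightarrow> indicator {..<a} t"
proof (cases "t < a")
  case True
  then have "(\<lambda>n. exp (- ((a - t)\<^sup>2)) ^ n) \<longlonglongrightarrow> 0"
    by (intro LIMSEQ_power_zero) simp
  with True have "(\<lambda>n. exp (- (real n * (max 0 (a - t))\<^sup>2))) \<longlonglongrightarrow> 0"
    by (simp add: exp_of_nat_mult[symmetric])
  from tendsto_diff[OF tendsto_const[of 1] this] True show ?thesis by (simp add: cutoff_def)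
next
  case False
  then show ?thesis by (simp add: cutoff_def)
qed

text \<open>This is the derivative in time of the whole function \<open>cutoff a n\<close>,
  exponential factor included, and not only that of the squared maximum.\<close>

definition max_square_deriv :: "real \<Rightarrow> nat \<Rightarrow> real \<Rightarrow> real" where
  "max_square_deriv a n t = - (2 * real n * max 0 (a - t) * exp (- (real n * (max 0 (a - t))\<^sup>2)))"

text \<open>Squaring removes the kink of the maximum. Only the origin needs a difference quotient,
  which is bounded by the absolute value of the increment.\<close>

lemma has_derivative_max_square: "((\<lambda>t::real. (max 0 t)\<^sup>2) has_real_derivative 2 * max 0 t) (at t)"
proof -
  consider "t < 0" | "t > 0" | "t = 0" by linarith
  then show ?thesis
  proof cases
    case 1
    have "((\<lambda>t::real. 0) has_real_derivative 0) (at t)" by simp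
    then have "((\<lambda>t::real. (max 0 t)\<^sup>2) has_real_derivative 0) (at t)"
      by (rule has_field_derivative_transform_within_open[where S = "{..<0}"]) (use 1 in auto)
    then show ?thesis using 1 by simp
  next
    case 2
    have "((\<lambda>t::real. t\<^sup>2) has_real_derivative 2 * t) (at t)"
      by (auto intro!: derivative_eq_intros)
    then have "((\<lambda>t::real. (max 0 t)\<^sup>2) has_real_derivative 2 * t) (at t)"
      by (rule has_field_derivative_transform_within_open[where S = "{0<..}"]) (use 2 in auto)
    then show ?thesis using 2 by simp
  next
    case 3
    have "((\<lambda>h::real. (max 0 h)\<^sup>2 / h) \<longlongrightarrow> 0) (at 0)"
    proof (rule Lim_null_comparison)
      show "\<forall>\<^sub>F h in at 0. norm ((max 0 h)\<^sup>2 / h) \<le> \<bar>h::real\<bar>"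
        by (rule always_eventually) (auto simp: power2_eq_square max_def)
      show "((\<lambda>h::real. \<bar>h\<bar>) \<longlongrightarrow> 0) (at 0)" by (intro tendsto_eq_intros) auto
    qed
    then show ?thesis using 3 by (simp add: DERIV_def)
  qed
qed

lemma cutoff_has_derivative:
  "(cutoff a n has_real_derivative max_square_deriv a n t) (at t)"
proof -
  have "((\<lambda>t. (max 0 (a - t))\<^sup>2) has_real_derivative (2 * max 0 (a - t)) * (-1)) (at t)"
    by (rule DERIV_chain2[OF has_derivative_max_square]) (auto intro!: derivative_eq_intros)
  from DERIV_cmult[OF this, of "- real n"]
  have "((\<lambda>t. - (real n * (max 0 (a - t))\<^sup>2)) has_real_derivative 2 * real n * max 0 (a - t)) (at t)"
    by (simp add: algebra_simps)
  from DERIV_diff[OF DERIV_const[of 1] DERIV_fun_exp[OF this]]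
  show ?thesis unfolding cutoff_def[abs_def] max_square_deriv_def by (simp add: algebra_simps)
qed

lemma continuous_on_max_square_deriv [continuous_intros]:
  "continuous_on S f \<Longrightarrow> continuous_on S (\<lambda>z. max_square_deriv a n (f z))"
  unfolding max_square_deriv_def by (intro continuous_intros)

text \<open>Dominated convergence with majorant 1. Identities known only for smooth products thereby
  become identities between measures of quadrants.\<close>

lemma cutoff_product_integral_tendsto:
  assumes M: "radon_pos M"
  shows "(\<lambda>n. LINT z|M. cutoff a n (fst z) * cutoff c n (snd z)) \<longlonglongrightarrow> measure M (D \<inter> {..<a} \<times> {..<c})"
proof -
  interpret finite_measure M using radon_posD[OF M] by simp
  have meas: "(\<lambda>z. cutoff a n (fst z) * cutoff c n (snd z)) \<in> borel_measurable M" for n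
    unfolding radon_posD[OF M]
    by (intro borel_measurable_continuous_on_restrict continuous_intros)
  have set: "D \<inter> {..<a} \<times> {..<c} \<in> sets M"
    unfolding radon_posD[OF M] by (rule lower_rect_in_sets)
  have "(\<lambda>n. LINT z|M. cutoff a n (fst z) * cutoff c n (snd z)) \<longlonglongrightarrow>
      (LINT z|M. indicator (D \<inter> {..<a} \<times> {..<c}) z)"
  proof (rule integral_dominated_convergence[where w = "\<lambda>_. 1"])
    show "AE z in M. (\<lambda>n. cutoff a n (fst z) * cutoff c n (snd z)) \<longlonglongrightarrow> indicator (D \<inter> {..<a} \<times> {..<c}) z"
    proof (rule AE_I2)
      fix z assume "z \<in> space M"
      then have "indicator {..<a} (fst z) * indicator {..<c} (snd z) =
          (indicator (D \<inter> {..<a} \<times> {..<c}) z :: real)"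
        using radon_posD[OF M] by (auto simp: indicator_def split: prod.splits)
      with tendsto_mult[OF cutoff_tendsto[of a "fst z"] cutoff_tendsto[of c "snd z"]]
      show "(\<lambda>n. cutoff a n (fst z) * cutoff c n (snd z)) \<longlonglongrightarrow> indicator (D \<inter> {..<a} \<times> {..<c}) z"
        by simp
    qed
  qed (use meas set in \<open>auto simp: abs_mult intro!: mult_le_one cutoff_bounds\<close>)
  then show ?thesis using set by (simp add: sets.sets_into_space Int_absorb1)
qed

lemma measure_D_eqI_cutoff:
  assumes M: "radon_pos M" and N: "radon_pos N"
    and eq: "\<And>a c n. (LINT z|M. cutoff a n (fst z) * cutoff c n (snd z)) =
      (LINT z|N. cutoff a n (fst z) * cutoff c n (snd z))"
  shows "M = N"
  using cutoff_product_integral_tendsto[OF N] cutoff_product_integral_tendsto[OF M]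
  unfolding eq by (intro measure_D_eqI[OF M N] LIMSEQ_unique)

section \<open>The Fisher-Rao functional\<close>

text \<open>The degenerate factor c = 0 is included: the convention that 0 times infinity is 0 in
  \<open>ennreal\<close> agrees with the value of \<open>r\<close> at the origin.\<close>

lemma r_scale: "0 \<le> c \<Longrightarrow> r (c * x) (c * y) = ennreal c * r x y"
proof -
  assume c: "0 \<le> c"
  consider "c = 0" | "c > 0" "x > 0" | "c > 0" "x \<le> 0" using c by linarith
  then show ?thesis
  proof cases
    case 2
    then have "1/4 * ((c * y)\<^sup>2 / (c * x)) = c * (1/4 * (y\<^sup>2 / x))"
      by (simp add: power2_eq_square field_simps)
    with 2 show ?thesis by (simp add: r_def ennreal_mult[symmetric])
  next
    case 3
    then have "\<not> 0 < c * x" by (simp add: mult_nonneg_nonpos not_less)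
    with 3 show ?thesis by (auto simp: r_def ennreal_mult_top)
  qed (simp add: r_def)
qed

lemma r_subadditive: "r (x + x') (y + y') \<le> r x y + r x' y'"
proof -
  consider "x > 0" "x' > 0" | "x = 0" "y = 0" | "x' = 0" "y' = 0"
    | "r x y = \<infinity>" | "r x' y' = \<infinity>"
    unfolding r_def by (cases "x > 0"; cases "x' > 0"; cases "x = 0 \<and> y = 0"; cases "x' = 0 \<and> y' = 0") simp_all
  then show ?thesis
  proof cases
    case 1
    \<comment> \<open>After multiplication by all denominators, the two sides of the Cauchy-Schwarz
      estimate differ exactly by this square.\<close>
    have "0 \<le> (y * x' - y' * x)\<^sup>2" by simp
    then have "(y + y')\<^sup>2 * (x * x') \<le> (y\<^sup>2 * x' + y'\<^sup>2 * x) * (x + x')"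
      by (simp add: power2_eq_square algebra_simps)
    then have "(y + y')\<^sup>2 / (x + x') \<le> y\<^sup>2 / x + y'\<^sup>2 / x'"
      using 1 by (simp add: add_frac_eq frac_le_eq divide_le_eq le_divide_eq algebra_simps)
    then have "1/4 * ((y + y')\<^sup>2 / (x + x')) \<le> 1/4 * (y\<^sup>2 / x) + 1/4 * (y'\<^sup>2 / x')"
      by linarith
    with 1 show ?thesis
      by (simp add: r_def ennreal_plus[symmetric] del: ennreal_plus)
  qed (simp_all add: r_def)
qed

lemma r_convex:
  assumes "0 \<le> s" "s \<le> 1"
  shows "r ((1 - s) * x + s * x') ((1 - s) * y + s * y') \<le> ennreal (1 - s) * r x y + ennreal s * r x' y'"
  using r_subadditive[of "(1 - s) * x" "s * x'" "(1 - s) * y" "s * y'"] assms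
  by (simp add: r_scale)

lemma r_measurable [measurable]:
  assumes [measurable]: "g \<in> borel_measurable M" "h \<in> borel_measurable M"
  shows "(\<lambda>z. r (g z) (h z)) \<in> borel_measurable M"
  unfolding r_def by measurable

lemma r_eq_0_iff: "r x y = 0 \<longleftrightarrow> 0 \<le> x \<and> y = 0"
  by (auto simp: r_def ennreal_eq_0_iff divide_le_0_iff power2_eq_square zero_le_mult_iff mult_le_0_iff)

section \<open>Densities and independence of the dominating measure\<close>

lemma has_density_cong:
  assumes "\<And>A. A \<in> sets borel_D \<Longrightarrow> smeasure \<mu> A = smeasure \<nu> A" "radon_pos m"
  shows "has_density \<mu> m g \<longleftrightarrow> has_density \<nu> m g"
  using assms by (auto simp: has_density_def radon_posD)

text \<open>\<open>dt_meas\<close> is an arbitrary choice among pairs with the same difference. This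
  allows it to be exchanged for any other representative.\<close>

lemma FR_cong:
  assumes "\<And>A. A \<in> sets borel_D \<Longrightarrow> smeasure \<nu> A = smeasure \<nu>' A"
  shows "FR f \<mu> \<nu> = FR f \<mu> \<nu>'"
  unfolding FR_def
  by (intro arg_cong[where f = The] ext ex_cong1 conj_cong refl) (simp add: has_density_cong[OF assms])

lemma has_density_unique:
  assumes "has_density \<nu> m g" "has_density \<nu> m h"
  shows "AE z in m. g z = h z"
  using assms by (intro density_unique_real) (auto simp: has_density_def)

lemma has_density_density:
  assumes "has_density \<nu> (density n (\<lambda>z. ennreal (a z))) g"
    and a [measurable]: "a \<in> borel_measurable n" "\<And>z. 0 \<le> a z"
  shows "has_density \<nu> n (\<lambda>z. a z * g z)"
proof -
  have g: "integrable (density n (\<lambda>z. ennreal (a z))) g"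
    using assms by (simp add: has_density_def)
  then have [measurable]: "g \<in> borel_measurable n" by auto
  show ?thesis
    unfolding has_density_def
  proof (intro conjI ballI)
    show "integrable n (\<lambda>z. a z * g z)" using g a by (subst (asm) integrable_density) auto
    fix A assume A [measurable]: "A \<in> sets n"
    then have "smeasure \<nu> A = (LINT z:A|density n (\<lambda>z. ennreal (a z)). g z)"
      using assms by (simp add: has_density_def)
    also have "\<dots> = (LINT z:A|n. a z * g z)"
      unfolding set_lebesgue_integral_def using a
      by (subst integral_density) (auto intro!: Bochner_Integration.integral_cong)
    finally show "smeasure \<nu> A = (LINT z:A|n. a z * g z)" .
  qed
qed

lemma radon_density_exists:
  assumes n: "radon_pos n" and m: "radon_pos m" and ac: "absolutely_continuous n m"
  obtains a where "a \<in> borel_measurable n" "\<And>z. (0::real) \<le> a z" "m = density n (\<lambda>z. ennreal (a z))"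
    "has_density (signed_of m) n a"
proof -
  interpret n: finite_measure n using radon_posD[OF n] by simp
  interpret m: finite_measure m using radon_posD[OF m] by simp
  have sets: "sets m = sets n" using radon_posD[OF n] radon_posD[OF m] by simp
  obtain a where a [measurable]: "a \<in> borel_measurable n" and RN: "AE x in n. RN_deriv n m x = ennreal (a x)"
    and nn: "\<And>x. 0 \<le> a x"
    using n.real_RN_deriv[OF m.finite_measure_axioms ac sets] by metis
  have eq: "m = density n (\<lambda>z. ennreal (a z))"
    using n.density_RN_deriv[OF ac sets] density_cong[OF _ _ RN] by simp
  \<comment> \<open>With respect to itself \<open>m\<close> has density 1; passing to the dominating
    measure \<open>n\<close> turns this into the density \<open>a\<close>.\<close>
  have "has_density (signed_of m) (density n (\<lambda>z. ennreal (a z))) (\<lambda>_. 1)"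
    unfolding eq[symmetric] has_density_def
    by (auto simp: smeasure_def signed_of_def zero_meas_def set_lebesgue_integral_def
        sets.sets_into_space Int_absorb2)
  from has_density_density[OF this a nn] have "has_density (signed_of m) n a" by simp
  with a nn eq show thesis by (rule that)
qed

lemma has_density_lincomb:
  assumes g: "has_density \<mu> m g" and h: "has_density \<nu> m h"
    and eq: "\<And>A. A \<in> sets m \<Longrightarrow> smeasure \<kappa> A = c * smeasure \<mu> A + d * smeasure \<nu> A"
  shows "has_density \<kappa> m (\<lambda>z. c * g z + d * h z)"
  unfolding has_density_def
proof (intro conjI ballI)
  show "integrable m (\<lambda>z. c * g z + d * h z)" using g h by (auto simp: has_density_def)
  fix A assume A: "A \<in> sets m"
  then have "set_integrable m A g" "set_integrable m A h"
    using g h unfolding set_integrable_def has_density_def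
    by (auto intro!: integrable_mult_indicator simp del: real_scaleR_def)
  then show "smeasure \<kappa> A = (LINT z:A|m. c * g z + d * h z)"
    using g h A by (simp add: eq has_density_def)
qed

lemma radon_signed_density_exists:
  assumes n: "radon_pos n" and \<nu>: "radon_signed \<nu>"
    and ac: "absolutely_continuous n (fst \<nu>)" "absolutely_continuous n (snd \<nu>)"
  obtains h where "has_density \<nu> n h"
proof -
  have \<nu>': "radon_pos (fst \<nu>)" "radon_pos (snd \<nu>)" using \<nu> by (auto simp: radon_signed_def)
  obtain a where a: "has_density (signed_of (fst \<nu>)) n a"
    using radon_density_exists[OF n \<nu>'(1) ac(1)] by metis
  obtain b where b: "has_density (signed_of (snd \<nu>)) n b"
    using radon_density_exists[OF n \<nu>'(2) ac(2)] by metis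
  have "has_density \<nu> n (\<lambda>z. 1 * a z + (-1) * b z)"
    by (rule has_density_lincomb[OF a b])
      (simp add: smeasure_def signed_of_def zero_meas_def)
  then show thesis by (rule that)
qed

lemma absolutely_continuous_mix_meas:
  assumes "sets N = sets M" "0 < s" "s < 1"
  shows "absolutely_continuous (mix_meas s M N) M" "absolutely_continuous (mix_meas s M N) N"
  using assms by (auto simp: absolutely_continuous_def null_sets_def emeasure_mix_meas)

text \<open>Both members of an average with weight 1/2 are absolutely continuous with respect to it,
  so iterated averaging dominates a whole list while staying finite.\<close>

lemma radon_dominating_exists:
  assumes "\<forall>M\<in>set Ms. radon_pos M"
  shows "\<exists>n. radon_pos n \<and> (\<forall>M\<in>set Ms. absolutely_continuous n M)"
  using assms
proof (induction Ms)
  case Nil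
  show ?case using radon_pos_zero by auto
next
  case (Cons M Ms)
  then obtain n where n: "radon_pos n" "\<forall>M\<in>set Ms. absolutely_continuous n M" by auto
  have "sets M = sets n" using Cons n by (simp add: radon_pos_def)
  note ac = absolutely_continuous_mix_meas[OF this, of "1/2"]
  have "radon_pos (mix_meas (1/2) n M)" using Cons n by (intro radon_pos_mix) auto
  moreover have "absolutely_continuous (mix_meas (1/2) n M) N" if "N \<in> set (M # Ms)" for N
    using that n ac unfolding absolutely_continuous_def by auto
  ultimately show ?case by blast
qed

text \<open>Both integrals are transferred to a common dominating measure. The Radon-Nikodym factor
  is absorbed by the homogeneity of \<open>r\<close>, and densities with respect to one measure are
  unique almost everywhere.\<close>

lemma FR_integral_invariant:
  assumes m: "radon_pos m" "has_density \<mu> m g" "has_density \<nu> m h"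
    and m': "radon_pos m'" "has_density \<mu> m' g'" "has_density \<nu> m' h'"
    and f: "f \<in> borel_measurable borel_D"
  shows "(\<integral>\<^sup>+z. r (g z) (h z) * ennreal (f z) \<partial>m) = (\<integral>\<^sup>+z. r (g' z) (h' z) * ennreal (f z) \<partial>m')"
proof -
  obtain n where n: "radon_pos n" "absolutely_continuous n m" "absolutely_continuous n m'"
    using radon_dominating_exists[of "[m, m']"] m m' by auto
  have red: "\<exists>G H. has_density \<mu> n G \<and> has_density \<nu> n H \<and>
      (\<integral>\<^sup>+z. r (g z) (h z) * ennreal (f z) \<partial>m) = (\<integral>\<^sup>+z. r (G z) (H z) * ennreal (f z) \<partial>n)"
    if m: "radon_pos m" "has_density \<mu> m g" "has_density \<nu> m h" and ac: "absolutely_continuous n m" for m g h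
  proof -
    obtain a where a [measurable]: "a \<in> borel_measurable n" and nn: "\<And>z. 0 \<le> a z"
      and eq: "m = density n (\<lambda>z. ennreal (a z))"
      using radon_density_exists[OF n(1) m(1) ac] by metis
    have [measurable]: "f \<in> borel_measurable n" using f radon_posD[OF n(1)] by simp
    have "g \<in> borel_measurable m" "h \<in> borel_measurable m"
      using m by (auto simp: has_density_def)
    then have [measurable]: "g \<in> borel_measurable n" "h \<in> borel_measurable n" by (auto simp: eq)
    have "(\<integral>\<^sup>+z. r (g z) (h z) * ennreal (f z) \<partial>m) =
        (\<integral>\<^sup>+z. ennreal (a z) * (r (g z) (h z) * ennreal (f z)) \<partial>n)"
      unfolding eq by (subst nn_integral_density) auto
    also have "\<dots> = (\<integral>\<^sup>+z. r (a z * g z) (a z * h z) * ennreal (f z) \<partial>n)"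
      using nn by (simp add: r_scale mult.assoc)
    finally show ?thesis
      using has_density_density[OF m(2)[unfolded eq] a nn] has_density_density[OF m(3)[unfolded eq] a nn]
      by blast
  qed
  obtain G H where GH: "has_density \<mu> n G" "has_density \<nu> n H"
    "(\<integral>\<^sup>+z. r (g z) (h z) * ennreal (f z) \<partial>m) = (\<integral>\<^sup>+z. r (G z) (H z) * ennreal (f z) \<partial>n)"
    using red[OF m n(2)] by blast
  obtain G' H' where GH': "has_density \<mu> n G'" "has_density \<nu> n H'"
    "(\<integral>\<^sup>+z. r (g' z) (h' z) * ennreal (f z) \<partial>m') = (\<integral>\<^sup>+z. r (G' z) (H' z) * ennreal (f z) \<partial>n)"
    using red[OF m' n(3)] by blast
  have "AE z in n. r (G z) (H z) * ennreal (f z) = r (G' z) (H' z) * ennreal (f z)"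
    using has_density_unique[OF GH(1) GH'(1)] has_density_unique[OF GH(2) GH'(2)]
    by eventually_elim simp
  with GH GH' show ?thesis by (simp cong: nn_integral_cong_AE)
qed

text \<open>Resolves the definite description in \<open>FR\<close>: the value may be computed with
  whichever dominating measure is convenient.\<close>

lemma FR_eqI:
  assumes "radon_pos m" "has_density \<mu> m g" "has_density \<nu> m h" "f \<in> borel_measurable borel_D"
  shows "FR f \<mu> \<nu> = (\<integral>\<^sup>+z. r (g z) (h z) * ennreal (f z) \<partial>m)"
  unfolding FR_def
proof (rule the_equality)
  show "\<exists>m' g' h'. radon_pos m' \<and> has_density \<mu> m' g' \<and> has_density \<nu> m' h' \<and>
      (\<integral>\<^sup>+z. r (g z) (h z) * ennreal (f z) \<partial>m) = (\<integral>\<^sup>+z. r (g' z) (h' z) * ennreal (f z) \<partial>m')"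
    using assms by blast
qed (use FR_integral_invariant[OF _ _ _ assms] in blast)

section \<open>Convexity and vanishing of the Fisher-Rao term\<close>

definition mix_signed :: "real \<Rightarrow> signed_meas \<Rightarrow> signed_meas \<Rightarrow> signed_meas" where
  "mix_signed s \<mu> \<nu> = (mix_meas s (fst \<mu>) (fst \<nu>), mix_meas s (snd \<mu>) (snd \<nu>))"

lemma radon_signed_mix: "radon_signed \<mu> \<Longrightarrow> radon_signed \<nu> \<Longrightarrow> radon_signed (mix_signed s \<mu> \<nu>)"
  by (simp add: radon_signed_def mix_signed_def radon_pos_mix)

lemma smeasure_mix_signed:
  assumes "radon_signed \<mu>" "radon_signed \<nu>" "s \<in> {0..1}" "A \<in> sets borel_D"
  shows "smeasure (mix_signed s \<mu> \<nu>) A = (1 - s) * smeasure \<mu> A + s * smeasure \<nu> A"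
  using assms by (simp add: smeasure_def mix_signed_def radon_signed_def radon_pos_def
      measure_mix_meas algebra_simps)

text \<open>A single measure dominates the two positive measures and all four components of the
  signed ones. Densities then mix linearly and the joint convexity of \<open>r\<close> applies
  pointwise.\<close>

lemma FR_convex:
  assumes M: "radon_pos M" and N: "radon_pos N" and \<mu>: "radon_signed \<mu>" and \<nu>: "radon_signed \<nu>"
    and s: "0 \<le> s" "s \<le> 1" and f [measurable]: "f \<in> borel_measurable borel_D"
  shows "FR f (signed_of (mix_meas s M N)) (mix_signed s \<mu> \<nu>) \<le>
    ennreal (1 - s) * FR f (signed_of M) \<mu> + ennreal s * FR f (signed_of N) \<nu>"
proof -
  obtain n where n: "radon_pos n" and ac: "absolutely_continuous n M" "absolutely_continuous n N"
      "absolutely_continuous n (fst \<mu>)" "absolutely_continuous n (snd \<mu>)"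
      "absolutely_continuous n (fst \<nu>)" "absolutely_continuous n (snd \<nu>)"
    using radon_dominating_exists[of "[M, N, fst \<mu>, snd \<mu>, fst \<nu>, snd \<nu>]"] M N \<mu> \<nu>
    by (auto simp: radon_signed_def)
  obtain g where g: "has_density (signed_of M) n g" using radon_density_exists[OF n M ac(1)] by metis
  obtain g' where g': "has_density (signed_of N) n g'" using radon_density_exists[OF n N ac(2)] by metis
  obtain h where h: "has_density \<mu> n h" using radon_signed_density_exists[OF n \<mu> ac(3,4)] .
  obtain h' where h': "has_density \<nu> n h'" using radon_signed_density_exists[OF n \<nu> ac(5,6)] .
  have [measurable]: "g \<in> borel_measurable n" "g' \<in> borel_measurable n" "h \<in> borel_measurable n"
    "h' \<in> borel_measurable n" "f \<in> borel_measurable n"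
    using g g' h h' f radon_posD[OF n] by (auto simp: has_density_def)
  have G: "has_density (signed_of (mix_meas s M N)) n (\<lambda>z. (1 - s) * g z + s * g' z)"
    by (rule has_density_lincomb[OF g g'])
      (use M N s radon_posD[OF n] in \<open>simp add: smeasure_def signed_of_def zero_meas_def radon_pos_def measure_mix_meas\<close>)
  have H: "has_density (mix_signed s \<mu> \<nu>) n (\<lambda>z. (1 - s) * h z + s * h' z)"
    by (rule has_density_lincomb[OF h h'])
      (use \<mu> \<nu> s radon_posD[OF n] in \<open>simp add: smeasure_mix_signed\<close>)
  have "FR f (signed_of (mix_meas s M N)) (mix_signed s \<mu> \<nu>) =
      (\<integral>\<^sup>+z. r ((1 - s) * g z + s * g' z) ((1 - s) * h z + s * h' z) * ennreal (f z) \<partial>n)"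
    by (rule FR_eqI[OF n G H f])
  also have "\<dots> \<le> (\<integral>\<^sup>+z. ennreal (1 - s) * (r (g z) (h z) * ennreal (f z)) +
      ennreal s * (r (g' z) (h' z) * ennreal (f z)) \<partial>n)"
  proof (rule nn_integral_mono)
    fix z
    show "r ((1 - s) * g z + s * g' z) ((1 - s) * h z + s * h' z) * ennreal (f z) \<le>
        ennreal (1 - s) * (r (g z) (h z) * ennreal (f z)) + ennreal s * (r (g' z) (h' z) * ennreal (f z))"
      using mult_right_mono[OF r_convex[OF s, of "g z" "g' z" "h z" "h' z"], of "ennreal (f z)"]
      by (simp add: algebra_simps)
  qed
  also have "\<dots> = ennreal (1 - s) * (\<integral>\<^sup>+z. r (g z) (h z) * ennreal (f z) \<partial>n) +
      ennreal s * (\<integral>\<^sup>+z. r (g' z) (h' z) * ennreal (f z) \<partial>n)"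
    by (simp add: nn_integral_add nn_integral_cmult)
  also have "\<dots> = ennreal (1 - s) * FR f (signed_of M) \<mu> + ennreal s * FR f (signed_of N) \<nu>"
    by (simp add: FR_eqI[OF n g h f] FR_eqI[OF n g' h' f])
  finally show ?thesis .
qed

lemma FR_zero:
  assumes "\<And>A. A \<in> sets borel_D \<Longrightarrow> smeasure \<nu> A = 0" and f: "f \<in> borel_measurable borel_D"
  shows "FR f (signed_of zero_meas) \<nu> = 0"
proof -
  have "has_density (signed_of zero_meas) zero_meas (\<lambda>_. 0)" "has_density \<nu> zero_meas (\<lambda>_. 0)"
    using assms by (auto simp: has_density_def signed_of_def smeasure_def zero_meas_def set_lebesgue_integral_def)
  from FR_eqI[OF radon_pos_zero this f] show ?thesis by (simp add: r_def)
qed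

text \<open>Since the weight is positive, the integrand can vanish only where \<open>r\<close> does,
  and there the density of \<nu> is 0.\<close>

lemma FR_eq_0_imp:
  assumes M: "radon_pos M" and \<nu>: "radon_signed \<nu>" and f: "f \<in> borel_measurable borel_D"
    and pos: "\<And>z. z \<in> D \<Longrightarrow> 0 < f z" and zero: "FR f (signed_of M) \<nu> = 0"
    and A: "A \<in> sets borel_D"
  shows "smeasure \<nu> A = 0"
proof -
  obtain n where n: "radon_pos n" and ac: "absolutely_continuous n M"
      "absolutely_continuous n (fst \<nu>)" "absolutely_continuous n (snd \<nu>)"
    using radon_dominating_exists[of "[M, fst \<nu>, snd \<nu>]"] M \<nu> by (auto simp: radon_signed_def)
  obtain g where g: "has_density (signed_of M) n g" using radon_density_exists[OF n M ac(1)] by metis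
  obtain h where h: "has_density \<nu> n h" using radon_signed_density_exists[OF n \<nu> ac(2,3)] .
  have [measurable]: "g \<in> borel_measurable n" "h \<in> borel_measurable n" "f \<in> borel_measurable n"
    using g h f radon_posD[OF n] by (auto simp: has_density_def)
  have "(\<integral>\<^sup>+z. r (g z) (h z) * ennreal (f z) \<partial>n) = 0"
    using zero FR_eqI[OF n g h f] by simp
  then have "AE z in n. r (g z) (h z) * ennreal (f z) = 0" by (subst (asm) nn_integral_0_iff_AE) auto
  then have "AE z in n. h z = 0"
    using AE_space
  proof eventually_elim
    case (elim z)
    then have "0 < f z" using pos radon_posD[OF n] by auto
    with elim show ?case by (auto simp: r_eq_0_iff ennreal_eq_0_iff)
  qed
  then have "(LINT z:A|n. h z) = (LINT z:A|n. 0)"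
    unfolding set_lebesgue_integral_def
    by (intro integral_cong_AE) (use A radon_posD[OF n] in auto)
  then show ?thesis using h A radon_posD[OF n] by (simp add: has_density_def)
qed

section \<open>The time derivative of a measure\<close>

text \<open>The bound on \<open>a\<close> makes the factor in time vanish at t = 1, as
  \<open>C1_test\<close> demands.\<close>

lemma C1_test_cutoff:
  assumes "a \<le> 1"
  shows "C1_test (\<lambda>z. cutoff a n (fst z) * cutoff c n (snd z))
    (\<lambda>z. max_square_deriv a n (fst z) * cutoff c n (snd z))"
  unfolding C1_test_def
proof (intro conjI ballI)
  show "continuous_on D (\<lambda>z. cutoff a n (fst z) * cutoff c n (snd z))"
    by (intro continuous_on_mult continuous_on_cutoff continuous_on_fst continuous_on_snd continuous_on_id)
  show
    "continuous_on D (\<lambda>z. max_square_deriv a n (fst z) * cutoff c n (snd z))"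
    by (intro continuous_on_mult continuous_on_cutoff continuous_on_max_square_deriv
        continuous_on_fst continuous_on_snd continuous_on_id)
  fix x
  show "cutoff a n (fst (1, x)) * cutoff c n (snd (1, x)) = 0"
    using assms by (simp add: cutoff_eq_0)
  fix t
  show "((\<lambda>s. cutoff a n (fst (s, x)) * cutoff c n (snd (s, x))) has_real_derivative
      max_square_deriv a n (fst (t, x)) * cutoff c n (snd (t, x))) (at t within {0..1})"
    unfolding fst_conv snd_conv
    by (rule DERIV_cmult_right[OF has_field_derivative_at_within[OF cutoff_has_derivative]])
qed

lemma C1_test_D:
  assumes "C1_test f ft"
  shows "continuous_on D f" "continuous_on D ft"
  using assms by (auto simp: C1_test_def)

lemma has_dt_test: "has_dt \<Delta> \<delta> \<Longrightarrow> C1_test f ft \<Longrightarrow> (LINT z|\<Delta>. ft z) + sintegral \<delta> f = 0"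
  unfolding has_dt_def by blast

lemma has_dt_D:
  assumes "has_dt \<Delta> \<delta>"
  shows "radon_signed \<delta>" "radon_pos (fst \<delta>)" "radon_pos (snd \<delta>)"
    "emeasure (fst \<delta>) ({1} \<times> {0..1}) = 0" "emeasure (snd \<delta>) ({1} \<times> {0..1}) = 0"
  using assms unfolding has_dt_def radon_signed_def by blast+

lemma sintegral_mix_signed:
  assumes "radon_signed \<mu>" "radon_signed \<nu>" "s \<in> {0..1}" "continuous_on D f"
  shows "sintegral (mix_signed s \<mu> \<nu>) f = (1 - s) * sintegral \<mu> f + s * sintegral \<nu> f"
proof -
  have "sets (fst \<nu>) = sets (fst \<mu>)" "sets (snd \<nu>) = sets (snd \<mu>)"
    using assms by (simp_all add: radon_signed_def radon_pos_def)
  moreover have "integrable (fst \<mu>) f" "integrable (fst \<nu>) f" "integrable (snd \<mu>) f" "integrable (snd \<nu>) f"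
    using assms by (auto simp: radon_signed_def intro!: radon_pos_integrable_continuous)
  ultimately show ?thesis
    using assms by (simp add: sintegral_def mix_signed_def integral_mix_meas algebra_simps)
qed

lemma right_edge_in_sets: "{1} \<times> {0..1} \<in> sets borel_D"
  by (auto simp: sets_borel_D intro!: borel_closed closed_Times)

lemma has_dt_mix:
  assumes M: "radon_pos M" and N: "radon_pos N" and \<mu>: "has_dt M \<mu>" and \<nu>: "has_dt N \<nu>" and s: "s \<in> {0..1}"
  shows "has_dt (mix_meas s M N) (mix_signed s \<mu> \<nu>)"
  unfolding has_dt_def
proof (intro conjI allI impI)
  note rs = has_dt_D(1)[OF \<mu>] has_dt_D(1)[OF \<nu>]
  then show "radon_signed (mix_signed s \<mu> \<nu>)" by (rule radon_signed_mix)
  have "sets (fst \<nu>) = sets (fst \<mu>)" "sets (snd \<nu>) = sets (snd \<mu>)"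
      "sets (fst \<mu>) = sets borel_D" "sets (snd \<mu>) = sets borel_D"
    using rs by (simp_all add: radon_signed_def radon_pos_def)
  then show "emeasure (fst (mix_signed s \<mu> \<nu>)) ({1} \<times> {0..1}) = 0"
    "emeasure (snd (mix_signed s \<mu> \<nu>)) ({1} \<times> {0..1}) = 0"
    using has_dt_D(4,5)[OF \<mu>] has_dt_D(4,5)[OF \<nu>] right_edge_in_sets
    by (simp_all add: mix_signed_def emeasure_mix_meas)
  fix f ft assume f: "C1_test f ft"
  have eq: "(LINT z|M. ft z) = - sintegral \<mu> f" "(LINT z|N. ft z) = - sintegral \<nu> f"
    using has_dt_test[OF \<mu> f] has_dt_test[OF \<nu> f] by linarith+
  have "(LINT z|mix_meas s M N. ft z) = (1 - s) * (LINT z|M. ft z) + s * (LINT z|N. ft z)"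
    using M N s C1_test_D[OF f]
    by (intro integral_mix_meas) (auto simp: radon_pos_def intro!: radon_pos_integrable_continuous[unfolded radon_pos_def])
  moreover have "sintegral (mix_signed s \<mu> \<nu>) f = (1 - s) * sintegral \<mu> f + s * sintegral \<nu> f"
    using rs s C1_test_D[OF f] by (intro sintegral_mix_signed)
  ultimately show "(LINT z|mix_meas s M N. ft z) + sintegral (mix_signed s \<mu> \<nu>) f = 0"
    unfolding eq by (simp add: algebra_simps)
qed

lemma has_dt_zero: "has_dt zero_meas (zero_meas, zero_meas)"
  by (simp add: has_dt_def radon_signed_def radon_pos_zero sintegral_def) (simp add: zero_meas_def)

lemma has_dt_dt_meas: "has_dt \<Delta> \<delta> \<Longrightarrow> has_dt \<Delta> (dt_meas \<Delta>)"
  unfolding dt_meas_def by (rule someI)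

text \<open>Moving the negative parts across turns an equality of differences into an equality of
  sums of positive measures, to which uniqueness results for measures apply. The average with weight
  1/2 plays the role of the sum.\<close>

lemma smeasure_eq_iff_mix_eq:
  assumes \<mu>: "radon_signed \<mu>" and \<nu>: "radon_signed \<nu>" and A: "A \<in> sets borel_D"
  shows "smeasure \<mu> A = smeasure \<nu> A \<longleftrightarrow>
    measure (mix_meas (1/2) (fst \<mu>) (snd \<nu>)) A = measure (mix_meas (1/2) (fst \<nu>) (snd \<mu>)) A"
  using assms by (auto simp: smeasure_def radon_signed_def radon_pos_def measure_mix_meas)

text \<open>Test functions vanish at t = 1, so the weak formula reaches only quadrants with
  \<open>a\<close> at most 1. Larger quadrants add nothing but the edge at t = 1, which
  \<open>has_dt\<close> makes a null set for both components.\<close>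

lemma has_dt_unique:
  assumes \<mu>: "has_dt \<Delta> \<mu>" and \<nu>: "has_dt \<Delta> \<nu>" and A: "A \<in> sets borel_D"
  shows "smeasure \<mu> A = smeasure \<nu> A"
proof -
  let ?L = "mix_meas (1/2) (fst \<mu>) (snd \<nu>)" and ?R = "mix_meas (1/2) (fst \<nu>) (snd \<mu>)"
  note rs = has_dt_D(1)[OF \<mu>] has_dt_D(1)[OF \<nu>]
  note r = has_dt_D(2,3)[OF \<mu>] has_dt_D(2,3)[OF \<nu>]
  from r have LR: "radon_pos ?L" "radon_pos ?R" by (auto intro: radon_pos_mix)
  have lower: "measure ?L (D \<inter> {..<a} \<times> {..<c}) = measure ?R (D \<inter> {..<a} \<times> {..<c})" if a: "a \<le> 1" for a c
  proof -
    let ?f = "\<lambda>n z. cutoff a n (fst z) * cutoff c n (snd z)"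
    have "(LINT z|?L. ?f n z) = (LINT z|?R. ?f n z)" for n
    proof -
      have cont: "continuous_on D (?f n)" by (intro continuous_intros)
      note int = r[THEN radon_pos_integrable_continuous, OF cont]
      have "sintegral \<mu> (?f n) = sintegral \<nu> (?f n)"
        using has_dt_test[OF \<mu> C1_test_cutoff[OF a, of n c]] has_dt_test[OF \<nu> C1_test_cutoff[OF a, of n c]]
        by linarith
      moreover have "(LINT z|?L. ?f n z) = 1/2 * (LINT z|fst \<mu>. ?f n z) + 1/2 * (LINT z|snd \<nu>. ?f n z)"
        "(LINT z|?R. ?f n z) = 1/2 * (LINT z|fst \<nu>. ?f n z) + 1/2 * (LINT z|snd \<mu>. ?f n z)"
        using integral_mix_meas[of "snd \<nu>" "fst \<mu>" "?f n" "1/2"]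
          integral_mix_meas[of "snd \<mu>" "fst \<nu>" "?f n" "1/2"] int r
        by (simp_all add: radon_pos_def)
      ultimately show ?thesis by (simp add: sintegral_def)
    qed
    with cutoff_product_integral_tendsto[OF LR(1), of a c] cutoff_product_integral_tendsto[OF LR(2), of a c]
    show ?thesis by (simp add: LIMSEQ_unique)
  qed
  have clip: "measure M (D \<inter> {..<a} \<times> {..<c}) = measure M (D \<inter> {..<min a 1} \<times> {..<c})"
    if M: "radon_pos M" and null: "emeasure M ({1} \<times> {0..1}) = 0" for M a c
  proof -
    have sets: "D \<inter> {..<b} \<times> {..<c} \<in> sets M" for b
      unfolding radon_posD[OF M] by (rule lower_rect_in_sets)
    have "{1} \<times> {0..1} \<in> null_sets M"
      using null right_edge_in_sets radon_posD(1)[OF M] by (intro null_setsI) simp_all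
    from AE_not_in[OF this]
    have "AE z in M. z \<in> D \<inter> {..<a} \<times> {..<c} \<longleftrightarrow> z \<in> D \<inter> {..<min a 1} \<times> {..<c}"
      by (rule eventually_mono) force
    then show ?thesis using sets sets by (rule measure_eq_AE)
  qed
  have null: "emeasure ?L ({1} \<times> {0..1}) = 0" "emeasure ?R ({1} \<times> {0..1}) = 0"
    using has_dt_D(4,5)[OF \<mu>] has_dt_D(4,5)[OF \<nu>] r right_edge_in_sets
    by (simp_all add: emeasure_mix_meas radon_pos_def)
  have "?L = ?R"
    using LR
  proof (rule measure_D_eqI)
    fix a c
    show "measure ?L (D \<inter> {..<a} \<times> {..<c}) = measure ?R (D \<inter> {..<a} \<times> {..<c})"
      using clip[OF LR(1) null(1), of a c] clip[OF LR(2) null(2), of a c] lower[of "min a 1" c] by simp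
  qed
  then show ?thesis using smeasure_eq_iff_mix_eq[OF rs A] by simp
qed

lemma has_dt_zero_imp_zero:
  assumes \<Delta>: "radon_pos \<Delta>" and \<delta>: "has_dt \<Delta> \<delta>" and zero: "\<And>A. A \<in> sets borel_D \<Longrightarrow> smeasure \<delta> A = 0"
  shows "\<Delta> = zero_meas"
proof -
  interpret finite_measure \<Delta> using radon_posD[OF \<Delta>] by simp
  note r = has_dt_D(2,3)[OF \<delta>]
  \<comment> \<open>Equality of the two components as measures, rather than of their values on sets
    one by one, makes \<open>sintegral\<close> vanish for every integrand.\<close>
  have "fst \<delta> = snd \<delta>"
    using r
  proof (rule measure_D_eqI)
    fix a c
    show "measure (fst \<delta>) (D \<inter> {..<a} \<times> {..<c}) = measure (snd \<delta>) (D \<inter> {..<a} \<times> {..<c})"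
      using zero[OF lower_rect_in_sets[of a c]] unfolding smeasure_def by linarith
  qed
  moreover have "C1_test (\<lambda>z. fst z - 1) (\<lambda>_. 1)"
    unfolding C1_test_def
  proof (intro conjI ballI)
    show "continuous_on D (\<lambda>z. fst z - 1)"
      by (intro continuous_on_diff continuous_on_fst continuous_on_id continuous_on_const)
    show "continuous_on D (\<lambda>_. 1::real)" by (rule continuous_on_const)
    fix t x :: real
    show "fst (1, x) - 1 = (0::real)" by simp
    show "((\<lambda>s. fst (s, x) - 1) has_real_derivative 1) (at t within {0..1})"
      using DERIV_diff[OF DERIV_ident DERIV_const[of 1]] by simp
  qed
  moreover from this have "(LINT z|\<Delta>. 1) + sintegral \<delta> (\<lambda>z. fst z - 1) = 0"
    by (rule has_dt_test[OF \<delta>])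
  ultimately have "(LINT z|\<Delta>. 1) = (0::real)" by (simp add: sintegral_def)
  then have "measure \<Delta> (space \<Delta>) = 0" by simp
  then have "emeasure \<Delta> (space \<Delta>) = 0" unfolding emeasure_eq_measure by simp
  then have zero: "emeasure \<Delta> A = 0" if "A \<in> sets \<Delta>" for A
    using emeasure_mono[OF sets.sets_into_space[OF that] sets.top] by (metis le_zero_eq)
  show ?thesis
  proof (rule measure_eqI)
    show "sets \<Delta> = sets zero_meas" using radon_posD(1)[OF \<Delta>] by (simp add: zero_meas_def)
    show "emeasure \<Delta> A = emeasure zero_meas A" if "A \<in> sets \<Delta>" for A
      using zero[OF that] by (simp add: zero_meas_def)
  qed
qed

section \<open>Stability of \<open>M0\<close> under mixing\<close>

lemma strip_in_sets: "\<epsilon> \<le> 1 \<Longrightarrow> {0..\<epsilon>} \<times> {0..1} \<in> sets borel_D"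
  by (auto simp: sets_borel_D intro!: borel_closed closed_Times)

lemma vanishes_at_0_mix:
  assumes M: "radon_pos M" "vanishes_at_0 M" and N: "radon_pos N" "vanishes_at_0 N" and s: "s \<in> {0..1}"
  shows "vanishes_at_0 (mix_meas s M N)"
  unfolding vanishes_at_0_def
proof (intro allI impI)
  fix g :: "real \<Rightarrow> real" assume g: "continuous_on {0..1} g"
  let ?I = "\<lambda>M \<epsilon>. 1/\<epsilon> * (LINT z:{0..\<epsilon>}\<times>{0..1}|M. g (snd z))"
  have "((\<lambda>\<epsilon>. (1 - s) * ?I M \<epsilon> + s * ?I N \<epsilon>) \<longlongrightarrow> (1 - s) * 0 + s * 0) (at_right 0)"
    using M N g by (intro tendsto_add tendsto_mult tendsto_const) (auto simp: vanishes_at_0_def)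
  moreover have "\<forall>\<^sub>F \<epsilon> in at_right 0. ?I (mix_meas s M N) \<epsilon> = (1 - s) * ?I M \<epsilon> + s * ?I N \<epsilon>"
  proof -
    have "\<forall>\<^sub>F \<epsilon> in at_right 0. \<epsilon> < (1::real)"
      by (rule eventually_at_rightI[of 0 1]) auto
    then show ?thesis
    proof eventually_elim
      case (elim \<epsilon>)
      have cont: "continuous_on D (\<lambda>z. g (snd z))"
        by (rule continuous_on_compose2[OF g]) (auto intro!: continuous_intros)
      have "set_integrable L ({0..\<epsilon>}\<times>{0..1}) (\<lambda>z. g (snd z))" if "radon_pos L" for L
        unfolding set_integrable_def
        using radon_pos_integrable_continuous[OF that cont] strip_in_sets[of \<epsilon>] elim radon_posD[OF that]
        by (intro integrable_mult_indicator) auto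
      with M N have eq: "(LINT z:{0..\<epsilon>}\<times>{0..1}|mix_meas s M N. g (snd z)) =
          (1 - s) * (LINT z:{0..\<epsilon>}\<times>{0..1}|M. g (snd z)) + s * (LINT z:{0..\<epsilon>}\<times>{0..1}|N. g (snd z))"
        unfolding set_lebesgue_integral_def set_integrable_def using s
        by (intro integral_mix_meas) (auto simp: radon_pos_def)
      show ?case unfolding eq by (simp add: algebra_simps add_divide_distrib diff_divide_distrib)
    qed
  qed
  ultimately have "(?I (mix_meas s M N) \<longlongrightarrow> (1 - s) * 0 + s * 0) (at_right 0)"
    by (rule tendsto_cong[THEN iffD2, rotated])
  then show "(?I (mix_meas s M N) \<longlongrightarrow> 0) (at_right 0)" by simp
qed

lemma M0_mix: "M \<in> M0 \<Longrightarrow> N \<in> M0 \<Longrightarrow> s \<in> {0..1} \<Longrightarrow> mix_meas s M N \<in> M0"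
  unfolding M0_def by (intro CollectI conjI radon_pos_mix vanishes_at_0_mix) blast+

lemma zero_in_M0: "zero_meas \<in> M0"
proof -
  have "(LINT z:A|zero_meas. h z) = 0" for A and h :: "real \<times> real \<Rightarrow> real"
    unfolding set_lebesgue_integral_def zero_meas_def by (rule integral_null_measure)
  then have "vanishes_at_0 zero_meas" unfolding vanishes_at_0_def by simp
  with radon_pos_zero show ?thesis unfolding M0_def by blast
qed

section \<open>Disintegration with respect to time\<close>

abbreviation borel_I :: "real measure" where
  "borel_I \<equiv> restrict_space borel {0..1}"

lemma space_leb01: "space leb01 = {0..1}"
  by (simp add: space_restrict_space)

lemma sets_leb01: "sets leb01 = sets borel_I"
  by (simp cong: sets_restrict_space_cong)

lemma measurable_leb01: "measurable leb01 M = measurable borel_I M"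
  by (rule measurable_cong_sets[OF sets_leb01 refl])

lemma space_borel_I: "space borel_I = {0..1}"
  by (simp add: space_restrict_space)

lemma sets_borel_I: "A \<in> sets borel_I \<longleftrightarrow> A \<in> sets borel \<and> A \<subseteq> {0..1}"
  by (subst sets_restrict_space_iff) auto

lemma emeasure_leb01: "A \<subseteq> {0..1} \<Longrightarrow> emeasure leb01 A = emeasure lborel A"
  by (rule emeasure_restrict_space) auto

interpretation leb01: finite_measure leb01
  by standard (simp add: space_leb01 emeasure_leb01)

lemma leb01_total: "emeasure leb01 {0..1} = 1" "measure leb01 {0..1} = 1"
  by (simp_all add: emeasure_leb01 measure_def)

lemma borel_measurable_leb01I: "f \<in> borel_measurable borel \<Longrightarrow> f \<in> borel_measurable leb01"
  by (simp add: measurable_leb01 measurable_restrict_space1)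

lemma leb01_ident [measurable]: "(\<lambda>t. t) \<in> borel_measurable leb01"
  by (intro borel_measurable_leb01I) simp

lemma integral_leb01: "(LINT t|leb01. f t) = (LINT t:{0..1}|lborel. f t)" for f :: "real \<Rightarrow> real"
  unfolding set_lebesgue_integral_def by (rule integral_restrict_space) simp

lemma borel_D_pairI:
  assumes "f \<in> borel_measurable M" "g \<in> borel_measurable M"
    and "\<And>w. w \<in> space M \<Longrightarrow> f w \<in> {0..1} \<and> g w \<in> {0..1}"
  shows "(\<lambda>w. (f w, g w)) \<in> measurable M borel_D"
  using assms by (intro measurable_restrict_space2 borel_measurable_Pair) auto

section \<open>Accumulation of a measure in time\<close>

context
  fixes \<nu> :: "(real \<times> real) measure"
  assumes \<nu>: "radon_pos \<nu>"
begin

interpretation \<nu>: finite_measure \<nu>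
  using radon_posD[OF \<nu>] by simp

interpretation P: pair_sigma_finite leb01 \<nu> ..

lemma pair_components_measurable:
  "fst \<in> borel_measurable (leb01 \<Otimes>\<^sub>M \<nu>)"
  "(\<lambda>w. fst (snd w)) \<in> borel_measurable (leb01 \<Otimes>\<^sub>M \<nu>)"
  "(\<lambda>w. snd (snd w)) \<in> borel_measurable (leb01 \<Otimes>\<^sub>M \<nu>)"
proof -
  have "fst \<in> borel_measurable \<nu>" "snd \<in> borel_measurable \<nu>"
    unfolding radon_posD[OF \<nu>] by (auto intro!: measurable_restrict_space1 simp: borel_prod[symmetric])
  then show "(\<lambda>w. fst (snd w)) \<in> borel_measurable (leb01 \<Otimes>\<^sub>M \<nu>)"
    "(\<lambda>w. snd (snd w)) \<in> borel_measurable (leb01 \<Otimes>\<^sub>M \<nu>)"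
    by measurable
  show "fst \<in> borel_measurable (leb01 \<Otimes>\<^sub>M \<nu>)"
    by (rule measurable_compose[OF measurable_fst leb01_ident])
qed

lemma space_leb01_pair: "space (leb01 \<Otimes>\<^sub>M \<nu>) = {0..1} \<times> D"
  by (simp add: space_pair_measure space_leb01 radon_posD[OF \<nu>])

text \<open>The antiderivative of \<open>\<nu>\<close> in time.\<close>

definition cumulated :: "(real \<times> real) measure" where
  "cumulated = distr (density (leb01 \<Otimes>\<^sub>M \<nu>) (\<lambda>w. ennreal (indicator {..fst w} (fst (snd w)))))
    borel_D (\<lambda>w. (fst w, snd (snd w)))"

lemma cumulated_map_measurable: "(\<lambda>w. (fst w, snd (snd w))) \<in> measurable (leb01 \<Otimes>\<^sub>M \<nu>) borel_D"
  by (intro borel_D_pairI pair_components_measurable) (auto simp: space_leb01_pair)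

lemma cumulated_weight_measurable:
  "(\<lambda>w. indicator {..fst w} (fst (snd w)) :: real) \<in> borel_measurable (leb01 \<Otimes>\<^sub>M \<nu>)"
proof -
  note [measurable] = pair_components_measurable
  have eq: "(\<lambda>w. indicator {..fst w} (fst (snd w)) :: real) = (\<lambda>w. if fst (snd w) \<le> fst w then 1 else 0)"
    by (auto simp: indicator_def)
  show ?thesis unfolding eq by measurable
qed

text \<open>Tonelli, with the time variable kept outside. The slice at time t is the mass that \<nu>
  has accumulated up to t, and the same computation yields the measurability in t that a
  disintegration requires.\<close>

lemma cumulated_slice:
  assumes A: "A \<in> sets borel_D"
  shows "emeasure cumulated A =
      (\<integral>\<^sup>+t. emeasure \<nu> {z\<in>D. fst z \<le> t \<and> snd z \<in> Pair t -` A} \<partial>leb01)" (is ?int)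
    and "(\<lambda>t. emeasure \<nu> {z\<in>D. fst z \<le> t \<and> snd z \<in> Pair t -` A}) \<in> borel_measurable leb01" (is ?meas)
proof -
  note [measurable] = cumulated_map_measurable cumulated_weight_measurable A
  let ?W = "\<lambda>w::real \<times> real \<times> real. ennreal (indicator {..fst w} (fst (snd w)))"
  let ?I = "\<lambda>w::real \<times> real \<times> real. indicator A (fst w, snd (snd w)) :: ennreal"
  have [measurable]: "?I \<in> borel_measurable (leb01 \<Otimes>\<^sub>M \<nu>)"
    by (rule measurable_compose[OF cumulated_map_measurable]) (use A in simp)
  have "emeasure cumulated A = (\<integral>\<^sup>+z. indicator A z \<partial>cumulated)"
    using A by (simp add: cumulated_def)
  also have "\<dots> = (\<integral>\<^sup>+w. ?I w \<partial>density (leb01 \<Otimes>\<^sub>M \<nu>) ?W)"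
    unfolding cumulated_def by (subst nn_integral_distr) (use A in auto)
  also have "\<dots> = (\<integral>\<^sup>+w. ?W w * ?I w \<partial>(leb01 \<Otimes>\<^sub>M \<nu>))"
    by (subst nn_integral_density) auto
  also have "\<dots> = (\<integral>\<^sup>+t. \<integral>\<^sup>+z. ?W (t, z) * ?I (t, z) \<partial>\<nu> \<partial>leb01)"
    by (rule \<nu>.nn_integral_fst[symmetric]) simp
  finally have int: "emeasure cumulated A = (\<integral>\<^sup>+t. \<integral>\<^sup>+z. ?W (t, z) * ?I (t, z) \<partial>\<nu> \<partial>leb01)" .
  have meas: "(\<lambda>t. \<integral>\<^sup>+z. ?W (t, z) * ?I (t, z) \<partial>\<nu>) \<in> borel_measurable leb01"
    by (rule \<nu>.borel_measurable_nn_integral_fst) simp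
  have inner: "(\<integral>\<^sup>+z. ?W (t, z) * ?I (t, z) \<partial>\<nu>) = emeasure \<nu> {z\<in>D. fst z \<le> t \<and> snd z \<in> Pair t -` A}"
    if t: "t \<in> space leb01" for t
  proof -
    have "(\<lambda>z. ?W (t, z) * ?I (t, z)) \<in> borel_measurable \<nu>"
      using t by measurable
    then have "{z \<in> space \<nu>. ?W (t, z) * ?I (t, z) = 1} \<in> sets \<nu>"
      by (rule borel_measurable_eq) simp
    moreover have eq: "{z \<in> space \<nu>. ?W (t, z) * ?I (t, z) = 1} = {z\<in>D. fst z \<le> t \<and> snd z \<in> Pair t -` A}"
      by (auto simp: radon_posD[OF \<nu>] indicator_def split: if_splits)
    ultimately have S: "{z\<in>D. fst z \<le> t \<and> snd z \<in> Pair t -` A} \<in> sets \<nu>" by simp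
    have "(\<integral>\<^sup>+z. ?W (t, z) * ?I (t, z) \<partial>\<nu>) =
        (\<integral>\<^sup>+z. indicator {z\<in>D. fst z \<le> t \<and> snd z \<in> Pair t -` A} z \<partial>\<nu>)"
      by (rule nn_integral_cong) (auto simp: radon_posD[OF \<nu>] indicator_def)
    with S show ?thesis by simp
  qed
  show ?int unfolding int by (rule nn_integral_cong) (rule inner)
  show ?meas using meas by (subst measurable_cong[OF inner[symmetric]])
qed

lemma cumulated_slice_sets:
  assumes "B \<in> sets borel_I"
  shows "{z\<in>D. fst z \<le> t \<and> snd z \<in> B} \<in> sets \<nu>"
proof -
  have "{z\<in>D. fst z \<le> t \<and> snd z \<in> B} = D \<inter> ({..t} \<times> B)" by auto
  moreover have "{..t} \<times> B \<in> sets (borel \<Otimes>\<^sub>M borel)"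
    using assms by (intro pair_measureI) (auto simp: sets_borel_I)
  then have "{..t} \<times> B \<in> sets borel" unfolding borel_prod .
  ultimately show ?thesis
    unfolding radon_posD[OF \<nu>] sets_borel_D by (simp add: sets.Int)
qed

lemma radon_pos_cumulated: "radon_pos cumulated"
proof -
  have "emeasure cumulated D \<le> (\<integral>\<^sup>+t. emeasure \<nu> D \<partial>leb01)"
    unfolding cumulated_slice[of D, OF sets.top[of borel_D, simplified]]
    using radon_posD[OF \<nu>] by (intro nn_integral_mono emeasure_mono) (auto intro: sets.top[of borel_D, simplified])
  also have "\<dots> < \<infinity>"
    by (simp add: space_leb01 leb01_total \<nu>.emeasure_finite less_top[symmetric])
  finally show ?thesis
    by (auto simp: radon_pos_def cumulated_def intro!: finite_measureI)
qed

text \<open>Fubini in the other order: integrating time first over all times after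
  \<open>fst z\<close> produces the backward antiderivative of \<open>u\<close>. Up to sign this is
  the test function whose time derivative is \<open>u * h\<close>. The bounds by 1 give
  integrability and hold for cutoffs.\<close>

lemma integral_cumulated:
  fixes u h :: "real \<Rightarrow> real"
  assumes u: "continuous_on UNIV u" and h: "continuous_on UNIV h"
    and bound: "\<And>t. \<bar>u t\<bar> \<le> 1" "\<And>x. \<bar>h x\<bar> \<le> 1"
  shows "(LINT z|cumulated. u (fst z) * h (snd z)) = (LINT z|\<nu>. integral {fst z..1} u * h (snd z))"
proof -
  note [measurable] = cumulated_map_measurable cumulated_weight_measurable pair_components_measurable
  have [measurable]: "u \<in> borel_measurable borel" "h \<in> borel_measurable borel"
    using u h by (auto intro: borel_measurable_continuous_onI)
  have g [measurable]: "(\<lambda>z. u (fst z) * h (snd z)) \<in> borel_measurable borel_D"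
    by (intro borel_measurable_continuous_on_restrict continuous_intros
        continuous_on_compose2[OF u] continuous_on_compose2[OF h]) auto
  let ?W = "\<lambda>w::real \<times> real \<times> real. indicator {..fst w} (fst (snd w)) :: real"
  have "(LINT z|cumulated. u (fst z) * h (snd z)) =
      (LINT w|density (leb01 \<Otimes>\<^sub>M \<nu>) (\<lambda>w. ennreal (?W w)). u (fst w) * h (snd (snd w)))"
    unfolding cumulated_def by (subst integral_distr[OF _ g]) auto
  also have "\<dots> = (LINT w|(leb01 \<Otimes>\<^sub>M \<nu>). ?W w * (u (fst w) * h (snd (snd w))))"
    by (subst integral_density) auto
  also have "\<dots> = (LINT z|\<nu>. LINT t|leb01. ?W (t, z) * (u t * h (snd z)))"
  proof -
    interpret pm: finite_measure "leb01 \<Otimes>\<^sub>M \<nu>"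
      by (rule finite_measure_pair_measure) unfold_locales
    have "integrable (leb01 \<Otimes>\<^sub>M \<nu>) (\<lambda>w. ?W w * (u (fst w) * h (snd (snd w))))"
      by (rule pm.integrable_const_bound[of _ 1])
        (auto simp: abs_mult indicator_def intro!: mult_le_one bound)
    then have "integrable (leb01 \<Otimes>\<^sub>M \<nu>) (\<lambda>(t, z). ?W (t, z) * (u t * h (snd z)))"
      by (simp add: case_prod_beta')
    from P.integral_snd[OF this] show ?thesis by (simp add: case_prod_beta')
  qed
  also have "\<dots> = (LINT z|\<nu>. integral {fst z..1} u * h (snd z))"
  proof (rule Bochner_Integration.integral_cong[OF refl])
    fix z assume "z \<in> space \<nu>"
    then have z: "0 \<le> fst z" "fst z \<le> 1" using radon_posD[OF \<nu>] by auto
    have cont: "continuous_on {fst z..1} u" using u by (rule continuous_on_subset) simp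
    have "(LINT t|leb01. ?W (t, z) * (u t * h (snd z))) = (LINT t|leb01. indicator {fst z..1} t * u t) * h (snd z)"
      unfolding Bochner_Integration.integral_mult_left_zero[symmetric]
      by (intro Bochner_Integration.integral_cong) (auto simp: indicator_def space_leb01)
    also have "(LINT t|leb01. indicator {fst z..1} t * u t) = (LINT t:{fst z..1}|lborel. u t)"
      unfolding integral_leb01 set_lebesgue_integral_def
      by (intro Bochner_Integration.integral_cong) (use z in \<open>auto simp: indicator_def\<close>)
    also have "\<dots> = integral {fst z..1} u"
      by (rule set_borel_integral_eq_integral(2)[OF borel_integrable_atLeastAtMost'[OF cont]])
    finally show "(LINT t|leb01. ?W (t, z) * (u t * h (snd z))) = integral {fst z..1} u * h (snd z)" .
  qed
  finally show ?thesis .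
qed

lemma cumulated_mono:
  assumes "B \<in> sets borel_I" "s \<le> t"
  shows "emeasure \<nu> {z\<in>D. fst z \<le> s \<and> snd z \<in> B} \<le> emeasure \<nu> {z\<in>D. fst z \<le> t \<and> snd z \<in> B}"
  using assms cumulated_slice_sets by (intro emeasure_mono) auto

text \<open>Continuity from above of a finite measure. It gives right-continuity because the
  accumulated mass includes the time \<open>t\<close> itself.\<close>

lemma cumulated_right_cont:
  assumes "B \<in> sets borel_I"
  shows "(\<lambda>n. emeasure \<nu> {z\<in>D. fst z \<le> t + 1 / real (Suc n) \<and> snd z \<in> B}) \<longlonglongrightarrow>
    emeasure \<nu> {z\<in>D. fst z \<le> t \<and> snd z \<in> B}"
proof -
  let ?A = "\<lambda>n. {z\<in>D. fst z \<le> t + 1 / real (Suc n) \<and> snd z \<in> B}"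
  have "x \<le> t" if "\<And>n. x \<le> t + 1 / real (Suc n)" for x
  proof (rule ccontr)
    assume "\<not> x \<le> t"
    then obtain n where "inverse (real (Suc n)) < x - t" using reals_Archimedean[of "x - t"] by auto
    with that[of n] show False by (simp add: inverse_eq_divide)
  qed
  then have "(\<Inter>n. ?A n) = {z\<in>D. fst z \<le> t \<and> snd z \<in> B}"
    by (force intro: order_trans)
  moreover have "decseq ?A"
    by (rule decseq_SucI) (auto intro: order_trans simp: frac_le)
  ultimately show ?thesis
    using Lim_emeasure_decseq[of ?A \<nu>] assms cumulated_slice_sets \<nu>.emeasure_finite by auto
qed

definition slice_upto :: "real \<Rightarrow> real measure" where
  "slice_upto t = distr (restrict_space \<nu> {z\<in>D. fst z \<le> t}) borel_I snd"

lemma slice_upto: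
  shows "sets (slice_upto t) = sets borel_I" "finite_measure (slice_upto t)"
    and "B \<in> sets borel_I \<Longrightarrow> emeasure (slice_upto t) B = emeasure \<nu> {z\<in>D. fst z \<le> t \<and> snd z \<in> B}"
proof -
  have S: "{z\<in>D. fst z \<le> t} \<in> sets \<nu>"
    using cumulated_slice_sets[of "{0..1}" t] by (auto simp: sets_borel_I mem_Times_iff cong: conj_cong elim!: back_subst[where P = "\<lambda>S. S \<in> sets \<nu>"])
  have "snd \<in> measurable \<nu> borel_I"
    unfolding radon_posD[OF \<nu>]
    by (intro measurable_restrict_space3) (auto simp: borel_prod[symmetric])
  then have m: "snd \<in> measurable (restrict_space \<nu> {z\<in>D. fst z \<le> t}) borel_I"
    by (rule measurable_restrict_space1)
  show "sets (slice_upto t) = sets borel_I" by (simp add: slice_upto_def)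
  have sp: "space (restrict_space \<nu> {z\<in>D. fst z \<le> t}) = {z\<in>D. fst z \<le> t}"
    using radon_posD[OF \<nu>] by (auto simp: space_restrict_space)
  show em: "emeasure (slice_upto t) B = emeasure \<nu> {z\<in>D. fst z \<le> t \<and> snd z \<in> B}" if "B \<in> sets borel_I" for B
  proof -
    have "snd -` B \<inter> {z\<in>D. fst z \<le> t} = {z\<in>D. fst z \<le> t \<and> snd z \<in> B}" by auto
    moreover have "emeasure (restrict_space \<nu> {z\<in>D. fst z \<le> t}) {z\<in>D. fst z \<le> t \<and> snd z \<in> B} =
        emeasure \<nu> {z\<in>D. fst z \<le> t \<and> snd z \<in> B}"
      by (rule emeasure_restrict_space) (use S in auto)
    ultimately show ?thesis
      using that m unfolding slice_upto_def by (simp add: emeasure_distr sp)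
  qed
  show "finite_measure (slice_upto t)"
  proof
    have "space (slice_upto t) \<in> sets borel_I"
      unfolding slice_upto_def space_distr by (rule sets.top)
    then show "emeasure (slice_upto t) (space (slice_upto t)) \<noteq> \<infinity>"
      using \<nu>.emeasure_finite by (simp add: em)
  qed
qed

end

text \<open>Fixing the upper limit of integration at 1 makes the function vanish at t = 1 whatever
  \<open>u\<close> is, and the sign compensates for differentiating with respect to the lower
  limit.\<close>

lemma C1_test_antiderivative:
  fixes u h :: "real \<Rightarrow> real"
  assumes u: "continuous_on UNIV u" and h: "continuous_on UNIV h"
  shows "C1_test (\<lambda>z. - (integral {fst z..1} u * h (snd z))) (\<lambda>z. u (fst z) * h (snd z))"
  unfolding C1_test_def
proof (intro conjI ballI)
  have u01: "continuous_on {0..1} u" using u by (rule continuous_on_subset) simp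
  have deriv: "((\<lambda>t. integral {t..1} u) has_real_derivative - u t) (at t within {0..1})" if "t \<in> {0..1}" for t
    using u01 that by (rule integral_has_real_derivative')
  then have cont: "continuous_on {0..1} (\<lambda>t. integral {t..1} u)"
    by (rule DERIV_continuous_on)
  have "continuous_on D (\<lambda>z. integral {fst z..1} u)"
    by (rule continuous_on_compose2[OF cont]) (auto intro!: continuous_on_fst continuous_on_id)
  moreover have hD: "continuous_on D (\<lambda>z. h (snd z))" and uD: "continuous_on D (\<lambda>z. u (fst z))"
    by (auto intro!: continuous_on_compose2[OF h] continuous_on_compose2[OF u]
        continuous_on_fst continuous_on_snd continuous_on_id)
  ultimately show "continuous_on D (\<lambda>z. - (integral {fst z..1} u * h (snd z)))"
    by (intro continuous_on_minus continuous_on_mult)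
  show "continuous_on D (\<lambda>z. u (fst z) * h (snd z))"
    by (intro continuous_on_mult uD hD)
  fix x :: real
  show "- (integral {fst (1, x)..1} u * h (snd (1, x))) = 0" by simp
  fix t :: real assume "t \<in> {0..1}"
  from DERIV_minus[OF DERIV_cmult_right[OF deriv[OF this], of "h x"]]
  show "((\<lambda>s. - (integral {fst (s, x)..1} u * h (snd (s, x)))) has_real_derivative
      u (fst (t, x)) * h (snd (t, x))) (at t within {0..1})"
    by simp
qed

text \<open>The weak equation integrated in time: \<Delta> is the antiderivative of \<delta>, stated
  without subtraction. Products of cutoffs suffice as integrands, and their backward antiderivatives
  are admissible in the weak formula.\<close>

lemma cumulated_balance:
  assumes \<Delta>: "radon_pos \<Delta>" and \<delta>: "has_dt \<Delta> \<delta>" and A: "A \<in> sets borel_D"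
  shows "emeasure \<Delta> A + emeasure (cumulated (snd \<delta>)) A = emeasure (cumulated (fst \<delta>)) A"
proof -
  note r = has_dt_D(2,3)[OF \<delta>]
  note c = r[THEN radon_pos_cumulated]
  \<comment> \<open>The zero measure pads the right-hand side, so that both sides carry the same
    factor 1/2.\<close>
  let ?L = "mix_meas (1/2) \<Delta> (cumulated (snd \<delta>))" and ?R = "mix_meas (1/2) (cumulated (fst \<delta>)) zero_meas"
  have LR: "radon_pos ?L" "radon_pos ?R" using \<Delta> c radon_pos_zero by (auto intro: radon_pos_mix)
  then have "?L = ?R"
  proof (rule measure_D_eqI_cutoff)
    fix a c :: real and n :: nat
    let ?u = "cutoff a n" and ?h = "cutoff c n"
    let ?f = "\<lambda>z. ?u (fst z) * ?h (snd z)" and ?F = "\<lambda>z. integral {fst z..1} ?u * ?h (snd z)"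
    have cu: "continuous_on UNIV ?u" "continuous_on UNIV ?h"
      by (intro continuous_on_cutoff continuous_on_id)+
    have cont: "continuous_on D ?f" using C1_test_D(2)[OF C1_test_antiderivative[OF cu]] .
    note int = radon_pos_integrable_continuous[OF _ cont]
    have "(LINT z|\<Delta>. ?f z) + sintegral \<delta> (\<lambda>z. - ?F z) = 0"
      by (rule has_dt_test[OF \<delta> C1_test_antiderivative[OF cu]])
    then have "(LINT z|\<Delta>. ?f z) + (LINT z|snd \<delta>. ?F z) = (LINT z|fst \<delta>. ?F z)"
      by (simp add: sintegral_def)
    then have "(LINT z|\<Delta>. ?f z) + (LINT z|cumulated (snd \<delta>). ?f z) = (LINT z|cumulated (fst \<delta>). ?f z)"
      using integral_cumulated[OF r(1) cu] integral_cumulated[OF r(2) cu] by (simp add: cutoff_bounds)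
    moreover have "(LINT z|?L. ?f z) = (1 - 1/2) * (LINT z|\<Delta>. ?f z) + 1/2 * (LINT z|cumulated (snd \<delta>). ?f z)"
      using \<Delta> c int by (intro integral_mix_meas) (auto simp: radon_pos_def)
    moreover have "(LINT z|?R. ?f z) = (1 - 1/2) * (LINT z|cumulated (fst \<delta>). ?f z) + 1/2 * (LINT z|zero_meas. ?f z)"
      using radon_pos_zero c int by (intro integral_mix_meas) (auto simp: radon_pos_def)
    moreover have "(LINT z|zero_meas. ?f z) = 0" by (simp add: zero_meas_def)
    ultimately show "(LINT z|?L. ?f z) = (LINT z|?R. ?f z)" by simp
  qed
  then have "emeasure ?L A = emeasure ?R A" by simp
  moreover have "emeasure ?L A = ennreal (1/2) * (emeasure \<Delta> A + emeasure (cumulated (snd \<delta>)) A)"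
    "emeasure ?R A = ennreal (1/2) * emeasure (cumulated (fst \<delta>)) A"
    using \<Delta> c A radon_pos_zero by (auto simp: emeasure_mix_meas radon_pos_def distrib_left zero_meas_def)
  ultimately show ?thesis by (simp add: ennreal_mult_cancel_left)
qed

text \<open>
  The balance above yields the inequality after integration over any time interval. Both sides are
  right-continuous in time, so it holds at every time.
\<close>

lemma slice_upto_le:
  assumes \<Delta>: "radon_pos \<Delta>" and \<delta>: "has_dt \<Delta> \<delta>" and t: "0 \<le> t" "t < 1" and B: "B \<in> sets borel_I"
  shows "emeasure (slice_upto (snd \<delta>) t) B \<le> emeasure (slice_upto (fst \<delta>) t) B"
proof (rule ccontr)
  note r = has_dt_D(2,3)[OF \<delta>]
  note upto = slice_upto(3)[OF r(1) B] slice_upto(3)[OF r(2) B]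
  let ?k = "\<lambda>t. emeasure (slice_upto (fst \<delta>) t) B" and ?l = "\<lambda>t. emeasure (slice_upto (snd \<delta>) t) B"
  assume "\<not> ?l t \<le> ?k t"
  then have less: "?k t < ?l t" by simp
  have "(\<lambda>n. ?k (t + 1 / real (Suc n))) \<longlonglongrightarrow> ?k t"
    using cumulated_right_cont[OF r(1) B, of t] by (simp add: upto)
  from order_tendstoD(2)[OF this less]
  have "\<forall>\<^sub>F n in sequentially. ?k (t + 1 / real (Suc n)) < ?l t" .
  moreover have "\<forall>\<^sub>F n in sequentially. 1 / real (Suc n) < 1 - t"
    using t order_tendstoD(2)[OF LIMSEQ_inverse_real_of_nat, of "1 - t"] by (simp add: inverse_eq_divide)
  ultimately have "\<forall>\<^sub>F n in sequentially. ?k (t + 1 / real (Suc n)) < ?l t \<and> 1 / real (Suc n) < 1 - t"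
    by (rule eventually_conj)
  then obtain n where n: "?k (t + 1 / real (Suc n)) < ?l t" "1 / real (Suc n) < 1 - t"
    by (auto dest: eventually_happens)
  define e where "e = 1 / real (Suc n)"
  have e: "0 < e" "t + e < 1" "?k (t + e) < ?l t" using n by (auto simp: e_def)
  let ?A = "{t..t+e} \<times> B"
  have "?A \<in> sets (borel \<Otimes>\<^sub>M borel)"
    using B by (intro pair_measureI) (auto simp: sets_borel_I)
  then have "?A \<in> sets borel" unfolding borel_prod .
  then have A: "?A \<in> sets borel_D" using B t e by (auto simp: sets_borel_D sets_borel_I)
  have slice: "emeasure (cumulated \<nu>) ?A = (\<integral>\<^sup>+s. emeasure (slice_upto \<nu> s) B * indicator {t..t+e} s \<partial>leb01)"
    if \<nu>: "radon_pos \<nu>" for \<nu>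
    unfolding cumulated_slice(1)[OF \<nu> A]
    by (intro nn_integral_cong) (simp add: slice_upto(3)[OF \<nu> B] indicator_def)
  have len: "(\<integral>\<^sup>+s. c * indicator {t..t+e} s \<partial>leb01) = c * ennreal e" for c
  proof -
    have "{t..t+e} \<in> sets leb01" using t e by (auto simp: sets_leb01 sets_borel_I)
    moreover have "emeasure leb01 {t..t+e} = ennreal e"
      using t e by (subst emeasure_leb01) auto
    ultimately show ?thesis by (simp add: nn_integral_cmult_indicator)
  qed
  \<comment> \<open>By monotonicity in time, on the whole interval \<open>{t..t+e}\<close> the slice
    of \<open>fst \<delta>\<close> is at most its value at t + e and that of
    \<open>snd \<delta>\<close> at least its value at t. Integration over the box then contradicts
    the balance.\<close>
  have "emeasure (cumulated (fst \<delta>)) ?A \<le> ?k (t + e) * ennreal e"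
    unfolding slice[OF r(1)] len[symmetric]
    by (intro nn_integral_mono) (auto simp: indicator_def upto intro!: cumulated_mono[OF r(1) B])
  also have "\<dots> < ?l t * ennreal e"
    using e less by (intro ennreal_mult_strict_right_mono) (auto simp: upto less_top[symmetric] radon_pos_emeasure_finite r)
  also have "\<dots> \<le> emeasure (cumulated (snd \<delta>)) ?A"
    unfolding slice[OF r(2)] len[symmetric]
    by (intro nn_integral_mono) (auto simp: indicator_def upto intro!: cumulated_mono[OF r(2) B])
  also have "\<dots> \<le> emeasure \<Delta> ?A + emeasure (cumulated (snd \<delta>)) ?A" by simp
  also have "\<dots> = emeasure (cumulated (fst \<delta>)) ?A" by (rule cumulated_balance[OF \<Delta> \<delta> A])
  finally show False by simp
qed

section \<open>Existence of the disintegration\<close>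

lemma vertical_section_sets: "A \<in> sets borel_D \<Longrightarrow> t \<in> {0..1} \<Longrightarrow> Pair t -` A \<in> sets borel_I"
proof -
  assume A: "A \<in> sets borel_D" and "t \<in> {0..1}"
  then have "A \<in> sets (borel \<Otimes>\<^sub>M borel)"
    unfolding sets_borel_D borel_prod by blast
  then have "Pair t -` A \<in> sets borel" by (rule sets_Pair1)
  with A show ?thesis by (auto simp: sets_borel_I sets_borel_D)
qed

lemma disintegration_exists:
  assumes \<Delta>: "radon_pos \<Delta>" and \<delta>: "has_dt \<Delta> \<delta>"
  shows "\<exists>\<kappa>. disintegrates \<Delta> \<kappa>"
proof -
  note r = has_dt_D(2,3)[OF \<delta>]
  define \<kappa> where "\<kappa> t = (if t < 1 then diff_measure (slice_upto (fst \<delta>) t) (slice_upto (snd \<delta>) t)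
    else null_measure borel_I)" for t
  have em: "emeasure (\<kappa> t) B = (if t < 1 then emeasure (slice_upto (fst \<delta>) t) B - emeasure (slice_upto (snd \<delta>) t) B else 0)"
    if B: "B \<in> sets borel_I" and t: "0 \<le> t" for t B
  proof (cases "t < 1")
    case True
    have "emeasure (diff_measure (slice_upto (fst \<delta>) t) (slice_upto (snd \<delta>) t)) B =
        emeasure (slice_upto (fst \<delta>) t) B - emeasure (slice_upto (snd \<delta>) t) B"
      by (rule emeasure_diff_measure)
        (use slice_upto(1,2)[OF r(1)] slice_upto(1,2)[OF r(2)] slice_upto_le[OF \<Delta> \<delta> t True] B in auto)
    with True show ?thesis by (simp add: \<kappa>_def)
  qed (simp add: \<kappa>_def)
  have "disintegrates \<Delta> \<kappa>"
    unfolding disintegrates_def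
  proof (intro conjI ballI)
    fix t :: real assume t: "t \<in> {0..1}"
    show sets: "sets (\<kappa> t) = sets borel_I"
      using slice_upto(1)[OF r(1)] by (simp add: \<kappa>_def)
    show "finite_measure (\<kappa> t)"
    proof
      have "space (\<kappa> t) \<in> sets borel_I" using sets by (metis sets.top)
      then show "emeasure (\<kappa> t) (space (\<kappa> t)) \<noteq> \<infinity>"
        using t finite_measure.emeasure_finite[OF slice_upto(2)[OF r(1)]] by (simp add: em)
    qed
  next
    fix A assume A: "A \<in> sets borel_D"
    let ?K = "\<lambda>\<nu> t. emeasure \<nu> {z\<in>D. fst z \<le> t \<and> snd z \<in> Pair t -` A}"
    note [measurable] = cumulated_slice(2)[OF r(1) A] cumulated_slice(2)[OF r(2) A]
    have eq: "emeasure (\<kappa> t) (Pair t -` A) = (if t < 1 then ?K (fst \<delta>) t - ?K (snd \<delta>) t else 0)"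
      if "t \<in> space leb01" for t
      using that vertical_section_sets[OF A, of t]
      by (simp add: em space_leb01 slice_upto(3)[OF r(1)] slice_upto(3)[OF r(2)])
    have "(\<lambda>t. if t < 1 then ?K (fst \<delta>) t - ?K (snd \<delta>) t else 0) \<in> borel_measurable leb01"
      by measurable
    then show "(\<lambda>t. emeasure (\<kappa> t) (Pair t -` A)) \<in> borel_measurable leb01"
      by (subst measurable_cong[OF eq])
    have not1: "AE t in leb01. t \<noteq> 1"
      by (subst AE_restrict_space_iff) (auto intro: AE_mp[OF AE_lborel_singleton])
    have le: "?K (snd \<delta>) t \<le> ?K (fst \<delta>) t" if "t \<in> space leb01" "t \<noteq> 1" for t
      using slice_upto_le[OF \<Delta> \<delta>, of t "Pair t -` A"] that vertical_section_sets[OF A, of t]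
      by (simp add: space_leb01 slice_upto(3)[OF r(1)] slice_upto(3)[OF r(2)])
    have "(\<integral>\<^sup>+t. emeasure (\<kappa> t) (Pair t -` A) \<partial>leb01) = (\<integral>\<^sup>+t. ?K (fst \<delta>) t - ?K (snd \<delta>) t \<partial>leb01)"
      using not1 AE_space by (intro nn_integral_cong_AE, eventually_elim) (auto simp: eq space_leb01)
    also have "\<dots> = (\<integral>\<^sup>+t. ?K (fst \<delta>) t \<partial>leb01) - (\<integral>\<^sup>+t. ?K (snd \<delta>) t \<partial>leb01)"
    proof (rule nn_integral_diff)
      show "(\<integral>\<^sup>+t. ?K (snd \<delta>) t \<partial>leb01) \<noteq> \<infinity>"
        unfolding cumulated_slice(1)[OF r(2) A, symmetric]
        by (rule radon_pos_emeasure_finite[OF radon_pos_cumulated[OF r(2)]])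
      show "AE t in leb01. ?K (snd \<delta>) t \<le> ?K (fst \<delta>) t"
        using not1 AE_space by eventually_elim (rule le)
    qed measurable
    also have "\<dots> = emeasure (cumulated (fst \<delta>)) A - emeasure (cumulated (snd \<delta>)) A"
      unfolding cumulated_slice(1)[OF r(1) A] cumulated_slice(1)[OF r(2) A] ..
    also have "\<dots> = emeasure \<Delta> A"
      unfolding cumulated_balance[OF \<Delta> \<delta> A, symmetric]
      using radon_pos_emeasure_finite[OF radon_pos_cumulated[OF r(2)], of A]
      by (simp add: ennreal_add_diff_cancel_right)
    finally show "emeasure \<Delta> A = (\<integral>\<^sup>+t. emeasure (\<kappa> t) (Pair t -` A) \<partial>leb01)" ..
  qed
  then show ?thesis by blast
qed

lemma disintegrates_slice:
  assumes "radon_pos \<Delta>" "has_dt \<Delta> \<delta>"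
  shows "disintegrates \<Delta> (slice \<Delta>)"
  using disintegration_exists[OF assms] unfolding slice_def by (rule someI_ex)

text \<open>A countable generator: identities that hold almost everywhere in time for each
  generating set can be combined on one null set.\<close>

lemma borel_generated_by_rat_lessThan:
  "sets (borel :: real measure) = sigma_sets UNIV (lessThan ` \<rat>)"
proof
  have "lessThan c \<in> sigma_sets UNIV (lessThan ` \<rat>)" for c :: real
  proof -
    have "lessThan c = \<Union> (lessThan ` {b\<in>\<rat>. b < c})"
    proof (intro equalityI subsetI)
      fix x assume "x \<in> {..<c}"
      then obtain b where "b \<in> \<rat>" "x < b" "b < c" using Rats_dense_in_real by auto
      then show "x \<in> \<Union> (lessThan ` {b\<in>\<rat>. b < c})" by auto
    qed auto
    also have "\<dots> \<in> sigma_sets UNIV (lessThan ` \<rat>)"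
      by (rule sigma_sets_UNION)
        (auto intro!: countable_image countable_subset[OF _ countable_rat] sigma_sets.Basic)
    finally show ?thesis .
  qed
  then have "sigma_sets UNIV (range lessThan) \<subseteq> sigma_sets UNIV (lessThan ` (\<rat> :: real set))"
    by (intro sigma_sets_mono) auto
  then show "sets borel \<subseteq> sigma_sets UNIV (lessThan ` (\<rat> :: real set))"
    by (simp add: borel_Iio)
  show "sigma_sets UNIV (lessThan ` \<rat>) \<subseteq> sets (borel :: real measure)"
    by (rule sets.sigma_sets_subset[of _ borel, simplified]) auto
qed

lemma measure_I_eqI:
  assumes M: "sets M = sets borel_I" "finite_measure M" and N: "sets N = sets borel_I" "finite_measure N"
    and eq: "\<And>c. c \<in> \<rat> \<Longrightarrow> emeasure M ({0..1} \<inter> {..<c}) = emeasure N ({0..1} \<inter> {..<c})"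
  shows "M = N"
proof -
  interpret M: finite_measure M by fact
  let ?M = "distr M borel (\<lambda>x. x)" and ?N = "distr N borel (\<lambda>x. x)"
  have sp: "space M = {0..1}" "space N = {0..1}"
    using sets_eq_imp_space_eq[OF M(1)] sets_eq_imp_space_eq[OF N(1)] by (simp_all add: space_borel_I)
  have "(\<lambda>x. x) \<in> measurable M borel" "(\<lambda>x. x) \<in> measurable N borel"
    by (simp_all add: measurable_cong_sets[OF M(1) refl] measurable_cong_sets[OF N(1) refl] measurable_restrict_space1)
  then have em: "emeasure ?M A = emeasure M ({0..1} \<inter> A)" "emeasure ?N A = emeasure N ({0..1} \<inter> A)"
    if "A \<in> sets borel" for A
    using that by (auto simp: emeasure_distr sp Int_commute)
  have "?M = ?N"
  proof (rule measure_eqI_generator_eq[where E = "lessThan ` \<rat>" and \<Omega> = UNIV and A = "\<lambda>n. {..<real n}"])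
    show "Int_stable (lessThan ` (\<rat> :: real set))"
    proof (rule Int_stableI_image)
      fix i j :: real assume "i \<in> \<rat>" "j \<in> \<rat>"
      then show "\<exists>k\<in>\<rat>. {..<i} \<inter> {..<j} = {..<k}"
        by (intro bexI[of _ "min i j"]) (auto simp: min_def)
    qed
    show "emeasure ?M X = emeasure ?N X" if "X \<in> lessThan ` \<rat>" for X
      using that eq by (auto simp: em)
    show "(\<Union>i. {..<real i}) = UNIV" by (auto simp: reals_Archimedean2)
    show "emeasure ?M {..<real i} \<noteq> \<infinity>" for i by (simp add: em)
  qed (auto simp: borel_generated_by_rat_lessThan)
  show ?thesis
  proof (rule measure_eqI)
    show "sets M = sets N" using M N by simp
    fix A assume "A \<in> sets M"
    then have "A \<in> sets borel" "A \<subseteq> {0..1}" using M by (auto simp: sets_borel_I)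
    then show "emeasure M A = emeasure N A"
      using em[of A] \<open>?M = ?N\<close> by (simp add: Int_absorb1)
  qed
qed

section \<open>Almost everywhere uniqueness of slices\<close>

lemma rect_in_sets_borel_D:
  assumes "I \<in> sets borel_I" "B \<in> sets borel_I"
  shows "I \<times> B \<in> sets borel_D"
proof -
  have "I \<times> B \<in> sets (borel \<Otimes>\<^sub>M borel)" using assms by (intro pair_measureI) (auto simp: sets_borel_I)
  then have "I \<times> B \<in> sets borel" unfolding borel_prod .
  with assms show ?thesis by (auto simp: sets_borel_D sets_borel_I)
qed

lemma disintegrates_rect:
  assumes "disintegrates \<Delta> \<kappa>" "I \<in> sets borel_I" "B \<in> sets borel_I"
  shows "emeasure \<Delta> (I \<times> B) = (\<integral>\<^sup>+t. emeasure (\<kappa> t) B * indicator I t \<partial>leb01)"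
proof -
  have "emeasure \<Delta> (I \<times> B) = (\<integral>\<^sup>+t. emeasure (\<kappa> t) (Pair t -` (I \<times> B)) \<partial>leb01)"
    using assms rect_in_sets_borel_D unfolding disintegrates_def by blast
  also have "\<dots> = (\<integral>\<^sup>+t. emeasure (\<kappa> t) B * indicator I t \<partial>leb01)"
    by (intro nn_integral_cong) (auto simp: indicator_def)
  finally show ?thesis .
qed

lemma disintegrates_measurable:
  assumes "disintegrates \<Delta> \<kappa>" "B \<in> sets borel_I"
  shows "(\<lambda>t. emeasure (\<kappa> t) B) \<in> borel_measurable leb01"
proof -
  have I: "{0..1} \<in> sets borel_I" by (simp add: sets_borel_I)
  have "(\<lambda>t. emeasure (\<kappa> t) (Pair t -` ({0..1} \<times> B))) \<in> borel_measurable leb01"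
    using assms rect_in_sets_borel_D[OF I assms(2)] unfolding disintegrates_def by blast
  then show ?thesis
    by (rule measurable_cong[THEN iffD1, rotated]) (simp add: space_leb01)
qed

text \<open>The three disintegrations are chosen independently, so equality can be expected only at
  almost every time. For a fixed set B the two candidates are densities in time of the same measure;
  countably many rational initial segments then share one exceptional null set and determine the
  slices.\<close>

lemma disintegrates_mix:
  assumes M: "radon_pos M" "disintegrates M \<kappa>" and N: "radon_pos N" "disintegrates N \<kappa>'"
    and mix: "disintegrates (mix_meas s M N) \<kappa>''" and s: "s \<in> {0..1}"
  shows "AE t in leb01. \<kappa>'' t = mix_meas s (\<kappa> t) (\<kappa>' t)"
proof -
  let ?k = "\<lambda>B t. ennreal (1 - s) * emeasure (\<kappa> t) B + ennreal s * emeasure (\<kappa>' t) B"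
  have "AE t in leb01. emeasure (\<kappa>'' t) B = ?k B t" if B: "B \<in> sets borel_I" for B
  proof -
    note [measurable] = disintegrates_measurable[OF M(2) B] disintegrates_measurable[OF N(2) B]
      disintegrates_measurable[OF mix B]
    have "density leb01 (\<lambda>t. emeasure (\<kappa>'' t) B) = density leb01 (?k B)"
    proof (rule measure_eqI)
      fix I assume "I \<in> sets (density leb01 (\<lambda>t. emeasure (\<kappa>'' t) B))"
      then have I: "I \<in> sets borel_I" and [measurable]: "I \<in> sets leb01" by (auto simp: sets_leb01)
      have "emeasure (density leb01 (\<lambda>t. emeasure (\<kappa>'' t) B)) I = emeasure (mix_meas s M N) (I \<times> B)"
        unfolding disintegrates_rect[OF mix I B] by (rule emeasure_density) auto
      also have "\<dots> = ennreal (1 - s) * emeasure M (I \<times> B) + ennreal s * emeasure N (I \<times> B)"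
        using M N rect_in_sets_borel_D[OF I B] by (intro emeasure_mix_meas) (auto simp: radon_pos_def)
      also have "\<dots> = (\<integral>\<^sup>+t. ?k B t * indicator I t \<partial>leb01)"
        unfolding disintegrates_rect[OF M(2) I B] disintegrates_rect[OF N(2) I B]
        by (simp add: nn_integral_add nn_integral_cmult[symmetric] distrib_right mult.assoc)
      also have "\<dots> = emeasure (density leb01 (?k B)) I"
        by (rule emeasure_density[symmetric]) auto
      finally show "emeasure (density leb01 (\<lambda>t. emeasure (\<kappa>'' t) B)) I = emeasure (density leb01 (?k B)) I" .
    qed simp
    then show ?thesis by (subst (asm) leb01.density_unique_iff) auto
  qed
  then have "\<forall>c\<in>\<rat>. AE t in leb01. emeasure (\<kappa>'' t) ({0..1} \<inter> {..<c}) = ?k ({0..1} \<inter> {..<c}) t"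
    by (simp add: sets_borel_I)
  then have "AE t in leb01. \<forall>c\<in>\<rat>. emeasure (\<kappa>'' t) ({0..1} \<inter> {..<c}) = ?k ({0..1} \<inter> {..<c}) t"
    by (rule AE_ball_countable[OF countable_rat, THEN iffD2])
  then show ?thesis
    using AE_space
  proof eventually_elim
    case (elim t)
    then have t: "t \<in> {0..1}" by (simp add: space_leb01)
    note D = M(2)[unfolded disintegrates_def, THEN conjunct1, rule_format, OF t]
      N(2)[unfolded disintegrates_def, THEN conjunct1, rule_format, OF t]
      mix[unfolded disintegrates_def, THEN conjunct1, rule_format, OF t]
    show ?case
    proof (rule measure_I_eqI)
      show "finite_measure (mix_meas s (\<kappa> t) (\<kappa>' t))" using D by (intro finite_measure_mix_meas) auto
      show "emeasure (\<kappa>'' t) ({0..1} \<inter> {..<c}) = emeasure (mix_meas s (\<kappa> t) (\<kappa>' t)) ({0..1} \<inter> {..<c})"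
        if "c \<in> \<rat>" for c
        using elim that D by (simp add: emeasure_mix_meas sets_borel_I)
    qed (use D in auto)
  qed
qed

text \<open>The total masses of the slices are nonnegative with integral 0, hence zero at almost
  every time; at the other times an arbitrary disintegration is not controlled.\<close>

lemma disintegrates_zero:
  assumes "disintegrates zero_meas \<kappa>"
  shows "AE t in leb01. \<kappa> t = null_measure borel_I"
proof -
  have I: "{0..1} \<in> sets borel_I" by (simp add: sets_borel_I)
  note [measurable] = disintegrates_measurable[OF assms I]
  have "(\<integral>\<^sup>+t. emeasure (\<kappa> t) {0..1} * indicator {0..1} t \<partial>leb01) = 0"
    unfolding disintegrates_rect[OF assms I I, symmetric] by (simp add: zero_meas_def)
  moreover have "(\<lambda>t. emeasure (\<kappa> t) {0..1} * indicator {0..1} t) \<in> borel_measurable leb01"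
    using I by (intro borel_measurable_times_ennreal) (auto simp: sets_leb01 intro: borel_measurable_indicator)
  ultimately have "AE t in leb01. emeasure (\<kappa> t) {0..1} * indicator {0..1} t = 0"
    by (subst (asm) nn_integral_0_iff_AE)
  then show ?thesis
    using AE_space
  proof eventually_elim
    case (elim t)
    then have t: "t \<in> {0..1}" and z: "emeasure (\<kappa> t) {0..1} = 0" by (simp_all add: space_leb01)
    note D = assms[unfolded disintegrates_def, THEN conjunct1, rule_format, OF t]
    show ?case
    proof (rule measure_eqI)
      fix A assume "A \<in> sets (\<kappa> t)"
      then have "A \<subseteq> {0..1}" using D by (simp add: sets_borel_I)
      then show "emeasure (\<kappa> t) A = emeasure (null_measure borel_I) A"
        using z emeasure_mono[of A "{0..1}" "\<kappa> t"] D I by simp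
    qed (use D in simp)
  qed
qed

section \<open>Curves in \<open>L\<^sup>2\<close>\<close>

lemma L2_D:
  assumes "L2 f"
  shows "f \<in> borel_measurable leb01" "integrable leb01 (\<lambda>x. (f x)\<^sup>2)" "integrable leb01 f"
proof -
  show m: "f \<in> borel_measurable leb01" "integrable leb01 (\<lambda>x. (f x)\<^sup>2)"
    using assms by (auto simp: L2_def)
  show "integrable leb01 f"
    by (rule leb01.square_integrable_imp_integrable[OF m])
qed

lemma abs_le_square_plus: "\<bar>a::real\<bar> \<le> c / 2 + a\<^sup>2 / (2 * c)" if "0 < c"
proof -
  have "0 \<le> (\<bar>a\<bar> - c)\<^sup>2" by simp
  then have "2 * c * \<bar>a\<bar> \<le> c\<^sup>2 + a\<^sup>2" by (simp add: power2_eq_square algebra_simps)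
  with that show ?thesis by (simp add: field_simps power2_eq_square)
qed

text \<open>Stands in for the Cauchy-Schwarz inequality. The free parameter is taken as 1 where only
  boundedness is at stake and as the error tolerance where continuity is.\<close>

lemma L2_integral_abs_le:
  assumes f: "L2 f" and c: "0 < c"
  shows "(LINT x|leb01. \<bar>f x\<bar>) \<le> c / 2 + (LINT x|leb01. (f x)\<^sup>2) / (2 * c)"
proof -
  have "(LINT x|leb01. \<bar>f x\<bar>) \<le> (LINT x|leb01. c / 2 + (f x)\<^sup>2 / (2 * c))"
    using L2_D[OF f] c by (intro integral_mono) (auto intro: abs_le_square_plus)
  also have "\<dots> = c / 2 + (LINT x|leb01. (f x)\<^sup>2) / (2 * c)"
    using L2_D[OF f] by (simp add: space_leb01 leb01_total)
  finally show ?thesis .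
qed

lemma abs_mono_nonneg: "0 \<le> a \<Longrightarrow> a \<le> b \<Longrightarrow> \<bar>a::real\<bar> \<le> \<bar>b\<bar>"
  by simp

lemma L2_diff:
  assumes f: "L2 f" and g: "L2 g"
  shows "L2 (\<lambda>x. f x - g x)"
proof -
  have [measurable]: "f \<in> borel_measurable leb01" "g \<in> borel_measurable leb01"
    using f g by (auto simp: L2_def)
  have le: "(f x - g x)\<^sup>2 \<le> 2 * (f x)\<^sup>2 + 2 * (g x)\<^sup>2" for x
    using sum_squares_ge_zero[of "f x + g x" 0] by (simp add: power2_eq_square algebra_simps)
  have "integrable leb01 (\<lambda>x. (f x - g x)\<^sup>2)"
  proof (rule Bochner_Integration.integrable_bound)
    show "integrable leb01 (\<lambda>x. 2 * (f x)\<^sup>2 + 2 * (g x)\<^sup>2)"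
      using L2_D(2)[OF f] L2_D(2)[OF g] by (intro Bochner_Integration.integrable_add integrable_mult_right)
    show "(\<lambda>x. (f x - g x)\<^sup>2) \<in> borel_measurable leb01" by measurable
    show "AE x in leb01. norm ((f x - g x)\<^sup>2) \<le> norm (2 * (f x)\<^sup>2 + 2 * (g x)\<^sup>2)"
      unfolding real_norm_def by (rule AE_I2) (rule abs_mono_nonneg[OF zero_le_power2 le])
  qed
  moreover have "(\<lambda>x. f x - g x) \<in> borel_measurable leb01" by measurable
  ultimately show ?thesis by (simp add: L2_def)
qed

text \<open>The exponent in \<open>eta\<close> and the function \<open>phi\<close> are both of this
  form, so one set of continuity and measurability results serves the two.\<close>

definition prim :: "(real \<Rightarrow> real) \<Rightarrow> real \<Rightarrow> real" where
  "prim f x = (LINT y:{0..x}|lborel. f y)"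

lemma prim_leb01: "x \<le> 1 \<Longrightarrow> prim f x = (LINT y|leb01. indicator {0..x} y * f y)"
  unfolding prim_def integral_leb01 set_lebesgue_integral_def
  by (intro Bochner_Integration.integral_cong) (auto simp: indicator_def)

lemma eta_prim: "eta q x = exp (prim q x)"
  by (simp add: eta_def prim_def)

lemma integrable_indicator_leb01:
  "integrable leb01 f \<Longrightarrow> integrable leb01 (\<lambda>y. indicator {a..b} y * f y)" for f :: "real \<Rightarrow> real"
  by (rule Bochner_Integration.integrable_bound[of leb01 f])
    (auto simp: indicator_def intro!: borel_measurable_times borel_measurable_leb01I)

lemma prim_abs_le:
  assumes "integrable leb01 f" "x \<le> 1"
  shows "\<bar>prim f x\<bar> \<le> (LINT y|leb01. \<bar>f y\<bar>)"
proof -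
  have "\<bar>prim f x\<bar> \<le> (LINT y|leb01. \<bar>indicator {0..x} y * f y\<bar>)"
    unfolding prim_leb01[OF assms(2)] by (rule integral_abs_bound)
  also have "\<dots> \<le> (LINT y|leb01. \<bar>f y\<bar>)"
    using assms integrable_indicator_leb01[OF assms(1)]
    by (intro integral_mono) (auto simp: indicator_def)
  finally show ?thesis .
qed

lemma prim_diff:
  assumes "integrable leb01 f" "integrable leb01 g" "x \<le> 1"
  shows "prim f x - prim g x = prim (\<lambda>y. f y - g y) x"
  using integrable_indicator_leb01[OF assms(1)] integrable_indicator_leb01[OF assms(2)]
  by (simp add: prim_leb01[OF assms(3)] right_diff_distrib)

section \<open>Uniform bounds and continuity in time\<close>

lemma C0_L2_D: "C0_L2 u \<Longrightarrow> t \<in> {0..1} \<Longrightarrow> L2 (u t)"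
  by (simp add: C0_L2_def)

text \<open>Compactness of the time interval by bisection: continuity bounds the squared norm near
  each time, and bounds on adjacent intervals combine.\<close>

lemma C0_L2_bounded:
  assumes u: "C0_L2 u"
  obtains B where "\<And>t. t \<in> {0..1} \<Longrightarrow> (LINT x|leb01. (u t x)\<^sup>2) \<le> B"
proof -
  let ?N = "\<lambda>t. LINT x|leb01. (u t x)\<^sup>2"
  have "\<exists>B. \<forall>t\<in>{0..1}. t \<in> {0..1} \<longrightarrow> ?N t \<le> B"
  proof (rule Bolzano[where P = "\<lambda>a b. \<exists>B. \<forall>t\<in>{a..b}. t \<in> {0..1} \<longrightarrow> ?N t \<le> B"])
    fix a b c :: real
    assume "\<exists>B. \<forall>t\<in>{a..b}. t \<in> {0..1} \<longrightarrow> ?N t \<le> B" "\<exists>B. \<forall>t\<in>{b..c}. t \<in> {0..1} \<longrightarrow> ?N t \<le> B"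
    then obtain B C where "\<forall>t\<in>{a..b}. t \<in> {0..1} \<longrightarrow> ?N t \<le> B" "\<forall>t\<in>{b..c}. t \<in> {0..1} \<longrightarrow> ?N t \<le> C"
      by blast
    then have "\<forall>t\<in>{a..c}. t \<in> {0..1} \<longrightarrow> ?N t \<le> max B C"
      by (metis atLeastAtMost_iff le_max_iff_disj linear)
    then show "\<exists>B. \<forall>t\<in>{a..c}. t \<in> {0..1} \<longrightarrow> ?N t \<le> B" by blast
  next
    fix t :: real assume t: "0 \<le> t" "t \<le> 1"
    then have "((\<lambda>s. LINT x|leb01. (u s x - u t x)\<^sup>2) \<longlongrightarrow> 0) (at t within {0..1})"
      using u by (simp add: C0_L2_def)
    then have "\<forall>\<^sub>F s in at t within {0..1}. (LINT x|leb01. (u s x - u t x)\<^sup>2) < 1"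
      by (rule order_tendstoD) simp
    then obtain d where d: "d > 0" "\<And>s. s \<in> {0..1} \<Longrightarrow> s \<noteq> t \<Longrightarrow> dist s t < d \<Longrightarrow> (LINT x|leb01. (u s x - u t x)\<^sup>2) < 1"
      unfolding eventually_at by auto
    have "?N s \<le> 2 * ?N t + 2" if s: "s \<in> {0..1}" "dist s t < d" for s
    proof -
      have Lst: "L2 (u s)" "L2 (u t)" using s t by (auto intro!: C0_L2_D[OF u])
      note L = Lst L2_diff[OF Lst]
      have le1: "(LINT x|leb01. (u s x - u t x)\<^sup>2) \<le> 1"
        using d(2)[OF s(1)] s by (cases "s = t") auto
      have "?N s \<le> (LINT x|leb01. 2 * (u t x)\<^sup>2 + 2 * (u s x - u t x)\<^sup>2)"
      proof (rule integral_mono)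
        show "(u s x)\<^sup>2 \<le> 2 * (u t x)\<^sup>2 + 2 * (u s x - u t x)\<^sup>2" for x
          using sum_squares_ge_zero[of "u s x - 2 * u t x" 0] by (simp add: power2_eq_square algebra_simps)
      qed (use L[THEN L2_D(2)] in auto)
      also have "\<dots> = 2 * ?N t + 2 * (LINT x|leb01. (u s x - u t x)\<^sup>2)"
        using L[THEN L2_D(2)] by simp
      finally show ?thesis using le1 by simp
    qed
    then have "\<forall>a b. a \<le> t \<and> t \<le> b \<and> b - a < d \<longrightarrow> (\<forall>s\<in>{a..b}. s \<in> {0..1} \<longrightarrow> ?N s \<le> 2 * ?N t + 2)"
      by (auto simp: dist_real_def)
    with d(1) show "\<exists>d>0. \<forall>a b. a \<le> t \<and> t \<le> b \<and> b - a < d \<longrightarrow> (\<exists>B. \<forall>s\<in>{a..b}. s \<in> {0..1} \<longrightarrow> ?N s \<le> B)"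
      by blast
  qed simp
  then show thesis using that by blast
qed

text \<open>For fixed x the primitive is a linear functional controlled by the integral of the
  absolute value, hence by the distance in square mean.\<close>

lemma prim_continuous_in_time:
  assumes u: "C0_L2 u" and x: "x \<le> 1"
  shows "continuous_on {0..1} (\<lambda>t. prim (u t) x)"
  unfolding continuous_on_def
proof
  fix t :: real assume t: "t \<in> {0..1}"
  let ?d = "\<lambda>s. LINT x|leb01. (u s x - u t x)\<^sup>2"
  have lim: "(?d \<longlongrightarrow> 0) (at t within {0..1})" using u t by (simp add: C0_L2_def)
  have est: "\<bar>prim (u s) x - prim (u t) x\<bar> \<le> c / 2 + ?d s / (2 * c)" if "s \<in> {0..1}" "0 < c" for s c
  proof -
    have Lst: "L2 (u s)" "L2 (u t)" using that t by (auto intro!: C0_L2_D[OF u])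
    note L = Lst L2_diff[OF Lst]
    have "\<bar>prim (u s) x - prim (u t) x\<bar> \<le> (LINT y|leb01. \<bar>u s y - u t y\<bar>)"
      using prim_diff[OF L(1,2)[THEN L2_D(3)] x] prim_abs_le[OF L2_D(3)[OF L(3)] x] by simp
    with L2_integral_abs_le[OF L(3) that(2)] show ?thesis by linarith
  qed
  show "((\<lambda>t. prim (u t) x) \<longlongrightarrow> prim (u t) x) (at t within {0..1})"
  proof (rule tendstoI)
    fix e :: real assume e: "0 < e"
    have "\<forall>\<^sub>F s in at t within {0..1}. ?d s < e * e"
      using lim by (rule order_tendstoD) (use e in simp)
    moreover have "\<forall>\<^sub>F s in at t within {0..1}. s \<in> {0..1}"
      by (simp add: eventually_at_filter)
    ultimately show "\<forall>\<^sub>F s in at t within {0..1}. dist (prim (u s) x) (prim (u t) x) < e"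
    proof eventually_elim
      case (elim s)
      \<comment> \<open>The choice c = e balances the estimate: the first term equals e / 2, and a
        squared distance below e * e keeps the second below e / 2.\<close>
      have "?d s / (2 * e) < e / 2" using elim e by (simp add: field_simps)
      with est[OF elim(2) e] show ?case by (simp add: dist_real_def)
    qed
  qed
qed

section \<open>Functions on the square and test functions in time\<close>

abbreviation leb2 :: "(real \<times> real) measure" where
  "leb2 \<equiv> leb01 \<Otimes>\<^sub>M leb01"

interpretation leb2: pair_sigma_finite leb01 leb01 ..

interpretation leb2: finite_measure "leb2"
  by (rule finite_measure_pair_measure) unfold_locales

lemma space_leb2: "space leb2 = D"
  by (simp add: space_pair_measure space_leb01)

lemma L2_L2_D:
  assumes "L2_L2 u"
  shows "case_prod u \<in> borel_measurable leb2"
    "integrable leb2 (case_prod u)"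
    "integrable leb2 (\<lambda>z. (case_prod u z)\<^sup>2)"
proof -
  show m: "case_prod u \<in> borel_measurable leb2"
    "integrable leb2 (\<lambda>z. (case_prod u z)\<^sup>2)"
    using assms by (auto simp: L2_L2_def)
  show "integrable leb2 (case_prod u)"
    by (rule leb2.square_integrable_imp_integrable[OF m])
qed

lemma leb2_fst [measurable]: "fst \<in> borel_measurable leb2"
  by (rule measurable_compose[OF measurable_fst leb01_ident])

lemma leb2_snd [measurable]: "snd \<in> borel_measurable leb2"
  by (rule measurable_compose[OF measurable_snd leb01_ident])

text \<open>Writing the moving upper limit as a condition inside the integrand leaves a parameter
  integral over a fixed interval.\<close>

lemma prim_jointly_measurable:
  assumes u: "case_prod u \<in> borel_measurable leb2"
  shows "(\<lambda>(t, x). prim (u t) x) \<in> borel_measurable leb2"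
proof -
  let ?M = "leb2 \<Otimes>\<^sub>M leb01"
  have [measurable]: "(\<lambda>w. u (fst (fst w)) (snd w)) \<in> borel_measurable ?M"
    using measurable_compose[OF measurable_Pair[OF measurable_compose[OF measurable_fst measurable_fst] measurable_snd] u]
    by simp
  have [measurable]: "(\<lambda>w. snd (fst w)) \<in> borel_measurable ?M" "snd \<in> borel_measurable ?M"
    by (rule measurable_compose[OF measurable_fst leb2_snd]) (rule measurable_compose[OF measurable_snd leb01_ident])
  have "(\<lambda>z. LINT y|leb01. (if 0 \<le> y \<and> y \<le> snd z then u (fst z) y else 0)) \<in> borel_measurable leb2"
    by (rule leb01.borel_measurable_lebesgue_integral) (simp add: case_prod_beta')
  then show ?thesis
    by (rule measurable_cong[THEN iffD1, rotated])
      (auto simp: space_leb2 prim_leb01 intro!: Bochner_Integration.integral_cong)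
qed

lemma integral_leb01_continuous:
  fixes f :: "real \<Rightarrow> real"
  assumes "continuous_on {0..1} f"
  shows "integrable leb01 f" "(LINT t|leb01. f t) = integral {0..1} f"
proof -
  note I = borel_integrable_atLeastAtMost'[OF assms]
  show "integrable leb01 f" using I unfolding set_integrable_def by (subst integrable_restrict_space) auto
  show "(LINT t|leb01. f t) = integral {0..1} f"
    unfolding integral_leb01 by (rule set_borel_integral_eq_integral(2)[OF I])
qed

lemma C1c_D:
  assumes "C1c \<psi> \<psi>'"
  shows "(\<psi> has_real_derivative \<psi>' t) (at t)" "continuous_on UNIV \<psi>'" "continuous_on UNIV \<psi>"
    "\<psi> 0 = 0" "\<psi> 1 = 0"
proof -
  show d: "(\<psi> has_real_derivative \<psi>' t) (at t)" for t using assms by (simp add: C1c_def)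
  show "continuous_on UNIV \<psi>'" using assms by (simp add: C1c_def)
  show "continuous_on UNIV \<psi>" using d by (auto intro: DERIV_isCont continuous_at_imp_continuous_on)
  obtain a b where "0 < a" "b < 1" "\<forall>t. t \<notin> {a..b} \<longrightarrow> \<psi> t = 0" using assms by (auto simp: C1c_def)
  then show "\<psi> 0 = 0" "\<psi> 1 = 0" by auto
qed

lemma continuous_clamp_bounded:
  fixes f :: "real \<Rightarrow> real"
  assumes "continuous_on UNIV f"
  obtains B where "0 \<le> B" "\<And>t. t \<in> {0..1} \<Longrightarrow> \<bar>f t\<bar> \<le> B"
proof -
  have "compact (f ` {0..1})"
    using assms by (intro compact_continuous_image) (auto intro: continuous_on_subset)
  then obtain B where "\<And>t. t \<in> {0..1} \<Longrightarrow> \<bar>f t\<bar> \<le> B"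
    by (metis (no_types, lifting) bounded_iff compact_imp_bounded image_eqI real_norm_def)
  then show thesis by (intro that[of "max 0 B"]) fastforce+
qed

text \<open>The vanishing mean is what makes the antiderivative return to 0 to the right of the
  support, and thus compactly supported.\<close>

lemma C1c_bump_antiderivative:
  fixes g :: "real \<Rightarrow> real"
  assumes g: "continuous_on UNIV g" and ab: "0 < a" "a < b" "b < 1"
    and supp: "\<And>t. t \<notin> {a<..<b} \<Longrightarrow> g t = 0" and zero: "integral {0..1} g = 0"
  shows "C1c (\<lambda>t. integral {0..t} g) g"
proof -
  have int: "g integrable_on {s..t}" for s t
    using g by (intro integrable_continuous_interval) (auto intro: continuous_on_subset)
  have left: "integral {0..t} g = 0" if "t \<le> a" for t
    using that supp by (intro integral_unique has_integral_is_0) auto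
  have right: "integral {0..t} g = 0" if "b < t" for t
  proof -
    have van: "integral {b..s} g = 0" for s
      using supp by (intro integral_unique has_integral_is_0) auto
    have "integral {0..b} g + integral {b..t} g = integral {0..t} g"
      "integral {0..b} g + integral {b..1} g = integral {0..1} g"
      using that ab int by (auto intro!: Henstock_Kurzweil_Integration.integral_combine)
    with van zero show ?thesis by simp
  qed
  have "((\<lambda>t. integral {0..t} g) has_real_derivative g t) (at t)" for t
  proof (cases "t < a")
    case True
    have "((\<lambda>t. 0) has_real_derivative 0) (at t)" by simp
    then have "((\<lambda>t. integral {0..t} g) has_real_derivative 0) (at t)"
      by (rule has_field_derivative_transform_within_open[where S = "{..<a}"]) (use True left in auto)
    with True supp show ?thesis by simp
  next
    case False
    then have t: "0 < t" using ab by simp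
    have "((\<lambda>t. integral {0..t} g) has_real_derivative g t) (at t within {0..t+1})"
      using g t by (intro integral_has_real_derivative) (auto intro: continuous_on_subset)
    then show ?thesis using t by (simp add: at_within_Icc_at)
  qed
  moreover have "integral {0..t} g = 0" if "t \<notin> {a..b}" for t
    using that left[of t] right[of t] by fastforce
  ultimately show ?thesis using g ab unfolding C1c_def by blast
qed

text \<open>
  With a bump \<open>w\<close> and the \<open>w\<close>-average \<open>c\<close> of \<open>H\<close>, the function \<open>w * (H - c)\<close> is the derivative of a
  test function, and testing with it gives \<open>\<integral> w * (H - c)\<^sup>2 = 0\<close>.
\<close>

lemma du_Bois_Reymond_const:
  fixes H :: "real \<Rightarrow> real"
  assumes H: "continuous_on {0..1} H"
    and test: "\<And>\<psi> \<psi>'. C1c \<psi> \<psi>' \<Longrightarrow> (LINT t|leb01. \<psi>' t * H t) = 0"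
  shows "\<exists>c. \<forall>t\<in>{0..1}. H t = c"
proof -
  have const: "\<exists>c. \<forall>t\<in>{a<..<b}. H t = c" if ab: "0 < a" "a < b" "b < 1" for a b
  proof -
    \<comment> \<open>\<open>w\<close> is positive exactly strictly between a and b.
      \<open>He\<close> extends H by constants, so that the later \<open>g\<close> is continuous on
      the whole line, as \<open>C1c\<close> requires.\<close>
    define w where "w t = max 0 (t - a) * max 0 (b - t)" for t :: real
    define He where "He t = H (max 0 (min 1 t))" for t
    have He: "continuous_on UNIV He"
      unfolding He_def by (rule continuous_on_compose2[OF H]) (auto intro!: continuous_intros)
    have He_eq: "He t = H t" if "t \<in> {0..1}" for t using that by (simp add: He_def)
    have w: "continuous_on UNIV w" unfolding w_def by (intro continuous_intros)
    have w_nonneg: "0 \<le> w t" for t by (simp add: w_def)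
    have cont: "continuous_on {0..1} w" "continuous_on {0..1} He"
      using w He by (auto intro: continuous_on_subset)
    have pos: "integral {0..1} w \<noteq> 0"
    proof
      assume "integral {0..1} w = 0"
      then have "(w has_integral 0) (cbox 0 1)"
        using integrable_continuous_interval[OF cont(1)] by (simp add: has_integral_iff)
      then have "w ((a + b) / 2) = 0"
        using cont ab w_nonneg by (intro has_integral_0_cbox_imp_0[of 0 1 w]) (auto simp: field_simps)
      moreover have "0 < w ((a + b) / 2)"
        unfolding w_def using ab by (intro mult_pos_pos) auto
      ultimately show False by simp
    qed
    define c where "c = integral {0..1} (\<lambda>t. w t * He t) / integral {0..1} w"
    define g where "g t = w t * (He t - c)" for t
    have g: "continuous_on UNIV g" unfolding g_def by (intro continuous_intros w He)
    have ints: "(\<lambda>t. w t * He t) integrable_on {0..1}" "(\<lambda>t. c * w t) integrable_on {0..1}"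
      by (intro integrable_continuous_interval continuous_intros cont)+
    have g0: "integral {0..1} g = 0"
    proof -
      have "integral {0..1} g = integral {0..1} (\<lambda>t. w t * He t - c * w t)"
        by (rule Henstock_Kurzweil_Integration.integral_cong) (simp add: g_def algebra_simps)
      also have "\<dots> = integral {0..1} (\<lambda>t. w t * He t) - c * integral {0..1} w"
        by (simp add: Henstock_Kurzweil_Integration.integral_diff[OF ints])
      finally show ?thesis using pos by (simp add: c_def)
    qed
    have "C1c (\<lambda>t. integral {0..t} g) g"
      by (rule C1c_bump_antiderivative[OF g ab _ g0]) (auto simp: g_def w_def)
    then have "(LINT t|leb01. g t * H t) = 0" by (rule test)
    moreover have "continuous_on {0..1} (\<lambda>t. g t * H t)"
      using g H by (intro continuous_on_mult) (auto intro: continuous_on_subset)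
    ultimately have gH: "integral {0..1} (\<lambda>t. g t * H t) = 0"
      by (simp add: integral_leb01_continuous)
    have g01: "continuous_on {0..1} g" using g by (rule continuous_on_subset) simp
    have sq: "continuous_on {0..1} (\<lambda>t. g t * (He t - c))"
      by (intro continuous_intros g01 cont)
    have "integral {0..1} (\<lambda>t. g t * (He t - c)) = integral {0..1} (\<lambda>t. g t * H t - c * g t)"
      by (rule Henstock_Kurzweil_Integration.integral_cong) (simp add: He_eq algebra_simps)
    also have "\<dots> = integral {0..1} (\<lambda>t. g t * H t) - c * integral {0..1} g"
      by (subst Henstock_Kurzweil_Integration.integral_diff)
        (auto intro!: integrable_continuous_interval continuous_intros g01 H)
    finally have "integral {0..1} (\<lambda>t. g t * (He t - c)) = 0" using gH g0 by simp
    then have "((\<lambda>t. g t * (He t - c)) has_integral 0) (cbox 0 1)"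
      using integrable_continuous_interval[OF sq] by (simp add: has_integral_iff)
    then have van: "g t * (He t - c) = 0" if "t \<in> {0..1}" for t
      using sq that w_nonneg
      by (intro has_integral_0_cbox_imp_0[of 0 1 "\<lambda>t. g t * (He t - c)"])
        (auto simp: g_def mult.assoc power2_eq_square[symmetric])
    have "H t = c" if "t \<in> {a<..<b}" for t
    proof -
      have t: "t \<in> {0..1}" and "w t \<noteq> 0" using that ab by (auto simp: w_def)
      with van[OF t] He_eq[OF t] show ?thesis by (simp add: g_def)
    qed
    then show ?thesis by blast
  qed
  have eq: "H s = H t" if st: "s \<in> {0<..<1}" "t \<in> {0<..<1}" for s t
  proof -
    obtain m M where m: "0 < m" "m \<le> s" "m \<le> t" "s \<le> M" "t \<le> M" "M < 1"
      by (rule that[of "min s t" "max s t"]) (use st in simp_all)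
    \<comment> \<open>Any two interior points lie in a common interval whose closure is inside the
      open unit interval; its ends are placed halfway towards 0 and 1.\<close>
    define a b where "a = m / 2" and "b = (1 + M) / 2"
    have "m \<le> M" using m(2,4) by (rule order_trans)
    have ab: "0 < a" "a < m" "M < b" "b < 1" using m(1,6) by (simp_all add: a_def b_def)
    then have "a < b" using \<open>m \<le> M\<close> by simp
    from const[OF ab(1) this ab(4)] obtain c where c: "\<forall>u\<in>{a<..<b}. H u = c" by blast
    have "s \<in> {a<..<b}" "t \<in> {a<..<b}"
      using less_le_trans[OF ab(2) m(2)] less_le_trans[OF ab(2) m(3)]
        le_less_trans[OF m(4) ab(3)] le_less_trans[OF m(5) ab(3)] by simp_all
    with c show ?thesis by metis
  qed
  have const': "H t = H (1/2)" if "t \<in> {0<..<1}" for t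
    using that by (rule eq) simp
  have "H t = H (1/2)" if "t \<in> {0..1}" for t
  proof (rule continuous_constant_on_closure[of "{0<..<1}" H])
    show "continuous_on (closure {0<..<1}) H" "t \<in> closure {0<..<1}" using H that by simp_all
  qed (rule const')
  then show ?thesis by blast
qed

text \<open>Subtracting the antiderivative of G leaves a function with vanishing weak derivative,
  hence a constant. Integration by parts has no boundary terms because \<psi> vanishes at 0 and
  1.\<close>

lemma du_Bois_Reymond:
  fixes F G :: "real \<Rightarrow> real"
  assumes F: "continuous_on {0..1} F" and G: "continuous_on {0..1} G"
    and test: "\<And>\<psi> \<psi>'. C1c \<psi> \<psi>' \<Longrightarrow> (LINT t|leb01. \<psi>' t * F t) = - (LINT t|leb01. \<psi> t * G t)"
    and t: "t \<in> {0..1}"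
  shows "(F has_real_derivative G t) (at t within {0..1})"
proof -
  let ?J = "\<lambda>t. integral {0..t} G"
  have dJ: "(?J has_real_derivative G t) (at t within {0..1})" if "t \<in> {0..1}" for t
    using G that by (rule integral_has_real_derivative)
  then have J: "continuous_on {0..1} ?J" by (rule DERIV_continuous_on)
  have "\<exists>c. \<forall>t\<in>{0..1}. F t - ?J t = c"
  proof (rule du_Bois_Reymond_const)
    show "continuous_on {0..1} (\<lambda>t. F t - ?J t)" using F J by (rule continuous_on_diff)
    fix \<psi> \<psi>' assume \<psi>: "C1c \<psi> \<psi>'"
    note C = C1c_D[OF \<psi>]
    have cont: "continuous_on {0..1} \<psi>" "continuous_on {0..1} \<psi>'"
      using C(2,3) by (auto intro: continuous_on_subset)
    have "((\<lambda>t. \<psi>' t * ?J t + G t * \<psi> t) has_integral \<psi> 1 * ?J 1 - \<psi> 0 * ?J 0) {0..1}"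
    proof (rule fundamental_theorem_of_calculus)
      show "((\<lambda>t. \<psi> t * ?J t) has_vector_derivative \<psi>' t * ?J t + G t * \<psi> t) (at t within {0..1})"
        if "t \<in> {0..1}" for t
        using DERIV_mult[OF has_field_derivative_at_within[OF C(1)] dJ[OF that]]
        by (simp add: has_real_derivative_iff_has_vector_derivative)
    qed simp
    then have "integral {0..1} (\<lambda>t. \<psi>' t * ?J t + G t * \<psi> t) = 0" using C by (simp add: integral_unique)
    moreover have "continuous_on {0..1} (\<lambda>t. \<psi>' t * ?J t)" "continuous_on {0..1} (\<lambda>t. \<psi> t * G t)"
      "continuous_on {0..1} (\<lambda>t. \<psi>' t * F t)"
      by (intro continuous_on_mult cont J G F)+
    note ints = this[THEN integral_leb01_continuous(1)]
    moreover have "continuous_on {0..1} (\<lambda>t. \<psi>' t * ?J t + G t * \<psi> t)"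
      by (intro continuous_on_add continuous_on_mult cont J G)
    note integral_leb01_continuous(2)[OF this]
    ultimately have "(LINT t|leb01. \<psi>' t * ?J t + G t * \<psi> t) = 0" by argo
    with test[OF \<psi>] ints show "(LINT t|leb01. \<psi>' t * (F t - ?J t)) = 0"
      by (simp add: right_diff_distrib mult.commute)
  qed
  then obtain c where c: "\<And>t. t \<in> {0..1} \<Longrightarrow> F t = ?J t + c" by (metis diff_add_cancel add.commute)
  have "((\<lambda>t. ?J t + c) has_real_derivative G t) (at t within {0..1})"
    using DERIV_add[OF dJ[OF t] DERIV_const[of c]] by simp
  then show ?thesis
    by (rule has_field_derivative_transform_within[where d = 1]) (use t c in auto)
qed

text \<open>Integrating the weak identity over space up to x, with Fubini, gives a scalar weak
  identity in time. The null set may depend on \<psi>, which is harmless because \<psi> is fixed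
  during this integration. As both primitives are continuous in time, the lemma of du Bois-Reymond
  makes the derivative classical, and this for every x.\<close>

lemma prim_has_time_derivative:
  assumes q: "C0_L2 q" and v: "C0_L2 v" and qv: "weak_deriv q v" and x: "x \<in> {0..1}" and t: "t \<in> {0..1}"
  shows "((\<lambda>t. prim (q t) x) has_real_derivative prim (v t) x) (at t within {0..1})"
proof (rule du_Bois_Reymond[OF prim_continuous_in_time prim_continuous_in_time _ t])
  fix \<psi> \<psi>' assume \<psi>: "C1c \<psi> \<psi>'"
  have fub: "(LINT t|leb01. g t * prim (u t) x) = (LINT y|leb01. indicator {0..x} y * (LINT t|leb01. g t * u t y))"
    and meas: "(\<lambda>y. LINT t|leb01. g t * u t y) \<in> borel_measurable leb01"
    if g: "continuous_on UNIV g" and u: "L2_L2 u" for g u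
  proof -
    obtain B where B: "\<And>t. t \<in> {0..1} \<Longrightarrow> \<bar>g t\<bar> \<le> B" "0 \<le> B" using continuous_clamp_bounded[OF g] by metis
    have [measurable]: "g \<in> borel_measurable borel" using g by (rule borel_measurable_continuous_onI)
    note [measurable] = L2_L2_D(1)[OF u]
    have um: "(\<lambda>z. u (fst z) (snd z)) \<in> borel_measurable leb2"
      using L2_L2_D(1)[OF u] by (simp add: case_prod_beta')
    have uI: "integrable leb2 (\<lambda>z. u (fst z) (snd z))"
      using L2_L2_D(2)[OF u] by (simp add: case_prod_beta')
    have gm: "(\<lambda>z. g (fst z)) \<in> borel_measurable leb2" by measurable
    have im: "(\<lambda>z. indicator {0..x} (snd z) :: real) \<in> borel_measurable leb2" by measurable
    have "integrable leb2 (\<lambda>z. indicator {0..x} (snd z) * (g (fst z) * u (fst z) (snd z)))"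
    proof (rule Bochner_Integration.integrable_bound)
      show "integrable leb2 (\<lambda>z. B * u (fst z) (snd z))" using uI by simp
      show "(\<lambda>z. indicator {0..x} (snd z) * (g (fst z) * u (fst z) (snd z))) \<in> borel_measurable leb2"
        using um gm im by measurable
      show "AE z in leb2. norm (indicator {0..x} (snd z) * (g (fst z) * u (fst z) (snd z)))
          \<le> norm (B * u (fst z) (snd z))"
        using B by (intro AE_I2) (auto simp: space_leb2 indicator_def abs_mult intro!: mult_right_mono)
    qed
    then have int: "integrable leb2 (\<lambda>(t, y). indicator {0..x} y * (g t * u t y))"
      by (simp add: case_prod_beta')
    have "(LINT t|leb01. g t * prim (u t) x) = (LINT t|leb01. LINT y|leb01. indicator {0..x} y * (g t * u t y))"
      using x by (simp add: prim_leb01 mult.left_commute flip: Bochner_Integration.integral_mult_right_zero)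
    also have "\<dots> = (LINT y|leb01. LINT t|leb01. indicator {0..x} y * (g t * u t y))"
      by (rule leb2.Fubini_integral[OF int, symmetric])
    finally show "(LINT t|leb01. g t * prim (u t) x) = (LINT y|leb01. indicator {0..x} y * (LINT t|leb01. g t * u t y))"
      by simp
    have "(\<lambda>z. g (snd z) * u (snd z) (fst z)) \<in> borel_measurable leb2"
      using measurable_compose[OF measurable_pair_swap' borel_measurable_times[OF gm um]] by (simp add: case_prod_beta')
    then show "(\<lambda>y. LINT t|leb01. g t * u t y) \<in> borel_measurable leb01"
      by (intro leb01.borel_measurable_lebesgue_integral) (simp add: case_prod_beta')
  qed
  have W: "L2_L2 q" "L2_L2 v" "AE y in leb01. (LINT t|leb01. \<psi>' t * q t y) = - (LINT t|leb01. \<psi> t * v t y)"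
    using qv \<psi> by (auto simp: weak_deriv_def)
  note C = C1c_D(2,3)[OF \<psi>]
  have [measurable]: "(\<lambda>y. indicator {0..x} y :: real) \<in> borel_measurable leb01" by measurable
  have "(LINT t|leb01. \<psi>' t * prim (q t) x) = (LINT y|leb01. indicator {0..x} y * - (LINT t|leb01. \<psi> t * v t y))"
    unfolding fub[OF C(1) W(1)]
    using meas[OF C(1) W(1)] meas[OF C(2) W(2)] W(3)
    by (intro integral_cong_AE) (auto elim: eventually_mono)
  also have "\<dots> = - (LINT t|leb01. \<psi> t * prim (v t) x)"
    unfolding fub[OF C(2) W(2)] by simp
  finally show "(LINT t|leb01. \<psi>' t * prim (q t) x) = - (LINT t|leb01. \<psi> t * prim (v t) x)" .
qed (use q v x in auto)

section \<open>Uniqueness of weak time derivatives\<close>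

lemma leb01_times_measurable:
  assumes "g \<in> borel_measurable borel" "d \<in> borel_measurable leb01"
  shows "(\<lambda>t. g t * d t :: real) \<in> borel_measurable leb01"
  by (rule borel_measurable_times[OF borel_measurable_leb01I[OF assms(1)] assms(2)])

text \<open>The positive and negative parts of \<open>d\<close> are densities of two finite measures
  that agree on rational initial segments, hence coincide. \<open>ennreal (d t)\<close> and
  \<open>ennreal (- d t)\<close> are equal only where \<open>d t\<close> is 0.\<close>

lemma AE_zero_if_lower_integrals_zero:
  fixes d :: "real \<Rightarrow> real"
  assumes d: "integrable leb01 d" and zero: "\<And>c. c \<in> \<rat> \<Longrightarrow> (LINT t|leb01. indicator {..<c} t * d t) = 0"
  shows "AE t in leb01. d t = 0"
proof -
  have [measurable]: "d \<in> borel_measurable leb01" using d by auto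
  let ?M = "density leb01 (\<lambda>t. ennreal (d t))" and ?N = "density leb01 (\<lambda>t. ennreal (- d t))"
  have fin: "(\<integral>\<^sup>+t. ennreal (d t) \<partial>leb01) < \<infinity>" "(\<integral>\<^sup>+t. ennreal (- d t) \<partial>leb01) < \<infinity>"
    using d by (auto simp: real_integrable_def less_top)
  have "?M = ?N"
  proof (rule measure_I_eqI)
    have tot: "emeasure (density leb01 f) (space (density leb01 f)) = (\<integral>\<^sup>+t. f t \<partial>leb01)"
      if f: "f \<in> borel_measurable leb01" for f
      unfolding space_density emeasure_density[OF f sets.top] by (auto intro!: nn_integral_cong)
    have "emeasure ?M (space ?M) = (\<integral>\<^sup>+t. ennreal (d t) \<partial>leb01)"
      "emeasure ?N (space ?N) = (\<integral>\<^sup>+t. ennreal (- d t) \<partial>leb01)"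
      by (rule tot; measurable)+
    with fin show "finite_measure ?M" "finite_measure ?N"
      by (auto intro!: finite_measureI)
    fix c :: real assume c: "c \<in> \<rat>"
    have set [measurable]: "{0..1} \<inter> {..<c} \<in> sets leb01" by (auto simp: sets_leb01 sets_borel_I)
    have "(\<lambda>t. indicator {..<c} t * d t) \<in> borel_measurable leb01"
      by (rule leb01_times_measurable) measurable
    then have int: "integrable leb01 (\<lambda>t. indicator {..<c} t * d t)"
      by (rule Bochner_Integration.integrable_bound[OF d]) (auto simp: indicator_def)
    have fin': "(\<integral>\<^sup>+t. ennreal (indicator {..<c} t * d t) \<partial>leb01) < \<infinity>"
        "(\<integral>\<^sup>+t. ennreal (- (indicator {..<c} t * d t)) \<partial>leb01) < \<infinity>"
      using int by (auto simp: real_integrable_def less_top)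
    have "enn2real (\<integral>\<^sup>+t. ennreal (indicator {..<c} t * d t) \<partial>leb01) =
        enn2real (\<integral>\<^sup>+t. ennreal (- (indicator {..<c} t * d t)) \<partial>leb01)"
      using zero[OF c] real_lebesgue_integral_def[OF int] by simp
    then have "(\<integral>\<^sup>+t. ennreal (indicator {..<c} t * d t) \<partial>leb01) = (\<integral>\<^sup>+t. ennreal (- (indicator {..<c} t * d t)) \<partial>leb01)"
      using ennreal_enn2real[OF fin'(1)[unfolded infinity_ennreal_def]]
        ennreal_enn2real[OF fin'(2)[unfolded infinity_ennreal_def]] by metis
    moreover have "emeasure ?M ({0..1} \<inter> {..<c}) = (\<integral>\<^sup>+t. ennreal (indicator {..<c} t * d t) \<partial>leb01)"
      by (subst emeasure_density) (auto intro!: nn_integral_cong simp: indicator_def space_leb01)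
    moreover have "emeasure ?N ({0..1} \<inter> {..<c}) = (\<integral>\<^sup>+t. ennreal (- (indicator {..<c} t * d t)) \<partial>leb01)"
      by (subst emeasure_density) (auto intro!: nn_integral_cong simp: indicator_def space_leb01)
    ultimately show "emeasure ?M ({0..1} \<inter> {..<c}) = emeasure ?N ({0..1} \<inter> {..<c})" by simp
  qed (simp_all add: sets_leb01)
  then have "AE t in leb01. ennreal (d t) = ennreal (- d t)"
    by (subst (asm) leb01.density_unique_iff) auto
  then show ?thesis
  proof (rule eventually_mono)
    show "d t = 0" if "ennreal (d t) = ennreal (- d t)" for t
      using that by (cases "d t \<ge> 0") (auto simp: ennreal_neg ennreal_eq_0_iff)
  qed
qed

text \<open>A product of two one-sided cutoffs, the left one reflected. In contrast to
  \<open>cutoff\<close> it can be supported inside the open unit interval, and it is identically 0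
  when b is at most a.\<close>

definition bump :: "real \<Rightarrow> real \<Rightarrow> nat \<Rightarrow> real \<Rightarrow> real" where
  "bump a b n t = cutoff (- a) n (- t) * cutoff b n t"

definition bump_deriv :: "real \<Rightarrow> real \<Rightarrow> nat \<Rightarrow> real \<Rightarrow> real" where
  "bump_deriv a b n t = - max_square_deriv (- a) n (- t) * cutoff b n t + max_square_deriv b n t * cutoff (- a) n (- t)"

lemma C1c_bump:
  assumes "0 < a" "b < 1"
  shows "C1c (bump a b n) (bump_deriv a b n)"
  unfolding C1c_def
proof (intro conjI allI)
  fix t
  have "((\<lambda>t. cutoff (- a) n (- t)) has_real_derivative max_square_deriv (- a) n (- t) * (- 1)) (at t)"
    by (rule DERIV_chain2[OF cutoff_has_derivative]) (rule DERIV_minus[OF DERIV_ident])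
  from DERIV_mult[OF this cutoff_has_derivative[of b n t]]
  show "(bump a b n has_real_derivative bump_deriv a b n t) (at t)"
    unfolding bump_def[abs_def] bump_deriv_def by simp
next
  show "continuous_on UNIV (bump_deriv a b n)"
    unfolding bump_deriv_def
    by (intro continuous_on_add continuous_on_mult continuous_on_minus continuous_on_cutoff
        continuous_on_max_square_deriv continuous_on_id)
  show "\<exists>a' b'. 0 < a' \<and> b' < 1 \<and> (\<forall>t. t \<notin> {a'..b'} \<longrightarrow> bump a b n t = 0)"
    using assms by (intro exI[of _ a] exI[of _ b]) (auto simp: bump_def cutoff_eq_0)
qed

lemma bump_bounds: "\<bar>bump a b n t\<bar> \<le> 1"
  unfolding bump_def abs_mult by (intro mult_le_one cutoff_bounds abs_ge_zero)

lemma bump_tendsto: "(\<lambda>n. bump a b n t) \<longlonglongrightarrow> indicator {a<..<b} t"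
proof -
  have "indicator {..<- a} (- t) * indicator {..<b} t = (indicator {a<..<b} t :: real)"
    by (auto simp: indicator_def)
  with tendsto_mult[OF cutoff_tendsto[of "- a" "- t"] cutoff_tendsto[of b t]] show ?thesis
    unfolding bump_def by simp
qed

text \<open>Letting \<open>n\<close> tend to infinity turns bumps into indicators, and then
  \<open>k\<close> exhausts the open interval from 0 to \<open>min c 1\<close>. The margin 1 / (k +
  2) keeps the supports away from 0 and 1, and all parameters range over countable sets.\<close>

lemma AE_zero_if_bump_integrals_zero:
  fixes d :: "real \<Rightarrow> real"
  assumes d: "integrable leb01 d"
    and zero: "\<And>c k n. c \<in> \<rat> \<Longrightarrow>
      (LINT t|leb01. bump (1 / (real k + 2)) (min c (1 - 1 / (real k + 2))) n t * d t) = 0"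
  shows "AE t in leb01. d t = 0"
proof (rule AE_zero_if_lower_integrals_zero[OF d])
  fix c :: real assume c: "c \<in> \<rat>"
  have [measurable]: "d \<in> borel_measurable leb01" using d by auto
  have nd: "integrable leb01 (\<lambda>t. \<bar>d t\<bar>)" using d by (rule integrable_abs)
  let ?a = "\<lambda>k::nat. 1 / (real k + 2)" and ?b = "\<lambda>k::nat. min c (1 - 1 / (real k + 2))"
  have k0: "(LINT t|leb01. indicator {?a k<..<?b k} t * d t) = 0" for k
  proof -
    have "(\<lambda>n. LINT t|leb01. bump (?a k) (?b k) n t * d t) \<longlonglongrightarrow> (LINT t|leb01. indicator {?a k<..<?b k} t * d t)"
    proof (rule integral_dominated_convergence[OF _ _ nd])
      show "(\<lambda>t. bump (?a k) (?b k) n t * d t) \<in> borel_measurable leb01" for n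
        unfolding bump_def by (rule leb01_times_measurable) measurable
      show "(\<lambda>t. indicator {?a k<..<?b k} t * d t) \<in> borel_measurable leb01"
        by (rule leb01_times_measurable) measurable
      show "AE t in leb01. (\<lambda>n. bump (?a k) (?b k) n t * d t) \<longlonglongrightarrow> indicator {?a k<..<?b k} t * d t"
        by (intro AE_I2 tendsto_mult_right bump_tendsto)
      show "AE t in leb01. norm (bump (?a k) (?b k) n t * d t) \<le> \<bar>d t\<bar>" for n
        unfolding real_norm_def abs_mult by (intro AE_I2 mult_left_le_one_le bump_bounds abs_ge_zero)
    qed
    then show ?thesis using zero[OF c] by (simp add: LIMSEQ_const_iff)
  qed
  have "(\<lambda>k. LINT t|leb01. indicator {?a k<..<?b k} t * d t) \<longlonglongrightarrow> (LINT t|leb01. indicator {0<..<min c 1} t * d t)"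
  proof (rule integral_dominated_convergence[OF _ _ nd])
    show "(\<lambda>t. indicator {?a k<..<?b k} t * d t) \<in> borel_measurable leb01" for k
      by (rule leb01_times_measurable) measurable
    show "(\<lambda>t. indicator {0<..<min c 1} t * d t) \<in> borel_measurable leb01"
      by (rule leb01_times_measurable) measurable
    show "AE t in leb01. norm (indicator {?a k<..<?b k} t * d t) \<le> \<bar>d t\<bar>" for k
      by (intro AE_I2) (auto simp: indicator_def)
    show "AE t in leb01. (\<lambda>k. indicator {?a k<..<?b k} t * d t) \<longlonglongrightarrow> indicator {0<..<min c 1} t * d t"
    proof (intro AE_I2 tendsto_mult_right tendsto_eventually)
      fix t :: real
      have lim: "(\<lambda>k. 1 / (real k + 2)) \<longlonglongrightarrow> 0"
        using LIMSEQ_ignore_initial_segment[OF lim_1_over_n, of 2] by (simp add: add.commute)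
      show "\<forall>\<^sub>F k in sequentially. indicator {?a k<..<?b k} t = (indicator {0<..<min c 1} t :: real)"
      proof (cases "t \<in> {0<..<min c 1}")
        case True
        have "\<forall>\<^sub>F k in sequentially. 1 / (real k + 2) < min t (1 - t)"
          using lim by (rule order_tendstoD) (use True in auto)
        then show ?thesis by (rule eventually_mono) (use True in \<open>auto simp: indicator_def\<close>)
      next
        case False
        have "1 / (real k + 2) > 0" for k by simp
        then have "t \<notin> {?a k<..<?b k}" for k
          using False by (smt (verit, best) greaterThanLessThan_iff)
        then have ind: "indicator {?a k<..<?b k} t = (0::real)" for k by (rule indicator_simps)
        have "indicator {0<..<min c 1} t = (0::real)" using False by (rule indicator_simps)
        then show ?thesis unfolding ind by simp
      qed
    qed
  qed
  then have z: "(LINT t|leb01. indicator {0<..<min c 1} t * d t) = 0"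
    using k0 by (simp add: LIMSEQ_const_iff)
  have "AE t in leb01. t \<noteq> 0 \<and> t \<noteq> 1"
    by (subst AE_restrict_space_iff) (auto intro: AE_mp[OF AE_lborel_singleton] AE_mp[OF AE_conjI[OF AE_lborel_singleton AE_lborel_singleton]])
  then have "AE t in leb01. indicator {..<c} t * d t = indicator {0<..<min c 1} t * d t"
    using AE_space by eventually_elim (auto simp: indicator_def space_leb01)
  then have "(LINT t|leb01. indicator {..<c} t * d t) = (LINT t|leb01. indicator {0<..<min c 1} t * d t)"
    by (intro integral_cong_AE leb01_times_measurable) measurable
  with z show "(LINT t|leb01. indicator {..<c} t * d t) = 0" by simp
qed

lemma C1c_integrable:
  fixes f g :: "real \<Rightarrow> real"
  assumes "continuous_on UNIV g" "integrable leb01 f"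
  shows "integrable leb01 (\<lambda>t. g t * f t)"
proof -
  obtain B where B: "\<And>t. t \<in> {0..1} \<Longrightarrow> \<bar>g t\<bar> \<le> B" "0 \<le> B" using continuous_clamp_bounded[OF assms(1)] by metis
  have "g \<in> borel_measurable leb01"
    using assms(1) by (intro borel_measurable_leb01I borel_measurable_continuous_onI)
  then have "(\<lambda>t. g t * f t) \<in> borel_measurable leb01" using assms(2) by (intro borel_measurable_times) auto
  then show ?thesis
    by (rule Bochner_Integration.integrable_bound[OF integrable_mult_right[OF assms(2), of B]])
      (use B in \<open>auto intro!: AE_I2 mult_right_mono simp: abs_mult space_leb01\<close>)
qed

lemma L2_L2_section:
  assumes "L2_L2 u"
  shows "AE x in leb01. integrable leb01 (\<lambda>t. u t x)"
  using leb2.AE_integrable_snd[OF L2_L2_D(2)[OF assms]] by simp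

text \<open>The exceptional set in x depends on the test function, so only countably many tests may
  be used. The bumps with rational endpoint \<open>c\<close> suffice, and uniqueness is then decided
  separately at almost every x.\<close>

lemma weak_deriv_unique:
  assumes v: "weak_deriv u v" and w: "weak_deriv u w"
  shows "AE x in leb01. AE t in leb01. v t x = w t x"
proof -
  let ?\<psi> = "\<lambda>(c::real) (k::nat) (n::nat). bump (1 / (real k + 2)) (min c (1 - 1 / (real k + 2))) n"
  have C: "C1c (?\<psi> c k n) (bump_deriv (1 / (real k + 2)) (min c (1 - 1 / (real k + 2))) n)" for c and k n
    by (rule C1c_bump) (simp, rule le_less_trans[OF min.cobounded2], simp)
  have L: "L2_L2 v" "L2_L2 w" using v w by (auto simp: weak_deriv_def)
  have "AE x in leb01. (LINT t|leb01. ?\<psi> c k n t * v t x) = (LINT t|leb01. ?\<psi> c k n t * w t x)" for c k n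
    using v[unfolded weak_deriv_def, THEN conjunct2, THEN conjunct2, rule_format, OF C[of k c n]]
      w[unfolded weak_deriv_def, THEN conjunct2, THEN conjunct2, rule_format, OF C[of k c n]]
    by eventually_elim simp
  then have "\<forall>c\<in>\<rat>. AE x in leb01. \<forall>k n. (LINT t|leb01. ?\<psi> c k n t * v t x) = (LINT t|leb01. ?\<psi> c k n t * w t x)"
    unfolding AE_all_countable by blast
  then have "AE x in leb01. \<forall>c\<in>\<rat>. \<forall>k n. (LINT t|leb01. ?\<psi> c k n t * v t x) = (LINT t|leb01. ?\<psi> c k n t * w t x)"
    by (rule AE_ball_countable[OF countable_rat, THEN iffD2])
  then show ?thesis
    using L2_L2_section[OF L(1)] L2_L2_section[OF L(2)]
  proof eventually_elim
    case (elim x)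
    have "AE t in leb01. v t x - w t x = 0"
    proof (rule AE_zero_if_bump_integrals_zero)
      show "integrable leb01 (\<lambda>t. v t x - w t x)" using elim by simp
      fix c :: real and k n assume "c \<in> \<rat>"
      with elim have "(LINT t|leb01. ?\<psi> c k n t * v t x) = (LINT t|leb01. ?\<psi> c k n t * w t x)" by blast
      with C1c_integrable[OF C1c_D(3)[OF C[of k c n]] elim(2)] C1c_integrable[OF C1c_D(3)[OF C[of k c n]] elim(3)]
      show "(LINT t|leb01. ?\<psi> c k n t * (v t x - w t x)) = 0"
        by (simp add: right_diff_distrib)
    qed
    then show ?case by simp
  qed
qed

text \<open>Needed because \<open>H2_L2\<close> only asserts that some weak derivative is again
  weakly differentiable; this carries the property over to the representative in use.\<close>

lemma weak_deriv_cong: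
  assumes v: "weak_deriv v a" and eq: "AE x in leb01. AE t in leb01. v t x = w t x" and w: "L2_L2 w"
  shows "weak_deriv w a"
  unfolding weak_deriv_def
proof (intro conjI allI impI w)
  show "L2_L2 a" using v by (simp add: weak_deriv_def)
  have L: "L2_L2 v" using v by (simp add: weak_deriv_def)
  fix \<psi> \<psi>' assume \<psi>: "C1c \<psi> \<psi>'"
  have c: "continuous_on UNIV \<psi>'" using C1c_D[OF \<psi>] by simp
  have "AE x in leb01. (LINT t|leb01. \<psi>' t * v t x) = - (LINT t|leb01. \<psi> t * a t x)"
    using v \<psi> by (simp add: weak_deriv_def)
  then show "AE x in leb01. (LINT t|leb01. \<psi>' t * w t x) = - (LINT t|leb01. \<psi> t * a t x)"
    using eq L2_L2_section[OF L] L2_L2_section[OF w]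
  proof eventually_elim
    case (elim x)
    have "(LINT t|leb01. \<psi>' t * w t x) = (LINT t|leb01. \<psi>' t * v t x)"
    proof (rule integral_cong_AE)
      show "AE t in leb01. \<psi>' t * w t x = \<psi>' t * v t x"
        using elim(2) by eventually_elim simp
    qed (use C1c_integrable[OF c elim(3)] C1c_integrable[OF c elim(4)] in auto)
    with elim show ?case by simp
  qed
qed

section \<open>Product rule for weak time derivatives\<close>

lemma C1c_mult_power:
  assumes "C1c \<psi> \<psi>'"
  shows "C1c (\<lambda>t. \<psi> t * t ^ k) (\<lambda>t. \<psi>' t * t ^ k + \<psi> t * (real k * t ^ (k - 1)))"
  unfolding C1c_def
proof (intro conjI allI)
  note C = C1c_D[OF assms]
  show "((\<lambda>t. \<psi> t * t ^ k) has_real_derivative \<psi>' t * t ^ k + \<psi> t * (real k * t ^ (k - 1))) (at t)" for t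
    using DERIV_mult[OF C(1) DERIV_pow[of k t]] by (simp add: algebra_simps)
  show "continuous_on UNIV (\<lambda>t. \<psi>' t * t ^ k + \<psi> t * (real k * t ^ (k - 1)))"
    by (intro continuous_on_add continuous_on_mult C continuous_on_power continuous_on_id continuous_on_const)
  show "\<exists>a b. 0 < a \<and> b < 1 \<and> (\<forall>t. t \<notin> {a..b} \<longrightarrow> \<psi> t * t ^ k = 0)"
    using assms unfolding C1c_def by (metis mult_zero_left)
qed

lemma integral_lincomb_sum:
  fixes f :: "'a \<Rightarrow> real"
  assumes "integrable M f" "\<And>i. integrable M (g i)"
  shows "(LINT t|M. a * f t + (\<Sum>i\<le>n::nat. b i * g i t)) = a * (LINT t|M. f t) + (\<Sum>i\<le>n. b i * (LINT t|M. g i t))"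
  using assms by simp

text \<open>
  The exceptional null set of a weak derivative depends on the test function, whereas the factor \<open>e\<close>
  below varies with the spatial variable. Testing with the countably many functions \<open>\<psi> t * t ^ k\<close>
  and approximating the derivative of \<open>e\<close> uniformly by polynomials in \<open>t\<close> settles the difference.
\<close>

lemma product_rule_section:
  fixes \<psi> \<psi>' v a e e' :: "real \<Rightarrow> real"
  assumes \<psi>: "continuous_on UNIV \<psi>" "continuous_on UNIV \<psi>'"
    and v: "integrable leb01 v" and a: "integrable leb01 a"
    and test: "\<And>k. (LINT t|leb01. (\<psi>' t * t ^ k + \<psi> t * (real k * t ^ (k - 1))) * v t) =
      - (LINT t|leb01. (\<psi> t * t ^ k) * a t)"
    and e: "\<And>t. t \<in> {0..1} \<Longrightarrow> (e has_real_derivative e' t) (at t within {0..1})"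
    and e': "continuous_on {0..1} e'"
  shows "(LINT t|leb01. (\<psi>' t * e t + \<psi> t * e' t) * v t + (\<psi> t * e t) * a t) = 0"
proof -
  have ec: "continuous_on {0..1} e" using e by (rule DERIV_continuous_on)
  let ?L = "\<lambda>g g' t. (\<psi>' t * g t + \<psi> t * g' t) * v t + (\<psi> t * g t) * a t"
  have intcont: "integrable leb01 (\<lambda>t. g t * f t)" if g: "continuous_on {0..1} g" and f: "integrable leb01 f"
    for g f :: "real \<Rightarrow> real"
  proof -
    have "continuous_on UNIV (\<lambda>t. g (max 0 (min 1 t)))"
      by (rule continuous_on_compose2[OF g]) (auto intro!: continuous_intros)
    from C1c_integrable[OF this f] have "integrable leb01 (\<lambda>t. g (max 0 (min 1 t)) * f t)" .
    moreover have "integrable leb01 (\<lambda>t. g (max 0 (min 1 t)) * f t) = integrable leb01 (\<lambda>t. g t * f t)"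
      by (rule Bochner_Integration.integrable_cong) (auto simp: space_leb01)
    ultimately show ?thesis by simp
  qed
  have \<psi>c: "continuous_on {0..1} \<psi>" "continuous_on {0..1} \<psi>'"
    using \<psi> by (auto intro: continuous_on_subset)
  have Lint: "integrable leb01 (?L g g')" if "continuous_on {0..1} g" "continuous_on {0..1} g'" for g g'
    using that \<psi>c v a by (intro Bochner_Integration.integrable_add intcont continuous_on_add continuous_on_mult)
  \<comment> \<open>For k = 0 the truncated exponent k - 1 is harmless, since it comes with the
    factor \<open>real k\<close>.\<close>
  have monom: "(LINT t|leb01. ?L (\<lambda>t. t ^ k) (\<lambda>t. real k * t ^ (k - 1)) t) = 0" for k
  proof -
    have "continuous_on {0..1} (\<lambda>t. \<psi>' t * t ^ k + \<psi> t * (real k * t ^ (k - 1)))" "continuous_on {0..1} (\<lambda>t. \<psi> t * t ^ k)"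
      by (intro continuous_on_add continuous_on_mult \<psi>c continuous_on_power continuous_on_id continuous_on_const)+
    then show ?thesis using test[of k] by (subst Bochner_Integration.integral_add) (auto intro!: intcont v a)
  qed
  have monom_int: "integrable leb01 (?L (\<lambda>t. t ^ k) (\<lambda>t. real k * t ^ (k - 1)))" for k
    by (intro Lint continuous_on_mult continuous_on_power continuous_on_id continuous_on_const)
  \<comment> \<open>\<open>K\<close> is the factor by which a uniform error in \<open>e\<close> and
    \<open>e'\<close> changes the left-hand side; it does not depend on the approximation.\<close>
  define K where "K = (LINT t|leb01. (\<bar>\<psi>' t\<bar> + \<bar>\<psi> t\<bar>) * \<bar>v t\<bar> + \<bar>\<psi> t\<bar> * \<bar>a t\<bar>)"
  have Kint: "integrable leb01 (\<lambda>t. (\<bar>\<psi>' t\<bar> + \<bar>\<psi> t\<bar>) * \<bar>v t\<bar> + \<bar>\<psi> t\<bar> * \<bar>a t\<bar>)"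
    by (intro Bochner_Integration.integrable_add intcont continuous_on_add continuous_on_rabs \<psi>c integrable_abs v a)
  have K: "0 \<le> K" unfolding K_def by (rule Bochner_Integration.integral_nonneg) simp
  have small: "\<bar>LINT t|leb01. ?L e e' t\<bar> \<le> \<epsilon> * K" if \<epsilon>: "0 < \<epsilon>" for \<epsilon>
  proof -
    obtain R where R: "real_polynomial_function R" "\<And>t. t \<in> {0..1} \<Longrightarrow> \<bar>e' t - R t\<bar> < \<epsilon>"
      using Stone_Weierstrass_real_polynomial_function[OF compact_Icc e' \<epsilon>] by metis
    then obtain c n where Rc: "R = (\<lambda>t. \<Sum>i\<le>n. c i * t ^ i)"
      unfolding real_polynomial_function_iff_sum by blast
    \<comment> \<open>The derivative is approximated first and then integrated from the exact value
      at 0, so that \<open>P\<close> is uniformly close to \<open>e\<close> and its derivative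
      \<open>R\<close> uniformly close to \<open>e'\<close> at the same time.\<close>
    define P where "P t = e 0 + (\<Sum>i\<le>n. c i / real (Suc i) * t ^ Suc i)" for t
    have dP: "(P has_real_derivative R t) (at t)" for t
    proof -
      have "((\<lambda>t. c i / real (Suc i) * t ^ Suc i) has_real_derivative c i * t ^ i) (at t)" for i
        using DERIV_cmult[OF DERIV_pow[of "Suc i" t], of "c i / real (Suc i)"] by (simp del: of_nat_Suc)
      then have "((\<lambda>t. \<Sum>i\<le>n. c i / real (Suc i) * t ^ Suc i) has_real_derivative (\<Sum>i\<le>n. c i * t ^ i)) (at t)"
        by (intro DERIV_sum)
      from DERIV_add[OF DERIV_const[of "e 0"] this] show ?thesis by (simp add: P_def[abs_def] Rc)
    qed
    have close: "\<bar>e t - P t\<bar> \<le> \<epsilon>" if t: "t \<in> {0..1}" for t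
    proof -
      have "norm ((e t - P t) - (e 0 - P 0)) \<le> \<epsilon> * norm (t - 0)"
      proof (rule field_differentiable_bound[of "{0..1}"])
        show "((\<lambda>t. e t - P t) has_field_derivative e' s - R s) (at s within {0..1})" if "s \<in> {0..1}" for s
          by (rule DERIV_diff[OF e[OF that] has_field_derivative_at_within[OF dP]])
        show "norm (e' s - R s) \<le> \<epsilon>" if "s \<in> {0..1}" for s using R(2)[OF that] by simp
      qed (use t in auto)
      moreover have "P 0 = e 0" by (simp add: P_def)
      moreover have "\<epsilon> * norm (t - 0) \<le> \<epsilon>" using t \<epsilon> by simp
      ultimately show ?thesis by simp
    qed
    have Rcont: "continuous_on {0..1} R" and Pcont: "continuous_on {0..1} P"
      using dP unfolding Rc
      by (auto intro!: continuous_intros DERIV_continuous_on[of _ P, OF has_field_derivative_at_within])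
    have "(LINT t|leb01. ?L P R t) = 0"
    proof -
      have "?L P R t = e 0 * ?L (\<lambda>t. t ^ 0) (\<lambda>t. real 0 * t ^ (0 - 1)) t +
          (\<Sum>i\<le>n. c i / real (Suc i) * ?L (\<lambda>t. t ^ Suc i) (\<lambda>t. real (Suc i) * t ^ (Suc i - 1)) t)" for t
        unfolding P_def Rc
        by (simp add: algebra_simps sum_distrib_left sum_distrib_right sum.distrib del: of_nat_Suc)
      then have "(LINT t|leb01. ?L P R t) = (LINT t|leb01. e 0 * ?L (\<lambda>t. t ^ 0) (\<lambda>t. real 0 * t ^ (0 - 1)) t +
          (\<Sum>i\<le>n. c i / real (Suc i) * ?L (\<lambda>t. t ^ Suc i) (\<lambda>t. real (Suc i) * t ^ (Suc i - 1)) t))"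
        by (rule Bochner_Integration.integral_cong[OF refl])
      also have "\<dots> = e 0 * (LINT t|leb01. ?L (\<lambda>t. t ^ 0) (\<lambda>t. real 0 * t ^ (0 - 1)) t) +
          (\<Sum>i\<le>n. c i / real (Suc i) * (LINT t|leb01. ?L (\<lambda>t. t ^ Suc i) (\<lambda>t. real (Suc i) * t ^ (Suc i - 1)) t))"
        by (rule integral_lincomb_sum[OF monom_int monom_int])
      also have "\<dots> = 0" unfolding monom by simp
      finally show ?thesis .
    qed
    moreover have "(LINT t|leb01. ?L e e' t - ?L P R t) = (LINT t|leb01. ?L e e' t) - (LINT t|leb01. ?L P R t)"
      by (rule Bochner_Integration.integral_diff[OF Lint[OF ec e'] Lint[OF Pcont Rcont]])
    ultimately have "\<bar>LINT t|leb01. ?L e e' t\<bar> = \<bar>LINT t|leb01. ?L e e' t - ?L P R t\<bar>" by simp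
    also have "\<dots> \<le> (LINT t|leb01. \<bar>?L e e' t - ?L P R t\<bar>)" by (rule integral_abs_bound)
    also have "\<dots> \<le> (LINT t|leb01. \<epsilon> * ((\<bar>\<psi>' t\<bar> + \<bar>\<psi> t\<bar>) * \<bar>v t\<bar> + \<bar>\<psi> t\<bar> * \<bar>a t\<bar>))"
    proof (rule integral_mono)
      show "integrable leb01 (\<lambda>t. \<bar>?L e e' t - ?L P R t\<bar>)"
        by (intro integrable_abs Bochner_Integration.integrable_diff Lint ec e' Pcont Rcont)
      show "integrable leb01 (\<lambda>t. \<epsilon> * ((\<bar>\<psi>' t\<bar> + \<bar>\<psi> t\<bar>) * \<bar>v t\<bar> + \<bar>\<psi> t\<bar> * \<bar>a t\<bar>))"
        by (rule integrable_mult_right[OF Kint])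
      fix t assume "t \<in> space leb01"
      then have t: "t \<in> {0..1}" by (simp add: space_leb01)
      have 1: "\<bar>\<psi>' t * (e t - P t)\<bar> \<le> \<bar>\<psi>' t\<bar> * \<epsilon>" "\<bar>\<psi> t * (e' t - R t)\<bar> \<le> \<bar>\<psi> t\<bar> * \<epsilon>"
          "\<bar>\<psi> t * (e t - P t)\<bar> \<le> \<bar>\<psi> t\<bar> * \<epsilon>"
        unfolding abs_mult using close[OF t] R(2)[OF t] by (intro mult_left_mono; simp)+
      have "\<bar>?L e e' t - ?L P R t\<bar> =
          \<bar>(\<psi>' t * (e t - P t) + \<psi> t * (e' t - R t)) * v t + (\<psi> t * (e t - P t)) * a t\<bar>"
        by (simp add: algebra_simps)
      also have "\<dots> \<le> \<bar>\<psi>' t * (e t - P t) + \<psi> t * (e' t - R t)\<bar> * \<bar>v t\<bar> + \<bar>\<psi> t * (e t - P t)\<bar> * \<bar>a t\<bar>"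
        unfolding abs_mult[symmetric] by (rule abs_triangle_ineq)
      also have "\<dots> \<le> (\<bar>\<psi>' t\<bar> * \<epsilon> + \<bar>\<psi> t\<bar> * \<epsilon>) * \<bar>v t\<bar> + (\<bar>\<psi> t\<bar> * \<epsilon>) * \<bar>a t\<bar>"
        using 1 by (intro add_mono mult_right_mono) auto
      finally show "\<bar>?L e e' t - ?L P R t\<bar> \<le> \<epsilon> * ((\<bar>\<psi>' t\<bar> + \<bar>\<psi> t\<bar>) * \<bar>v t\<bar> + \<bar>\<psi> t\<bar> * \<bar>a t\<bar>)"
        by (simp add: algebra_simps)
    qed
    also have "\<dots> = \<epsilon> * K" unfolding K_def by (rule Bochner_Integration.integral_mult_right_zero)
    finally show ?thesis .
  qed
  have "\<bar>LINT t|leb01. ?L e e' t\<bar> \<le> 0"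
  proof (rule field_le_epsilon)
    fix \<delta> :: real assume "0 < \<delta>"
    \<comment> \<open>Dividing by K + 1 rather than K covers the case K = 0.\<close>
    then have "\<delta> / (K + 1) * K \<le> \<delta>" "0 < \<delta> / (K + 1)" using K by (simp_all add: field_simps)
    with small[of "\<delta> / (K + 1)"] show "\<bar>LINT t|leb01. ?L e e' t\<bar> \<le> 0 + \<delta>" by simp
  qed
  then show ?thesis by simp
qed

text \<open>A countable union of null sets makes the tests with all monomials valid at almost every
  x, where the one-variable product rule applies.\<close>

lemma weak_deriv_mult:
  assumes v: "weak_deriv v a"
    and e: "\<And>t x. t \<in> {0..1} \<Longrightarrow> x \<in> {0..1} \<Longrightarrow> ((\<lambda>t. e t x) has_real_derivative e' t x) (at t within {0..1})"
    and e': "\<And>x. x \<in> {0..1} \<Longrightarrow> continuous_on {0..1} (\<lambda>t. e' t x)"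
    and L: "L2_L2 (\<lambda>t x. e t x * v t x)" "L2_L2 (\<lambda>t x. e t x * a t x + e' t x * v t x)"
  shows "weak_deriv (\<lambda>t x. e t x * v t x) (\<lambda>t x. e t x * a t x + e' t x * v t x)"
  unfolding weak_deriv_def
proof (intro conjI allI impI L)
  fix \<psi> \<psi>' assume \<psi>: "C1c \<psi> \<psi>'"
  note C = C1c_D[OF \<psi>]
  have La: "L2_L2 v" "L2_L2 a" using v by (auto simp: weak_deriv_def)
  have "AE x in leb01. (LINT t|leb01. (\<psi>' t * t ^ k + \<psi> t * (real k * t ^ (k - 1))) * v t x) =
      - (LINT t|leb01. (\<psi> t * t ^ k) * a t x)" for k
    using v C1c_mult_power[OF \<psi>, of k] by (simp add: weak_deriv_def)
  then have "AE x in leb01. \<forall>k. (LINT t|leb01. (\<psi>' t * t ^ k + \<psi> t * (real k * t ^ (k - 1))) * v t x) =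
      - (LINT t|leb01. (\<psi> t * t ^ k) * a t x)"
    unfolding AE_all_countable ..
  then show "AE x in leb01. (LINT t|leb01. \<psi>' t * (e t x * v t x)) =
      - (LINT t|leb01. \<psi> t * (e t x * a t x + e' t x * v t x))"
    using L2_L2_section[OF La(1)] L2_L2_section[OF La(2)] L2_L2_section[OF L(1)] L2_L2_section[OF L(2)] AE_space
  proof eventually_elim
    case (elim x)
    then have x: "x \<in> {0..1}" by (simp add: space_leb01)
    have "(LINT t|leb01. (\<psi>' t * e t x + \<psi> t * e' t x) * v t x + (\<psi> t * e t x) * a t x) = 0"
      using elim by (intro product_rule_section[OF C(3,2)] e e' x) auto
    also have "(\<lambda>t. (\<psi>' t * e t x + \<psi> t * e' t x) * v t x + (\<psi> t * e t x) * a t x) =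
        (\<lambda>t. \<psi>' t * (e t x * v t x) + \<psi> t * (e t x * a t x + e' t x * v t x))"
      by (simp add: algebra_simps)
    finally show ?case
      using C1c_integrable[OF C(2) elim(4)] C1c_integrable[OF C(3) elim(5)] by simp
  qed
qed

section \<open>Reparametrisation by \<open>\<phi>\<close>\<close>

lemma set_integrable_leb01:
  fixes f :: "real \<Rightarrow> real"
  assumes "integrable leb01 f" "0 \<le> a" "b \<le> 1"
  shows "set_integrable lborel {a..b} f"
proof -
  have "set_integrable lborel {0..1} f"
    using assms(1) unfolding set_integrable_def by (subst (asm) integrable_restrict_space) auto
  then show ?thesis by (rule set_integrable_subset) (use assms in auto)
qed

lemma prim_eq_integral:
  "integrable leb01 f \<Longrightarrow> x \<le> 1 \<Longrightarrow> prim f x = integral {0..x} f"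
  unfolding prim_def by (rule set_borel_integral_eq_integral(2)[OF set_integrable_leb01]) auto

lemma prim_continuous:
  assumes "integrable leb01 f"
  shows "continuous_on {0..1} (prim f)"
proof -
  have "f integrable_on {0..1}"
    by (rule set_borel_integral_eq_integral(1)[OF set_integrable_leb01[OF assms]]) auto
  then have "continuous_on {0..1} (\<lambda>x. integral {0..x} f)" by (rule indefinite_integral_continuous_1)
  then show ?thesis
    by (rule continuous_on_eq) (simp add: prim_eq_integral[OF assms])
qed

lemma eta_pos: "0 < eta f x"
  by (simp add: eta_def)

lemma phi_prim: "phi f = prim (eta f)"
  by (simp add: phi_def prim_def fun_eq_iff)

lemma eta_continuous: "L2 f \<Longrightarrow> continuous_on {0..1} (eta f)"
  unfolding eta_prim[abs_def] by (intro continuous_on_exp prim_continuous L2_D)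

lemma eta_integrable: "L2 f \<Longrightarrow> integrable leb01 (eta f)"
  by (rule integral_leb01_continuous(1)[OF eta_continuous])

context
  fixes f :: "real \<Rightarrow> real"
  assumes f: "f \<in> Q"
begin

lemma Q_L2: "L2 f"
  using f by (simp add: Q_def)

lemma phi_has_derivative:
  "x \<in> {0..1} \<Longrightarrow> (phi f has_real_derivative eta f x) (at x within {0..1})"
proof -
  assume x: "x \<in> {0..1}"
  have "((\<lambda>x. integral {0..x} (eta f)) has_real_derivative eta f x) (at x within {0..1})"
    by (rule integral_has_real_derivative[OF eta_continuous[OF Q_L2] x])
  then show ?thesis
    by (rule has_field_derivative_transform_within[where d = 1])
      (use x in \<open>auto simp: phi_prim prim_eq_integral[OF eta_integrable[OF Q_L2]]\<close>)
qed

lemma phi_continuous: "continuous_on {0..1} (phi f)"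
  using phi_has_derivative by (rule DERIV_continuous_on)

lemma phi_0: "phi f 0 = 0" and phi_1: "phi f 1 = 1"
  using f by (simp_all add: phi_prim prim_eq_integral[OF eta_integrable[OF Q_L2]] Q_def
      integral_leb01_continuous(2)[OF eta_continuous[OF Q_L2]])

lemma phi_less:
  assumes "x \<in> {0..1}" "y \<in> {0..1}" "x < y"
  shows "phi f x < phi f y"
proof (rule DERIV_pos_imp_increasing_open[OF \<open>x < y\<close>])
  show "continuous_on {x..y} (phi f)"
    by (rule continuous_on_subset[OF phi_continuous]) (use assms in auto)
  fix z assume z: "x < z" "z < y"
  then have "at z within {0..1} = at z" using assms by (intro at_within_Icc_at) auto
  then have "(phi f has_real_derivative eta f z) (at z)"
    using phi_has_derivative[of z] z assms by simp
  then show "\<exists>l. (phi f has_real_derivative l) (at z) \<and> 0 < l" using eta_pos by blast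
qed

lemma phi_le_iff: "x \<in> {0..1} \<Longrightarrow> y \<in> {0..1} \<Longrightarrow> phi f x \<le> phi f y \<longleftrightarrow> x \<le> y"
  using phi_less[of x y] phi_less[of y x] by (cases x y rule: linorder_cases) auto

lemma phi_inj: "inj_on (phi f) {0..1}"
  by (rule inj_onI) (metis order.eq_iff phi_le_iff)

lemma phi_image: "phi f ` {0..1} = {0..1}"
proof (intro equalityI subsetI)
  fix y assume "y \<in> phi f ` {0..1}"
  then obtain x where "x \<in> {0..1}" "y = phi f x" by blast
  then show "y \<in> {0..1}" using phi_le_iff[of 0 x] phi_le_iff[of x 1] by (simp add: phi_0 phi_1)
next
  fix y :: real assume "y \<in> {0..1}"
  then obtain x where "0 \<le> x" "x \<le> 1" "phi f x = y"
    using IVT'[of "phi f" 0 y 1] phi_continuous by (auto simp: phi_0 phi_1)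
  then show "y \<in> phi f ` {0..1}" by auto
qed

lemma phi_bounds: "x \<in> {0..1} \<Longrightarrow> phi f x \<in> {0..1}"
  using phi_image by blast

lemma phi_inv:
  "x \<in> {0..1} \<Longrightarrow> the_inv_into {0..1} (phi f) (phi f x) = x"
  "y \<in> {0..1} \<Longrightarrow> phi f (the_inv_into {0..1} (phi f) y) = y"
  "y \<in> {0..1} \<Longrightarrow> the_inv_into {0..1} (phi f) y \<in> {0..1}"
  using the_inv_into_f_f[OF phi_inj] f_the_inv_into_f[OF phi_inj] the_inv_into_into[OF phi_inj _ order_refl]
  by (simp_all only: phi_image)

lemma phi_measurable: "phi f \<in> measurable leb01 borel_I"
proof (rule measurable_restrict_space2)
  show "phi f \<in> space leb01 \<rightarrow> {0..1}" using phi_bounds by (simp add: space_leb01)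
  show "phi f \<in> borel_measurable leb01"
    unfolding measurable_leb01 by (rule borel_measurable_continuous_on_restrict[OF phi_continuous])
qed

lemma eta_measurable: "eta f \<in> borel_measurable leb01"
  using eta_integrable[OF Q_L2] by auto

text \<open>The interval is half-open to match the preimage of a ray \<open>{..<c}\<close> under
  \<open>phi f\<close>; the missing endpoint has measure zero.\<close>

lemma prim_eta_nn_integral:
  assumes "x \<in> {0..1}"
  shows "(\<integral>\<^sup>+y. ennreal (eta f y) * indicator {0..<x} y \<partial>leb01) = ennreal (phi f x)"
proof -
  have nx: "AE y in leb01. y \<noteq> x"
    by (subst AE_restrict_space_iff) (auto intro: AE_mp[OF AE_lborel_singleton])
  have "(\<integral>\<^sup>+y. ennreal (eta f y) * indicator {0..<x} y \<partial>leb01) = (\<integral>\<^sup>+y. ennreal (indicator {0..x} y * eta f y) \<partial>leb01)"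
    using nx by (intro nn_integral_cong_AE, eventually_elim) (auto simp: indicator_def)
  also have "\<dots> = ennreal (LINT y|leb01. indicator {0..x} y * eta f y)"
    using integrable_indicator_leb01[OF eta_integrable[OF Q_L2]] eta_pos[THEN less_imp_le]
    by (intro nn_integral_eq_integral) auto
  also have "\<dots> = ennreal (phi f x)" using assms by (simp add: phi_prim prim_leb01)
  finally show ?thesis .
qed

text \<open>The change of variables by \<open>phi f\<close>, whose derivative is
  \<open>eta f\<close>. Comparing initial segments is enough: the preimage of [0,c) is [0,x) with
  \<open>phi f x = c\<close>, and its weighted length is again c.\<close>

lemma distr_phi: "distr (density leb01 (\<lambda>x. ennreal (eta f x))) borel_I (phi f) = distr leb01 borel_I (\<lambda>x. x)"
proof (rule measure_I_eqI)
  have meas: "phi f \<in> measurable (density leb01 (\<lambda>x. ennreal (eta f x))) borel_I"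
    using phi_measurable by simp
  have id: "(\<lambda>x. x) \<in> measurable leb01 borel_I" by (simp add: measurable_leb01)
  have [measurable]: "(\<lambda>x. ennreal (eta f x)) \<in> borel_measurable leb01"
    using eta_measurable by simp
  have em: "emeasure (distr (density leb01 (\<lambda>x. ennreal (eta f x))) borel_I (phi f)) ({0..1} \<inter> {..<c}) =
      emeasure leb01 ({0..1} \<inter> {..<c})" for c
  proof -
    have S: "{0..1} \<inter> {..<c} \<in> sets borel_I" by (simp add: sets_borel_I)
    then have P: "phi f -` ({0..1} \<inter> {..<c}) \<inter> {0..1} \<in> sets leb01"
      using measurable_sets[OF phi_measurable S] unfolding space_leb01 by simp
    have "emeasure (distr (density leb01 (\<lambda>x. ennreal (eta f x))) borel_I (phi f)) ({0..1} \<inter> {..<c}) =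
        (\<integral>\<^sup>+x. ennreal (eta f x) * indicator (phi f -` ({0..1} \<inter> {..<c}) \<inter> {0..1}) x \<partial>leb01)"
      using emeasure_distr[OF meas S] P by (simp add: space_leb01 emeasure_density)
    also have "\<dots> = emeasure leb01 ({0..1} \<inter> {..<c})"
    proof -
      consider "c \<le> 0" | "0 < c" "c \<le> 1" | "1 < c" by linarith
      then show ?thesis
      proof cases
        case 1
        then have "phi f -` ({0..1} \<inter> {..<c}) \<inter> {0..1} = {}" "{0..1} \<inter> {..<c} = {}" by auto
        then show ?thesis by simp
      next
        case 2
        then obtain x where x: "x \<in> {0..1}" "phi f x = c" using phi_image by (metis atLeastAtMost_iff imageE less_imp_le)
        have "phi f -` ({0..1} \<inter> {..<c}) \<inter> {0..1} = {0..<x}"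
        proof (intro equalityI subsetI)
          fix y assume y: "y \<in> phi f -` ({0..1} \<inter> {..<c}) \<inter> {0..1}"
          then have "\<not> phi f x \<le> phi f y" using x by auto
          with y x show "y \<in> {0..<x}" using phi_le_iff[of x y] by auto
        next
          fix y assume y: "y \<in> {0..<x}"
          then have "y \<in> {0..1}" using x by auto
          then show "y \<in> phi f -` ({0..1} \<inter> {..<c}) \<inter> {0..1}"
            using phi_less[of y x] phi_bounds[of y] x y by auto
        qed
        moreover have "{0..1} \<inter> {..<c} = {0..<c}" "{0..<c} \<subseteq> {0..1}" using 2 by auto
        ultimately show ?thesis
          using prim_eta_nn_integral[OF x(1)] x 2 emeasure_leb01[of "{0..<c}"] by simp
      next
        case 3
        have "phi f -` ({0..1} \<inter> {..<c}) \<inter> {0..1} = {0..1}" "{0..1} \<inter> {..<c} = {0..1}"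
          using phi_bounds 3 by force+
        moreover have "(\<integral>\<^sup>+x. ennreal (eta f x) * indicator {0..1} x \<partial>leb01) = ennreal 1"
        proof -
          have "(\<integral>\<^sup>+x. ennreal (eta f x) * indicator {0..1} x \<partial>leb01) = (\<integral>\<^sup>+x. ennreal (eta f x) \<partial>leb01)"
            by (intro nn_integral_cong) (simp add: space_leb01)
          also have "\<dots> = ennreal (LINT x|leb01. eta f x)"
            using eta_integrable[OF Q_L2] eta_pos[THEN less_imp_le] by (intro nn_integral_eq_integral) auto
          finally show ?thesis using f by (simp add: Q_def)
        qed
        ultimately show ?thesis by (simp add: leb01_total)
      qed
    qed
    finally show ?thesis .
  qed
  have em': "emeasure (distr leb01 borel_I (\<lambda>x. x)) A = emeasure leb01 A" if "A \<in> sets borel_I" for A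
    using that by (subst emeasure_distr[OF id]) (auto simp: sets_borel_I space_leb01 Int_absorb2)
  show "emeasure (distr (density leb01 (\<lambda>x. ennreal (eta f x))) borel_I (phi f)) ({0..1} \<inter> {..<c}) =
      emeasure (distr leb01 borel_I (\<lambda>x. x)) ({0..1} \<inter> {..<c})" for c
    unfolding em by (rule em'[symmetric]) (simp add: sets_borel_I)
  show "finite_measure (distr leb01 borel_I (\<lambda>x. x))"
    by (rule leb01.finite_measure_distr[OF id])
  have full: "{0..1} \<inter> {..<2} = {0..1::real}" by auto
  show "finite_measure (distr (density leb01 (\<lambda>x. ennreal (eta f x))) borel_I (phi f))"
    using em[of 2] unfolding full by (intro finite_measureI) (simp add: space_borel_I leb01_total)
qed simp_all

lemma phi_inv_measurable: "the_inv_into {0..1} (phi f) \<in> measurable leb01 leb01"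
proof -
  have "continuous_on {0..1} (the_inv_into {0..1} (phi f))"
    using continuous_on_inv_into[OF phi_continuous compact_Icc phi_inj] by (simp only: phi_image)
  then have "the_inv_into {0..1} (phi f) \<in> borel_measurable leb01"
    unfolding measurable_leb01 by (rule borel_measurable_continuous_on_restrict)
  then have "the_inv_into {0..1} (phi f) \<in> measurable leb01 borel_I"
    using phi_inv(3) by (intro measurable_restrict_space2) (auto simp: space_leb01)
  then show ?thesis by (simp cong: measurable_cong_sets add: sets_leb01)
qed

lemma nn_integral_phi_inv:
  assumes g: "g \<in> borel_measurable leb01"
  shows "(\<integral>\<^sup>+y. g (the_inv_into {0..1} (phi f) y) \<partial>leb01) = (\<integral>\<^sup>+x. ennreal (eta f x) * g x \<partial>leb01)"
proof -
  let ?h = "\<lambda>y. g (the_inv_into {0..1} (phi f) y)"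
  have h: "?h \<in> borel_measurable borel_I"
    using measurable_compose[OF phi_inv_measurable g] unfolding measurable_leb01 .
  have [measurable]: "(\<lambda>x. ennreal (eta f x)) \<in> borel_measurable leb01" "phi f \<in> measurable leb01 borel_I"
    using eta_measurable phi_measurable by simp_all
  have "(\<integral>\<^sup>+y. ?h y \<partial>leb01) = (\<integral>\<^sup>+y. ?h y \<partial>distr leb01 borel_I (\<lambda>x. x))"
    using h by (subst nn_integral_distr) (simp_all add: measurable_leb01)
  also have "\<dots> = (\<integral>\<^sup>+x. ?h (phi f x) \<partial>density leb01 (\<lambda>x. ennreal (eta f x)))"
    unfolding distr_phi[symmetric] using h by (subst nn_integral_distr) simp_all
  also have "\<dots> = (\<integral>\<^sup>+x. ennreal (eta f x) * ?h (phi f x) \<partial>leb01)"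
    using h by (subst nn_integral_density) (auto intro: measurable_compose[OF phi_measurable])
  also have "\<dots> = (\<integral>\<^sup>+x. ennreal (eta f x) * g x \<partial>leb01)"
    by (intro nn_integral_cong) (simp add: space_leb01 phi_inv(1))
  finally show ?thesis .
qed

text \<open>The substitution by \<open>phi f\<close> identifies the integral of the absolute value
  of the composed function with that of \<open>eta f * u\<close>. Primitives are bounded by this
  integral, so a bound on the velocity suffices.\<close>

lemma b_coeff_bound:
  assumes u: "integrable leb01 (\<lambda>x. eta f x * u x)" and um: "u \<in> borel_measurable leb01"
    and B: "(LINT x|leb01. \<bar>eta f x * u x\<bar>) \<le> B"
  shows "\<bar>b_coeff u f\<bar> \<le> 3/2 * B\<^sup>2"
proof -
  let ?w = "\<lambda>y. u (the_inv_into {0..1} (phi f) y)"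
  have wm: "?w \<in> borel_measurable leb01"
    by (rule measurable_compose[OF phi_inv_measurable um])
  have abs_eq: "(\<integral>\<^sup>+y. ennreal (norm (?w y)) \<partial>leb01) = ennreal (LINT x|leb01. \<bar>eta f x * u x\<bar>)"
  proof -
    have "(\<integral>\<^sup>+y. ennreal (norm (?w y)) \<partial>leb01) = (\<integral>\<^sup>+x. ennreal (eta f x) * ennreal (norm (u x)) \<partial>leb01)"
      by (rule nn_integral_phi_inv) (use um in measurable)
    also have "\<dots> = (\<integral>\<^sup>+x. ennreal \<bar>eta f x * u x\<bar> \<partial>leb01)"
      using eta_pos[THEN less_imp_le] by (simp add: ennreal_mult abs_mult abs_of_nonneg)
    also have "\<dots> = ennreal (LINT x|leb01. \<bar>eta f x * u x\<bar>)"
      using u by (intro nn_integral_eq_integral integrable_abs) auto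
    finally show ?thesis .
  qed
  have wi: "integrable leb01 ?w"
    using wm abs_eq by (intro integrableI_bounded) auto
  have "(LINT y|leb01. \<bar>?w y\<bar>) = (LINT x|leb01. \<bar>eta f x * u x\<bar>)"
    using abs_eq nn_integral_eq_integral[OF integrable_abs[OF wi]] by simp
  then have P: "\<bar>prim ?w x\<bar> \<le> B" if "x \<in> {0..1}" for x
    using prim_abs_le[OF wi, of x] B that by simp
  then have "0 \<le> B" using abs_ge_zero order_trans by (metis atLeastAtMost_iff order_refl zero_le_one)
  have sq: "(prim ?w x)\<^sup>2 \<le> B\<^sup>2" if "x \<in> {0..1}" for x
    using P[OF that] by (rule abs_le_square_iff[THEN iffD1, of _ B, OF order_trans]) (use \<open>0 \<le> B\<close> in simp)
  have pc: "continuous_on {0..1} (\<lambda>x. (prim ?w x)\<^sup>2)"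
    by (intro continuous_on_power prim_continuous wi)
  have I0: "0 \<le> (LINT x|leb01. (prim ?w x)\<^sup>2)" by (rule Bochner_Integration.integral_nonneg) simp
  have "(LINT x|leb01. (prim ?w x)\<^sup>2) \<le> (LINT x|leb01. B\<^sup>2)"
    by (rule integral_mono) (use sq integral_leb01_continuous(1)[OF pc] in \<open>auto simp: space_leb01\<close>)
  also have "(LINT x|leb01. B\<^sup>2) = B\<^sup>2" by (simp add: space_leb01 leb01_total)
  finally have "(LINT x|leb01. (prim ?w x)\<^sup>2) \<le> B\<^sup>2" .
  moreover have "b_coeff u f = 3/2 * (LINT x|leb01. (prim ?w x)\<^sup>2)"
    by (simp add: b_coeff_def prim_def)
  ultimately show ?thesis using I0 by (metis abs_of_nonneg mult_left_mono mult_nonneg_nonneg zero_le_divide_iff zero_le_numeral)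
qed

end

section \<open>Regularity along the path\<close>

definition meas2 :: "(real \<Rightarrow> real \<Rightarrow> real) \<Rightarrow> bool" where
  "meas2 u \<longleftrightarrow> (\<lambda>z. u (fst z) (snd z)) \<in> borel_measurable leb2"

definition bdd2 :: "(real \<Rightarrow> real \<Rightarrow> real) \<Rightarrow> bool" where
  "bdd2 u \<longleftrightarrow> (\<exists>B. \<forall>t\<in>{0..1}. \<forall>x\<in>{0..1}. \<bar>u t x\<bar> \<le> B)"

lemma meas2_case_prod: "meas2 u \<longleftrightarrow> case_prod u \<in> borel_measurable leb2"
  by (simp add: meas2_def case_prod_beta')

lemma meas2_const [simp]: "meas2 (\<lambda>t x. c)"
  by (simp add: meas2_def)

lemma meas2_time: "c \<in> borel_measurable leb01 \<Longrightarrow> meas2 (\<lambda>t x. c t)"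
  unfolding meas2_def by (rule measurable_compose[OF measurable_fst])

lemma meas2_add: "meas2 u \<Longrightarrow> meas2 v \<Longrightarrow> meas2 (\<lambda>t x. u t x + v t x)"
  unfolding meas2_def by (rule borel_measurable_add)

lemma meas2_diff: "meas2 u \<Longrightarrow> meas2 v \<Longrightarrow> meas2 (\<lambda>t x. u t x - v t x)"
  unfolding meas2_def by (rule borel_measurable_diff)

lemma meas2_mult: "meas2 u \<Longrightarrow> meas2 v \<Longrightarrow> meas2 (\<lambda>t x. u t x * v t x)"
  unfolding meas2_def by (rule borel_measurable_times)

lemma meas2_power2: "meas2 u \<Longrightarrow> meas2 (\<lambda>t x. (u t x)\<^sup>2)"
  unfolding power2_eq_square by (intro meas2_mult)

lemma meas2_exp: "meas2 u \<Longrightarrow> meas2 (\<lambda>t x. exp (u t x))"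
  unfolding meas2_def by (rule measurable_compose[OF _ borel_measurable_exp])

lemma meas2_cong: "meas2 u \<Longrightarrow> (\<And>t x. t \<in> {0..1} \<Longrightarrow> x \<in> {0..1} \<Longrightarrow> u t x = v t x) \<Longrightarrow> meas2 v"
  unfolding meas2_def
  by (subst measurable_cong[of "leb2" _ "\<lambda>z. u (fst z) (snd z)"]) (auto simp: space_leb2)

lemma meas2_prim: "meas2 u \<Longrightarrow> meas2 (\<lambda>t. prim (u t))"
  using prim_jointly_measurable[of u] unfolding meas2_case_prod by simp

lemma meas2_section: "meas2 u \<Longrightarrow> t \<in> {0..1} \<Longrightarrow> u t \<in> borel_measurable leb01"
  unfolding meas2_def using measurable_Pair2[of "\<lambda>z. u (fst z) (snd z)" leb01 leb01 borel t] by (simp add: space_leb01)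

lemma meas2_section': "meas2 u \<Longrightarrow> x \<in> {0..1} \<Longrightarrow> (\<lambda>t. u t x) \<in> borel_measurable leb01"
  unfolding meas2_def using measurable_Pair1[of "\<lambda>z. u (fst z) (snd z)" leb01 leb01 borel x] by (simp add: space_leb01)

lemma meas2_integral: "meas2 u \<Longrightarrow> (\<lambda>t. LINT x|leb01. u t x) \<in> borel_measurable leb01"
  by (rule leb01.borel_measurable_lebesgue_integral) (simp add: meas2_case_prod)

lemma meas2_nn_integral:
  assumes "meas2 u" shows "(\<lambda>t. \<integral>\<^sup>+x. ennreal (u t x) \<partial>leb01) \<in> borel_measurable leb01"
  by (rule leb01.borel_measurable_nn_integral) (use assms in \<open>simp add: meas2_def case_prod_beta'\<close>)

lemma L2_L2_meas2: "L2_L2 u \<Longrightarrow> meas2 u"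
  by (simp add: L2_L2_def meas2_case_prod)

lemma bdd2_const [simp]: "bdd2 (\<lambda>t x. c)"
  by (auto simp: bdd2_def)

lemma bdd2_add:
  assumes "bdd2 u" "bdd2 v" shows "bdd2 (\<lambda>t x. u t x + v t x)"
proof -
  obtain A B where "\<forall>t\<in>{0..1}. \<forall>x\<in>{0..1}. \<bar>u t x\<bar> \<le> A" "\<forall>t\<in>{0..1}. \<forall>x\<in>{0..1}. \<bar>v t x\<bar> \<le> B"
    using assms unfolding bdd2_def by blast
  then have "\<forall>t\<in>{0..1}. \<forall>x\<in>{0..1}. \<bar>u t x + v t x\<bar> \<le> A + B"
    by (meson abs_triangle_ineq add_mono order_trans)
  then show ?thesis unfolding bdd2_def by blast
qed

lemma bdd2_mult:
  assumes "bdd2 u" "bdd2 v" shows "bdd2 (\<lambda>t x. u t x * v t x)"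
proof -
  obtain A B where "\<forall>t\<in>{0..1}. \<forall>x\<in>{0..1}. \<bar>u t x\<bar> \<le> A" "\<forall>t\<in>{0..1}. \<forall>x\<in>{0..1}. \<bar>v t x\<bar> \<le> B"
    using assms unfolding bdd2_def by blast
  then have "\<forall>t\<in>{0..1}. \<forall>x\<in>{0..1}. \<bar>u t x * v t x\<bar> \<le> A * B"
    unfolding abs_mult by (meson abs_ge_zero mult_mono order_trans)
  then show ?thesis unfolding bdd2_def by blast
qed

lemma bdd2_minus: "bdd2 u \<Longrightarrow> bdd2 (\<lambda>t x. - u t x)"
  by (simp add: bdd2_def)

lemma bdd2_diff: "bdd2 u \<Longrightarrow> bdd2 v \<Longrightarrow> bdd2 (\<lambda>t x. u t x - v t x)"
  using bdd2_add[OF _ bdd2_minus] by fastforce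

lemma bdd2_integrable:
  assumes u: "meas2 u" "bdd2 u" and t: "t \<in> {0..1}"
  shows "integrable leb01 (u t)"
proof -
  obtain B where "\<forall>t\<in>{0..1}. \<forall>x\<in>{0..1}. \<bar>u t x\<bar> \<le> B" using u unfolding bdd2_def by blast
  with t meas2_section[OF u(1) t] show ?thesis
    by (intro leb01.integrable_const_bound[of _ B]) (auto simp: space_leb01)
qed

lemma bdd2_integral:
  assumes u: "meas2 u" "bdd2 u"
  shows "bdd2 (\<lambda>t x. LINT y|leb01. u t y)"
proof -
  obtain B where B: "\<forall>t\<in>{0..1}. \<forall>x\<in>{0..1}. \<bar>u t x\<bar> \<le> B" using u unfolding bdd2_def by blast
  have "\<bar>LINT y|leb01. u t y\<bar> \<le> B" if t: "t \<in> {0..1}" for t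
  proof -
    have "\<bar>LINT y|leb01. u t y\<bar> \<le> (LINT y|leb01. \<bar>u t y\<bar>)" by (rule integral_abs_bound)
    also have "\<dots> \<le> (LINT y|leb01. B)"
      using B t bdd2_integrable[OF u t] by (intro integral_mono) (auto simp: space_leb01)
    also have "\<dots> = B" by (simp add: space_leb01 leb01_total)
    finally show ?thesis .
  qed
  then show ?thesis unfolding bdd2_def by blast
qed

lemma L2_L2_bdd2:
  assumes u: "meas2 u" "bdd2 u"
  shows "L2_L2 u"
proof -
  obtain B where B: "\<forall>t\<in>{0..1}. \<forall>x\<in>{0..1}. \<bar>(u t x)\<^sup>2\<bar> \<le> B"
    using bdd2_mult[OF u(2) u(2)] unfolding bdd2_def power2_eq_square by blast
  have "(\<lambda>z. (case_prod u z)\<^sup>2) \<in> borel_measurable leb2"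
    using u by (intro borel_measurable_power) (simp add: meas2_case_prod)
  then have "integrable leb2 (\<lambda>z. (case_prod u z)\<^sup>2)"
    using B by (intro leb2.integrable_const_bound[of _ B]) (auto simp: space_leb2)
  with u show ?thesis by (simp add: L2_L2_def meas2_case_prod)
qed

lemma L2_L2_mult_bdd2:
  assumes g: "meas2 g" "bdd2 g" and u: "L2_L2 u"
  shows "L2_L2 (\<lambda>t x. g t x * u t x)"
proof -
  obtain B where B: "\<forall>t\<in>{0..1}. \<forall>x\<in>{0..1}. \<bar>(g t x)\<^sup>2\<bar> \<le> B"
    using bdd2_mult[OF g(2) g(2)] unfolding bdd2_def power2_eq_square by blast
  have meas2: "meas2 (\<lambda>t x. g t x * u t x)" by (intro meas2_mult g L2_L2_meas2[OF u])
  have "integrable leb2 (\<lambda>z. (case_prod (\<lambda>t x. g t x * u t x) z)\<^sup>2)"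
  proof (rule Bochner_Integration.integrable_bound)
    show "integrable leb2 (\<lambda>z. B * (case_prod u z)\<^sup>2)"
      using L2_L2_D(3)[OF u] by (rule integrable_mult_right)
    show "(\<lambda>z. (case_prod (\<lambda>t x. g t x * u t x) z)\<^sup>2) \<in> borel_measurable leb2"
      using meas2 by (intro borel_measurable_power) (simp add: meas2_case_prod)
    show "AE z in leb2. norm ((case_prod (\<lambda>t x. g t x * u t x) z)\<^sup>2) \<le> norm (B * (case_prod u z)\<^sup>2)"
    proof (rule AE_I2)
      fix z assume "z \<in> space leb2"
      then obtain t x where z: "z = (t, x)" "t \<in> {0..1}" "x \<in> {0..1}" by (auto simp: space_leb2)
      then have "(g t x)\<^sup>2 \<le> B" using B by auto
      then have "(g t x)\<^sup>2 * (u t x)\<^sup>2 \<le> \<bar>B\<bar> * (u t x)\<^sup>2" by (intro mult_right_mono) auto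
      then show "norm ((case_prod (\<lambda>t x. g t x * u t x) z)\<^sup>2) \<le> norm (B * (case_prod u z)\<^sup>2)"
        by (simp add: z power_mult_distrib abs_mult)
    qed
  qed
  with meas2 show ?thesis by (simp add: L2_L2_def meas2_case_prod)
qed

lemma L2_L2_add:
  assumes u: "L2_L2 u" and v: "L2_L2 v"
  shows "L2_L2 (\<lambda>t x. u t x + v t x)"
proof -
  have meas2: "meas2 (\<lambda>t x. u t x + v t x)" by (intro meas2_add L2_L2_meas2 u v)
  have "integrable leb2 (\<lambda>z. (case_prod (\<lambda>t x. u t x + v t x) z)\<^sup>2)"
  proof (rule Bochner_Integration.integrable_bound)
    show "integrable leb2 (\<lambda>z. 2 * (case_prod u z)\<^sup>2 + 2 * (case_prod v z)\<^sup>2)"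
      using L2_L2_D(3)[OF u] L2_L2_D(3)[OF v] by (intro Bochner_Integration.integrable_add integrable_mult_right)
    show "(\<lambda>z. (case_prod (\<lambda>t x. u t x + v t x) z)\<^sup>2) \<in> borel_measurable leb2"
      using meas2 by (intro borel_measurable_power) (simp add: meas2_case_prod)
    have le: "(a + b)\<^sup>2 \<le> 2 * a\<^sup>2 + 2 * b\<^sup>2" for a b :: real
      using sum_squares_ge_zero[of "a - b" 0] by (simp add: power2_eq_square algebra_simps)
    show "AE z in leb2. norm ((case_prod (\<lambda>t x. u t x + v t x) z)\<^sup>2)
        \<le> norm (2 * (case_prod u z)\<^sup>2 + 2 * (case_prod v z)\<^sup>2)"
      unfolding real_norm_def case_prod_beta' by (rule AE_I2) (rule abs_mono_nonneg[OF zero_le_power2 le])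
  qed
  with meas2 show ?thesis by (simp add: L2_L2_def meas2_case_prod)
qed

text \<open>Only the affine dependence on \<open>phi\<close> and the linearity in the two
  coefficients are used later, so the entries of the inverse matrix remain symbolic.\<close>

lemma H2inv_comb_eq:
  "H2inv_comb f (vector [a, b]) x = (matrix_inv H2 $ 1 $ 1 * a + matrix_inv H2 $ 1 $ 2 * b) +
    phi f x * (matrix_inv H2 $ 2 $ 1 * a + matrix_inv H2 $ 2 $ 2 * b)"
  by (simp add: H2inv_comb_def inner_vec_def matrix_vector_mult_def UNIV_2)

lemma upper_integral_eq_prim:
  assumes "integrable leb01 f" "x \<in> {0..1}"
  shows "(LINT y:{x..1}|lborel. f y) = prim f 1 - prim f x"
proof -
  have I: "set_integrable lborel {a..b} f" if "0 \<le> a" "b \<le> 1" for a b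
    by (rule set_integrable_leb01[OF assms(1) that])
  have "integral {0..x} f + integral {x..1} f = integral {0..1} f"
    using assms(2) set_borel_integral_eq_integral(1)[OF I[of 0 1]]
    by (intro Henstock_Kurzweil_Integration.integral_combine) auto
  then show ?thesis
    using assms I by (simp add: prim_eq_integral set_borel_integral_eq_integral(2))
qed

section \<open>The path and its covariant acceleration\<close>

locale cotangent_path =
  fixes q0 p0 :: "real \<Rightarrow> real" and p q :: "real \<Rightarrow> real \<Rightarrow> real"
  assumes path: "(p, q) \<in> C0_paths q0 p0"
begin

text \<open>\<open>C0_paths\<close> asserts continuity in time for this curve, not for
  \<open>p\<close>; estimates for \<open>p\<close> are obtained from it after division by
  \<open>eta\<close>.\<close>

definition vel :: "real \<Rightarrow> real \<Rightarrow> real" where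
  "vel t x = eta (q t) x * p t x"

lemma vel_eq: "(\<lambda>t x. eta (q t) x * p t x) = vel"
  by (simp add: vel_def fun_eq_iff)

lemma q_Q: "t \<in> {0..1} \<Longrightarrow> q t \<in> Q"
  using path by (auto simp: C0_paths_def TstarQ_def)

lemma q_cont: "C0_L2 q" and vel_cont: "C0_L2 vel" and q_deriv: "weak_deriv q vel"
  using path by (auto simp: C0_paths_def vel_eq H2_L2_def)

lemma q_L2_L2: "L2_L2 q" and vel_L2_L2: "L2_L2 vel"
  using q_deriv by (auto simp: weak_deriv_def)

text \<open>The second derivative in \<open>H2_L2\<close> belongs to some weak derivative of
  \<open>q\<close>; by uniqueness that one agrees almost everywhere with \<open>vel\<close>.\<close>

lemma vel_deriv: "\<exists>a. weak_deriv vel a"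
proof -
  obtain v a where va: "weak_deriv q v" "weak_deriv v a"
    using path by (auto simp: C0_paths_def H2_L2_def)
  have "weak_deriv vel a"
    by (rule weak_deriv_cong[OF va(2) weak_deriv_unique[OF va(1) q_deriv] vel_L2_L2])
  then show ?thesis by blast
qed

lemma C0_L2_prim_bdd2:
  assumes "C0_L2 u" shows "bdd2 (\<lambda>t. prim (u t))"
proof -
  obtain B where B: "\<And>t. t \<in> {0..1} \<Longrightarrow> (LINT x|leb01. (u t x)\<^sup>2) \<le> B"
    using C0_L2_bounded[OF assms] by blast
  have "\<bar>prim (u t) x\<bar> \<le> 1 / 2 + B / 2" if "t \<in> {0..1}" "x \<in> {0..1}" for t x
  proof -
    have L: "L2 (u t)" using assms that by (simp add: C0_L2_def)
    from prim_abs_le[OF L2_D(3)[OF L], of x] L2_integral_abs_le[OF L zero_less_one] B[OF that(1)] that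
    show ?thesis by simp
  qed
  then show ?thesis unfolding bdd2_def by blast
qed

lemma eta_exp: "eta (q t) x = exp (prim (q t) x)"
  by (rule eta_prim)

lemma exp_bdd2:
  assumes "bdd2 u" shows "bdd2 (\<lambda>t x. exp (u t x))"
proof -
  obtain B where "\<forall>t\<in>{0..1}. \<forall>x\<in>{0..1}. \<bar>u t x\<bar> \<le> B" using assms unfolding bdd2_def by blast
  then have "\<forall>t\<in>{0..1}. \<forall>x\<in>{0..1}. \<bar>exp (u t x)\<bar> \<le> exp B" by (auto simp: abs_le_iff)
  then show ?thesis unfolding bdd2_def by blast
qed

lemma prim_q_meas2: "meas2 (\<lambda>t. prim (q t))"
  by (intro meas2_prim L2_L2_meas2 q_L2_L2)

lemma eta_meas2: "meas2 (\<lambda>t. eta (q t))" and eta_bdd2: "bdd2 (\<lambda>t. eta (q t))"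
  unfolding eta_prim[abs_def] by (intro meas2_exp prim_q_meas2 exp_bdd2 C0_L2_prim_bdd2 q_cont)+

text \<open>The reciprocal of \<open>eta\<close> along the path. In exponential form its bounds,
  measurability and time derivative come from those of the primitive of \<open>q\<close>.\<close>

definition inveta :: "real \<Rightarrow> real \<Rightarrow> real" where
  "inveta t x = exp (- prim (q t) x)"

lemma inveta_meas2: "meas2 inveta" and inveta_bdd2: "bdd2 inveta"
proof -
  have "meas2 (\<lambda>t x. 0 - prim (q t) x)" by (intro meas2_diff meas2_const prim_q_meas2)
  then have "meas2 (\<lambda>t x. exp (0 - prim (q t) x))" by (rule meas2_exp)
  then show "meas2 inveta" by (simp add: inveta_def[abs_def])
  show "bdd2 inveta" unfolding inveta_def[abs_def] by (intro exp_bdd2 bdd2_minus C0_L2_prim_bdd2 q_cont)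
qed

lemma inveta_vel: "inveta t x * vel t x = p t x"
  by (simp add: inveta_def vel_def eta_exp exp_minus)

lemma inveta_vel_fun: "(\<lambda>t x. inveta t x * vel t x) = p"
  by (simp add: inveta_vel fun_eq_iff)

lemma p_L2_L2: "L2_L2 p"
  using L2_L2_mult_bdd2[OF inveta_meas2 inveta_bdd2 vel_L2_L2] by (simp add: inveta_vel_fun)

lemma p_meas2: "meas2 p"
  by (rule L2_L2_meas2[OF p_L2_L2])

lemma prim_vel_meas2: "meas2 (\<lambda>t. prim (vel t))"
  by (intro meas2_prim L2_L2_meas2 vel_L2_L2)

lemma p_deriv: "weak_deriv p (time_deriv p)"
proof -
  obtain a where a: "weak_deriv vel a" using vel_deriv by blast
  have aL: "L2_L2 a" using a by (simp add: weak_deriv_def)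
  let ?e' = "\<lambda>t x. - prim (vel t) x * inveta t x"
  have e'meas2: "meas2 ?e'"
  proof -
    have "meas2 (\<lambda>t x. (0 - prim (vel t) x) * inveta t x)" by (intro meas2_mult meas2_diff meas2_const prim_vel_meas2 inveta_meas2)
    then show ?thesis by simp
  qed
  have e'bdd2: "bdd2 ?e'" by (intro bdd2_mult bdd2_minus C0_L2_prim_bdd2 vel_cont inveta_bdd2)
  have d: "((\<lambda>t. inveta t x) has_real_derivative ?e' t x) (at t within {0..1})"
    if "t \<in> {0..1}" "x \<in> {0..1}" for t x
  proof -
    have "((\<lambda>t. - prim (q t) x) has_real_derivative - prim (vel t) x) (at t within {0..1})"
      by (rule DERIV_minus[OF prim_has_time_derivative[OF q_cont vel_cont q_deriv that(2,1)]])
    from DERIV_chain2[OF DERIV_exp this] show ?thesis unfolding inveta_def by (simp add: mult.commute)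
  qed
  have "weak_deriv (\<lambda>t x. inveta t x * vel t x) (\<lambda>t x. inveta t x * a t x + ?e' t x * vel t x)"
  proof (rule weak_deriv_mult[OF a])
    fix x :: real assume x: "x \<in> {0..1}"
    have "continuous_on {0..1} (\<lambda>t. inveta t x)" using d[OF _ x] by (rule DERIV_continuous_on)
    moreover have "continuous_on {0..1} (\<lambda>t. prim (vel t) x)"
      using x by (intro prim_continuous_in_time vel_cont) auto
    ultimately show "continuous_on {0..1} (\<lambda>t. ?e' t x)"
      by (intro continuous_on_mult continuous_on_minus)
  next
    show "L2_L2 (\<lambda>t x. inveta t x * vel t x)" using p_L2_L2 by (simp add: inveta_vel_fun)
    show "L2_L2 (\<lambda>t x. inveta t x * a t x + ?e' t x * vel t x)"
      by (intro L2_L2_add L2_L2_mult_bdd2 inveta_meas2 inveta_bdd2 aL e'meas2 e'bdd2 vel_L2_L2)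
  qed (rule d)
  \<comment> \<open>Existence of one weak derivative is what gives the choice in
    \<open>time_deriv\<close> its meaning.\<close>
  then show ?thesis
    unfolding inveta_vel_fun time_deriv_def by (rule someI[of "weak_deriv p"])
qed

lemma phi_meas2: "meas2 (\<lambda>t. phi (q t))"
  unfolding phi_prim[abs_def] by (intro meas2_prim eta_meas2)

lemma phi_bdd2: "bdd2 (\<lambda>t. phi (q t))"
  unfolding bdd2_def using phi_bounds[OF q_Q] by (intro exI[of _ 1]) auto

lemma eta_inner_measurable:
  "meas2 u \<Longrightarrow> meas2 h \<Longrightarrow> (\<lambda>t. eta_inner (q t) (u t) (h t)) \<in> borel_measurable leb01"
  unfolding eta_inner_def by (intro meas2_integral meas2_mult eta_meas2)

lemma H2inv_comb_meas2:
  assumes "\<alpha> \<in> borel_measurable leb01" "\<beta> \<in> borel_measurable leb01"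
  shows "meas2 (\<lambda>t. H2inv_comb (q t) (vector [\<alpha> t, \<beta> t]))"
  unfolding H2inv_comb_eq[abs_def]
  by (intro meas2_add meas2_mult phi_meas2 meas2_const meas2_time assms)

lemma H2inv_comb_bdd2:
  assumes "bdd2 (\<lambda>t x. \<alpha> t)" "bdd2 (\<lambda>t x. \<beta> t)"
  shows "bdd2 (\<lambda>t. H2inv_comb (q t) (vector [\<alpha> t, \<beta> t]))"
  unfolding H2inv_comb_eq[abs_def]
  by (intro bdd2_add bdd2_mult phi_bdd2 bdd2_const assms)

lemma pi_star_meas2: "meas2 u \<Longrightarrow> meas2 (\<lambda>t. pi_star (q t) (u t))"
  unfolding pi_star_def[abs_def]
  by (intro meas2_diff H2inv_comb_meas2 eta_inner_measurable meas2_const phi_meas2)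

lemma pi_star_bdd2:
  assumes "meas2 u" "bdd2 u" shows "bdd2 (\<lambda>t. pi_star (q t) (u t))"
  unfolding pi_star_def[abs_def] eta_inner_def
  by (intro bdd2_diff H2inv_comb_bdd2 bdd2_integral meas2_mult bdd2_mult eta_meas2 eta_bdd2 meas2_const bdd2_const phi_meas2 phi_bdd2 assms)

definition V :: "real \<Rightarrow> real \<Rightarrow> real" where
  "V t = U_fun (\<lambda>y. (p t y)\<^sup>2) (q t)"

text \<open>The integrand \<open>eta * p^2\<close> equals \<open>p * vel\<close>, which is
  \<open>inveta * vel^2\<close>: a bounded factor times an integrable function. Hence
  \<open>V\<close> is a difference of primitives, for which measurability and bounds are at
  hand.\<close>

lemma V_eq:
  assumes t: "t \<in> {0..1}" and x: "x \<in> {0..1}"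
  shows "V t x = 1/2 * (prim (\<lambda>y. p t y * vel t y) 1 - prim (\<lambda>y. p t y * vel t y) x)"
    and "\<bar>V t x\<bar> \<le> (LINT y|leb01. \<bar>p t y * vel t y\<bar>)"
    and "integrable leb01 (\<lambda>y. p t y * vel t y)"
proof -
  have L: "L2 (vel t)" using vel_cont t by (simp add: C0_L2_def)
  obtain B where B: "\<forall>t\<in>{0..1}. \<forall>x\<in>{0..1}. \<bar>inveta t x\<bar> \<le> B" using inveta_bdd2 unfolding bdd2_def by blast
  have pv: "p t y * vel t y = inveta t y * (vel t y)\<^sup>2" for y
    using inveta_vel[of t y] by (simp add: power2_eq_square mult.assoc)
  show I: "integrable leb01 (\<lambda>y. p t y * vel t y)"
    unfolding pv
  proof (rule Bochner_Integration.integrable_bound)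
    show "integrable leb01 (\<lambda>y. B * (vel t y)\<^sup>2)" by (intro integrable_mult_right L2_D[OF L])
    show "(\<lambda>y. inveta t y * (vel t y)\<^sup>2) \<in> borel_measurable leb01"
      by (intro borel_measurable_times borel_measurable_power meas2_section[OF inveta_meas2 t] L2_D[OF L])
    show "AE y in leb01. norm (inveta t y * (vel t y)\<^sup>2) \<le> norm (B * (vel t y)\<^sup>2)"
    proof (rule AE_I2)
      fix y assume "y \<in> space leb01"
      then have "\<bar>inveta t y\<bar> \<le> B" using B t by (simp add: space_leb01)
      then have "\<bar>inveta t y\<bar> \<le> \<bar>B\<bar>" by simp
      then show "norm (inveta t y * (vel t y)\<^sup>2) \<le> norm (B * (vel t y)\<^sup>2)"
        unfolding norm_mult by (intro mult_right_mono) simp_all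
    qed
  qed
  have eq: "eta (q t) y * (p t y)\<^sup>2 = p t y * vel t y" for y
    by (simp add: vel_def power2_eq_square)
  show V: "V t x = 1/2 * (prim (\<lambda>y. p t y * vel t y) 1 - prim (\<lambda>y. p t y * vel t y) x)"
    unfolding V_def U_fun_def eq upper_integral_eq_prim[OF I x] ..
  show "\<bar>V t x\<bar> \<le> (LINT y|leb01. \<bar>p t y * vel t y\<bar>)"
    unfolding V using prim_abs_le[OF I, of 1] prim_abs_le[OF I, of x] x by auto
qed

lemma V_meas2: "meas2 V"
proof (rule meas2_cong)
  have J: "meas2 (\<lambda>t y. p t y * vel t y)" by (intro meas2_mult p_meas2 L2_L2_meas2 vel_L2_L2)
  have "(\<lambda>t. prim (\<lambda>y. p t y * vel t y) 1) \<in> borel_measurable leb01"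
    by (rule meas2_section'[OF meas2_prim[OF J]]) simp
  then show "meas2 (\<lambda>t x. 1/2 * (prim (\<lambda>y. p t y * vel t y) 1 - prim (\<lambda>y. p t y * vel t y) x))"
    by (intro meas2_mult meas2_const meas2_diff meas2_time meas2_prim J)
  show "1/2 * (prim (\<lambda>y. p t y * vel t y) 1 - prim (\<lambda>y. p t y * vel t y) x) = V t x"
    if "t \<in> {0..1}" "x \<in> {0..1}" for t x
    using V_eq(1)[OF that] ..
qed

text \<open>One bound for all times comes from the uniform bound on the squared norms of
  \<open>vel\<close>.\<close>

lemma V_bdd2: "bdd2 V"
proof -
  obtain B where B: "\<forall>t\<in>{0..1}. \<forall>x\<in>{0..1}. \<bar>inveta t x\<bar> \<le> B" using inveta_bdd2 unfolding bdd2_def by blast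
  obtain C where C: "\<And>t. t \<in> {0..1} \<Longrightarrow> (LINT x|leb01. (vel t x)\<^sup>2) \<le> C"
    using C0_L2_bounded[OF vel_cont] by blast
  have B0: "0 \<le> B" using B by (metis abs_ge_zero atLeastAtMost_iff order_refl order_trans zero_le_one)
  have "\<bar>V t x\<bar> \<le> B * C" if t: "t \<in> {0..1}" and x: "x \<in> {0..1}" for t x
  proof -
    have L: "L2 (vel t)" using vel_cont t by (simp add: C0_L2_def)
    have "\<bar>V t x\<bar> \<le> (LINT y|leb01. \<bar>p t y * vel t y\<bar>)" by (rule V_eq(2)[OF t x])
    also have "\<dots> \<le> (LINT y|leb01. B * (vel t y)\<^sup>2)"
    proof (rule integral_mono)
      fix y assume "y \<in> space leb01"
      then have "\<bar>inveta t y\<bar> \<le> B" using B t by (simp add: space_leb01)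
      then have "\<bar>inveta t y * (vel t y)\<^sup>2\<bar> \<le> B * (vel t y)\<^sup>2" by (simp add: abs_mult mult_right_mono)
      then show "\<bar>p t y * vel t y\<bar> \<le> B * (vel t y)\<^sup>2"
        using inveta_vel[of t y] by (simp add: power2_eq_square mult.assoc[symmetric])
    qed (use V_eq(3)[OF t x] L2_D[OF L] in auto)
    also have "\<dots> \<le> B * C" using C[OF t] B0 by (simp add: mult_left_mono)
    finally show ?thesis .
  qed
  then show ?thesis unfolding bdd2_def by blast
qed

text \<open>The issue is the joint measurability of the inverse of \<open>phi\<close> in time and
  space. By monotonicity the inverse at y is at most c exactly when y is at most
  \<open>phi (q t) c\<close>, which turns sublevel sets into a condition on \<open>phi\<close>
  itself.\<close>

lemma b_coeff_measurable: "(\<lambda>t. b_coeff (p t) (q t)) \<in> borel_measurable leb01"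
proof -
  let ?i = "\<lambda>t y. the_inv_into {0..1} (phi (q t)) y"
  have "(\<lambda>z. ?i (fst z) (snd z)) \<in> borel_measurable leb2"
  proof (rule borel_measurableI_le)
    fix c :: real
    consider "c < 0" | "1 < c" | "c \<in> {0..1}" by fastforce
    then show "{z \<in> space leb2. ?i (fst z) (snd z) \<le> c} \<in> sets leb2"
    proof cases
      case 1
      then have eq: "{z \<in> space leb2. ?i (fst z) (snd z) \<le> c} = {}"
        using phi_inv(3)[OF q_Q] by (force simp: space_leb2)
      show ?thesis unfolding eq by (rule sets.empty_sets)
    next
      case 2
      then have eq: "{z \<in> space leb2. ?i (fst z) (snd z) \<le> c} = space leb2"
        using phi_inv(3)[OF q_Q] by (force simp: space_leb2)
      show ?thesis unfolding eq by (rule sets.top)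
    next
      case 3
      have "?i t y \<le> c \<longleftrightarrow> y \<le> phi (q t) c" if "t \<in> {0..1}" "y \<in> {0..1}" for t y
        using phi_le_iff[OF q_Q phi_inv(3)[OF q_Q], of t t y c] phi_inv(2)[OF q_Q, of t y] that 3 by simp
      then have "{z \<in> space leb2. ?i (fst z) (snd z) \<le> c} =
          {z \<in> space leb2. snd z \<le> phi (q (fst z)) c}"
        by (auto simp: space_leb2)
      moreover have "(\<lambda>z. phi (q (fst z)) c) \<in> borel_measurable leb2"
        by (rule measurable_compose[OF measurable_fst meas2_section'[OF phi_meas2 3]])
      ultimately show ?thesis by (simp add: borel_measurable_le leb2_snd)
    qed
  qed
  then have "(\<lambda>z. ?i (fst z) (snd z)) \<in> measurable leb2 borel_I"
    using phi_inv(3)[OF q_Q] by (intro measurable_restrict_space2) (auto simp: space_leb2)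
  then have "(\<lambda>z. ?i (fst z) (snd z)) \<in> measurable leb2 leb01"
    by (simp cong: measurable_cong_sets add: sets_leb01)
  from measurable_compose[OF measurable_Pair[OF measurable_fst this] p_meas2[unfolded meas2_def]]
  have "meas2 (\<lambda>t y. p t (?i t y))" by (simp add: meas2_def)
  from meas2_integral[OF meas2_power2[OF meas2_prim[OF this]]]
  show ?thesis unfolding b_coeff_def prim_def by simp
qed

lemma b_coeff_bdd2: "bdd2 (\<lambda>t x. b_coeff (p t) (q t))"
proof -
  obtain C where C: "\<And>t. t \<in> {0..1} \<Longrightarrow> (LINT x|leb01. (vel t x)\<^sup>2) \<le> C"
    using C0_L2_bounded[OF vel_cont] by blast
  have "\<bar>b_coeff (p t) (q t)\<bar> \<le> 3/2 * (1/2 + C/2)\<^sup>2" if t: "t \<in> {0..1}" for t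
  proof (rule b_coeff_bound[OF q_Q[OF t]])
    have L: "L2 (vel t)" using vel_cont t by (simp add: C0_L2_def)
    show "integrable leb01 (\<lambda>x. eta (q t) x * p t x)" using L2_D(3)[OF L] unfolding vel_def .
    show "p t \<in> borel_measurable leb01" by (rule meas2_section[OF p_meas2 t])
    show "(LINT x|leb01. \<bar>eta (q t) x * p t x\<bar>) \<le> 1/2 + C/2"
      using L2_integral_abs_le[OF L zero_less_one] C[OF t] by (simp add: vel_def)
  qed
  then show ?thesis unfolding bdd2_def by blast
qed

text \<open>The two occurrences of \<open>V\<close> cancel up to its projection. What remains is the
  square integrable time derivative of \<open>p\<close> plus a bounded term.\<close>

lemma acc_flat_eq:
  "acc_flat p q t x = time_deriv p t x +
    (pi_star (q t) (V t) x - H2inv_comb (q t) (vector [0, b_coeff (p t) (q t)]) x)"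
  by (simp add: acc_flat_def Let_def V_def)

lemma acc_flat_L2_L2: "L2_L2 (acc_flat p q)"
proof -
  have "L2_L2 (\<lambda>t x. pi_star (q t) (V t) x - H2inv_comb (q t) (vector [0, b_coeff (p t) (q t)]) x)"
    by (intro L2_L2_bdd2 meas2_diff bdd2_diff pi_star_meas2 pi_star_bdd2 H2inv_comb_meas2 H2inv_comb_bdd2 V_meas2 V_bdd2
        b_coeff_measurable b_coeff_bdd2 bdd2_const borel_measurable_const)
  moreover have "L2_L2 (time_deriv p)" using p_deriv by (simp add: weak_deriv_def)
  ultimately show ?thesis unfolding acc_flat_eq[abs_def] by (intro L2_L2_add)
qed

end

section \<open>The functional\<close>

lemma disintegrates_D:
  assumes "disintegrates \<Delta> \<kappa>" "t \<in> {0..1}"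
  shows "sets (\<kappa> t) = sets borel_I" "finite_measure (\<kappa> t)" "space (\<kappa> t) = {0..1}"
proof -
  show s: "sets (\<kappa> t) = sets borel_I" "finite_measure (\<kappa> t)"
    using assms by (simp_all add: disintegrates_def)
  show "space (\<kappa> t) = {0..1}" using sets_eq_imp_space_eq[OF s(1)] by (simp add: space_borel_I)
qed

lemma disintegrates_section_measurable:
  assumes "disintegrates \<Delta> \<kappa>" "t \<in> {0..1}" "f \<in> borel_measurable borel_D"
  shows "(\<lambda>y. f (t, y)) \<in> borel_measurable (\<kappa> t)"
proof -
  have "(\<lambda>y. (t, y)) \<in> measurable borel_I borel_D"
    using assms(2) by (intro borel_D_pairI) (auto simp: space_borel_I measurable_restrict_space1)
  from measurable_compose[OF this assms(3)] show ?thesis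
    by (simp add: measurable_cong_sets[OF disintegrates_D(1)[OF assms(1,2)] refl])
qed

text \<open>\<open>disintegrates\<close> guarantees measurability in time only for the masses of
  vertical sections; approximation by simple functions extends it to integrals.\<close>

lemma disintegrates_nn_integral_measurable:
  fixes f :: "real \<times> real \<Rightarrow> ennreal"
  assumes \<kappa>: "disintegrates \<Delta> \<kappa>" and f: "f \<in> borel_measurable borel_D"
  shows "(\<lambda>t. \<integral>\<^sup>+y. f (t, y) \<partial>\<kappa> t) \<in> borel_measurable leb01"
  using f
proof (induction f rule: borel_measurable_induct)
  case (cong f g)
  have eq: "(\<integral>\<^sup>+y. f (t, y) \<partial>\<kappa> t) = (\<integral>\<^sup>+y. g (t, y) \<partial>\<kappa> t)" if "t \<in> space leb01" for t
    using that cong(3) disintegrates_D(3)[OF \<kappa>, of t] by (intro nn_integral_cong) (simp add: space_leb01)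
  show ?case by (rule measurable_cong[THEN iffD2, rotated, OF cong(4)]) (rule eq)
next
  case (set A)
  have eq: "(\<integral>\<^sup>+y. indicator A (t, y) \<partial>\<kappa> t) = emeasure (\<kappa> t) (Pair t -` A)" if "t \<in> space leb01" for t
  proof -
    have t: "t \<in> {0..1}" using that by (simp add: space_leb01)
    have "Pair t -` A \<in> sets (\<kappa> t)"
      using vertical_section_sets[OF set t] disintegrates_D(1)[OF \<kappa> t] by simp
    moreover have "(\<lambda>y. indicator A (t, y) :: ennreal) = indicator (Pair t -` A)"
      by (auto simp: indicator_def fun_eq_iff)
    ultimately show ?thesis by simp
  qed
  have m: "(\<lambda>t. emeasure (\<kappa> t) (Pair t -` A)) \<in> borel_measurable leb01"
    using \<kappa> set by (simp add: disintegrates_def)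
  show ?case by (rule measurable_cong[THEN iffD2, rotated, OF m]) (rule eq)
next
  case (mult u c)
  have eq: "(\<integral>\<^sup>+y. c * u (t, y) \<partial>\<kappa> t) = c * (\<integral>\<^sup>+y. u (t, y) \<partial>\<kappa> t)" if "t \<in> space leb01" for t
    using disintegrates_section_measurable[OF \<kappa> _ mult(2), of t] that
    by (intro nn_integral_cmult) (simp add: space_leb01)
  have m: "(\<lambda>t. c * (\<integral>\<^sup>+y. u (t, y) \<partial>\<kappa> t)) \<in> borel_measurable leb01" using mult(4) by simp
  show ?case by (rule measurable_cong[THEN iffD2, rotated, OF m]) (rule eq)
next
  case (add u v)
  have eq: "(\<integral>\<^sup>+y. v (t, y) + u (t, y) \<partial>\<kappa> t) = (\<integral>\<^sup>+y. v (t, y) \<partial>\<kappa> t) + (\<integral>\<^sup>+y. u (t, y) \<partial>\<kappa> t)"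
    if "t \<in> space leb01" for t
    using disintegrates_section_measurable[OF \<kappa> _ \<open>u \<in> borel_measurable borel_D\<close>, of t]
      disintegrates_section_measurable[OF \<kappa> _ \<open>v \<in> borel_measurable borel_D\<close>, of t] that
    by (intro nn_integral_add) (simp_all add: space_leb01)
  have m: "(\<lambda>t. (\<integral>\<^sup>+y. v (t, y) \<partial>\<kappa> t) + (\<integral>\<^sup>+y. u (t, y) \<partial>\<kappa> t)) \<in> borel_measurable leb01"
    using add.IH by simp
  show ?case by (rule measurable_cong[THEN iffD2, rotated, OF m]) (rule eq)
next
  case (seq U)
  have eq: "(\<integral>\<^sup>+y. (SUP i. U i) (t, y) \<partial>\<kappa> t) = (SUP i. \<integral>\<^sup>+y. U i (t, y) \<partial>\<kappa> t)" if "t \<in> space leb01" for t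
  proof -
    have "incseq (\<lambda>i y. U i (t, y))" using \<open>incseq U\<close> by (auto simp: incseq_def le_fun_def)
    moreover have "(\<lambda>y. U i (t, y)) \<in> borel_measurable (\<kappa> t)" for i
      using disintegrates_section_measurable[OF \<kappa> _ seq(1), of t i] that by (simp add: space_leb01)
    ultimately show ?thesis by (simp add: nn_integral_monotone_convergence_SUP[symmetric] image_comp)
  qed
  have m: "(\<lambda>t. SUP i. \<integral>\<^sup>+y. U i (t, y) \<partial>\<kappa> t) \<in> borel_measurable leb01" using seq.IH by simp
  show ?case by (rule measurable_cong[THEN iffD2, rotated, OF m]) (rule eq)
qed

lemma borel_D_into_leb2: "(\<lambda>z. (fst z, snd z)) \<in> measurable borel_D leb2"
proof -
  have "fst \<in> borel_measurable borel_D" "snd \<in> borel_measurable borel_D"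
    by (auto intro!: measurable_restrict_space1 simp: borel_prod[symmetric])
  then have "fst \<in> measurable borel_D borel_I" "snd \<in> measurable borel_D borel_I"
    by (auto intro!: measurable_restrict_space2)
  then have "fst \<in> measurable borel_D leb01" "snd \<in> measurable borel_D leb01"
    by (simp_all cong: measurable_cong_sets add: sets_leb01)
  then show ?thesis by (rule measurable_Pair)
qed

lemma meas2_borel_D: "meas2 u \<Longrightarrow> (\<lambda>z. u (fst z) (snd z)) \<in> borel_measurable borel_D"
  unfolding meas2_def using measurable_compose[OF borel_D_into_leb2, of "\<lambda>z. u (fst z) (snd z)" borel]
  unfolding fst_conv snd_conv by blast

section \<open>The weighted energy along the path\<close>

context cotangent_path
begin

definition energy :: "(real \<Rightarrow> real \<Rightarrow> real) \<Rightarrow> ennreal" where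
  "energy f = (\<integral>\<^sup>+t. cotangent_norm_sq (q t) (f t) \<partial>leb01)"

lemma cotangent_norm_sq_measurable:
  "meas2 f \<Longrightarrow> (\<lambda>t. cotangent_norm_sq (q t) (f t)) \<in> borel_measurable leb01"
  unfolding cotangent_norm_sq_def by (intro meas2_nn_integral meas2_mult eta_meas2 meas2_power2)

lemma ennreal_combination_eq:
  assumes "0 \<le> a" "0 \<le> b" "0 \<le> c" "0 \<le> d" "0 \<le> k" "0 \<le> l" "0 \<le> m" "a + k * b = l * c + m * d"
  shows "ennreal a + ennreal k * ennreal b = ennreal l * ennreal c + ennreal m * ennreal d"
proof -
  have "ennreal a + ennreal k * ennreal b = ennreal (a + k * b)"
    "ennreal l * ennreal c + ennreal m * ennreal d = ennreal (l * c + m * d)"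
    using assms(1-7) by (simp_all add: ennreal_mult)
  then show ?thesis unfolding assms(8) by (rule trans[OF _ sym])
qed

lemma nn_integral_combination:
  fixes f g :: "'b \<Rightarrow> ennreal"
  assumes "f \<in> borel_measurable M" "g \<in> borel_measurable M"
  shows "(\<integral>\<^sup>+x. f x + k * g x \<partial>M) = (\<integral>\<^sup>+x. f x \<partial>M) + k * (\<integral>\<^sup>+x. g x \<partial>M)"
    and "(\<integral>\<^sup>+x. l * f x + k * g x \<partial>M) = l * (\<integral>\<^sup>+x. f x \<partial>M) + k * (\<integral>\<^sup>+x. g x \<partial>M)"
  using assms by (simp_all add: nn_integral_add nn_integral_cmult)

text \<open>An exact identity instead of an inequality: dropping the difference term gives
  convexity, keeping it at s = 1/2 is the parallelogram identity used for uniqueness. Stated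
  additively, it remains true for infinite energies.\<close>

lemma energy_convex_identity:
  assumes f: "meas2 f" and g: "meas2 g" and s: "0 \<le> s" "s \<le> 1"
  shows "energy (\<lambda>t x. (1 - s) * f t x + s * g t x) + ennreal (s * (1 - s)) * energy (\<lambda>t x. f t x - g t x) =
    ennreal (1 - s) * energy f + ennreal s * energy g"
proof -
  let ?h = "\<lambda>t x. (1 - s) * f t x + s * g t x" and ?d = "\<lambda>t x. f t x - g t x"
  have hd: "meas2 ?h" "meas2 ?d" by (intro meas2_add meas2_diff meas2_mult meas2_const f g)+
  note meas = hd[THEN cotangent_norm_sq_measurable] f[THEN cotangent_norm_sq_measurable] g[THEN cotangent_norm_sq_measurable]
  have "cotangent_norm_sq (q t) (?h t) + ennreal (s * (1 - s)) * cotangent_norm_sq (q t) (?d t) =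
      ennreal (1 - s) * cotangent_norm_sq (q t) (f t) + ennreal s * cotangent_norm_sq (q t) (g t)"
    if "t \<in> space leb01" for t
  proof -
    have t: "t \<in> {0..1}" using that by (simp add: space_leb01)
    have m: "(\<lambda>x. ennreal (eta (q t) x * (u t x)\<^sup>2)) \<in> borel_measurable leb01" if "meas2 u" for u
      using meas2_section[OF meas2_mult[OF eta_meas2 meas2_power2[OF that]] t] by simp
    have pt: "ennreal (eta (q t) x * (?h t x)\<^sup>2) + ennreal (s * (1 - s)) * ennreal (eta (q t) x * (?d t x)\<^sup>2) =
        ennreal (1 - s) * ennreal (eta (q t) x * (f t x)\<^sup>2) + ennreal s * ennreal (eta (q t) x * (g t x)\<^sup>2)" for x
    proof -
      have "eta (q t) x * (?h t x)\<^sup>2 + s * (1 - s) * (eta (q t) x * (?d t x)\<^sup>2) =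
          (1 - s) * (eta (q t) x * (f t x)\<^sup>2) + s * (eta (q t) x * (g t x)\<^sup>2)"
        by (simp add: power2_eq_square algebra_simps)
      then show ?thesis
        using s eta_pos[THEN less_imp_le, of "q t" x]
        by (intro ennreal_combination_eq mult_nonneg_nonneg zero_le_power2) auto
    qed
    have "cotangent_norm_sq (q t) (?h t) + ennreal (s * (1 - s)) * cotangent_norm_sq (q t) (?d t) =
        (\<integral>\<^sup>+x. ennreal (eta (q t) x * (?h t x)\<^sup>2) + ennreal (s * (1 - s)) * ennreal (eta (q t) x * (?d t x)\<^sup>2) \<partial>leb01)"
      unfolding cotangent_norm_sq_def by (rule nn_integral_combination(1)[OF hd[THEN m], symmetric])
    also have "\<dots> = ennreal (1 - s) * cotangent_norm_sq (q t) (f t) + ennreal s * cotangent_norm_sq (q t) (g t)"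
      unfolding pt cotangent_norm_sq_def by (rule nn_integral_combination(2)[OF m[OF f] m[OF g]])
    finally show ?thesis .
  qed
  then have "(\<integral>\<^sup>+t. cotangent_norm_sq (q t) (?h t) + ennreal (s * (1 - s)) * cotangent_norm_sq (q t) (?d t) \<partial>leb01) =
      (\<integral>\<^sup>+t. ennreal (1 - s) * cotangent_norm_sq (q t) (f t) + ennreal s * cotangent_norm_sq (q t) (g t) \<partial>leb01)"
    by (rule nn_integral_cong)
  then show ?thesis
    unfolding energy_def nn_integral_combination(1)[OF meas(1,2)] nn_integral_combination(2)[OF meas(3,4)] .
qed

lemma energy_finite:
  assumes f: "L2_L2 f"
  shows "energy f < \<infinity>"
proof -
  obtain B where B: "\<forall>t\<in>{0..1}. \<forall>x\<in>{0..1}. \<bar>eta (q t) x\<bar> \<le> B" using eta_bdd2 unfolding bdd2_def by blast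
  have B0: "0 \<le> B" using B by (metis abs_ge_zero atLeastAtMost_iff order_refl order_trans zero_le_one)
  have "energy f \<le> (\<integral>\<^sup>+t. \<integral>\<^sup>+x. ennreal (B * (f t x)\<^sup>2) \<partial>leb01 \<partial>leb01)"
    unfolding energy_def cotangent_norm_sq_def
    using B by (intro nn_integral_mono ennreal_leI mult_right_mono) (auto simp: space_leb01 abs_le_iff)
  also have "\<dots> = (\<integral>\<^sup>+z. ennreal (B * (case_prod f z)\<^sup>2) \<partial>leb2)"
  proof -
    have "(\<lambda>z. ennreal (B * (case_prod f z)\<^sup>2)) \<in> borel_measurable leb2"
      by (intro measurable_compose[OF _ measurable_ennreal] borel_measurable_times
          borel_measurable_const borel_measurable_power L2_L2_D(1)[OF f])
    from leb01.nn_integral_fst[OF this] show ?thesis by simp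
  qed
  also have "\<dots> = ennreal (LINT z|leb2. B * (case_prod f z)\<^sup>2)"
    using B0 by (intro nn_integral_eq_integral integrable_mult_right L2_L2_D(3)[OF f]) auto
  also have "\<dots> < \<infinity>" by simp
  finally show ?thesis .
qed

text \<open>As \<open>eta\<close> is positive, zero energy of the difference forces equality of the
  functions almost everywhere, and no energy has to be subtracted.\<close>

lemma energy_diff_zero:
  assumes f: "meas2 f" and g: "meas2 g" and zero: "energy (\<lambda>t x. f t x - g t x) = 0"
  shows "energy f = energy g"
proof -
  have d: "meas2 (\<lambda>t x. f t x - g t x)" by (intro meas2_diff f g)
  have "AE t in leb01. cotangent_norm_sq (q t) (\<lambda>x. f t x - g t x) = 0"
    using zero cotangent_norm_sq_measurable[OF d] unfolding energy_def by (simp add: nn_integral_0_iff_AE)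
  then have "AE t in leb01. cotangent_norm_sq (q t) (f t) = cotangent_norm_sq (q t) (g t)"
    using AE_space
  proof eventually_elim
    case (elim t)
    then have t: "t \<in> {0..1}" by (simp add: space_leb01)
    have "(\<lambda>x. ennreal (eta (q t) x * (f t x - g t x)\<^sup>2)) \<in> borel_measurable leb01"
      using meas2_section[OF meas2_mult[OF eta_meas2 meas2_power2[OF d]] t] by simp
    then have "AE x in leb01. ennreal (eta (q t) x * (f t x - g t x)\<^sup>2) = 0"
      using elim(1) unfolding cotangent_norm_sq_def by (simp add: nn_integral_0_iff_AE)
    then have "AE x in leb01. ennreal (eta (q t) x * (f t x)\<^sup>2) = ennreal (eta (q t) x * (g t x)\<^sup>2)"
    proof (rule eventually_mono)
      fix x assume "ennreal (eta (q t) x * (f t x - g t x)\<^sup>2) = 0"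
      then have "eta (q t) x * (f t x - g t x)\<^sup>2 \<le> 0" by (simp add: ennreal_eq_0_iff)
      then have "f t x = g t x" using eta_pos[of "q t" x] by (simp add: mult_le_0_iff)
      then show "ennreal (eta (q t) x * (f t x)\<^sup>2) = ennreal (eta (q t) x * (g t x)\<^sup>2)" by simp
    qed
    then show ?case unfolding cotangent_norm_sq_def by (rule nn_integral_cong_AE)
  qed
  then show ?thesis unfolding energy_def by (rule nn_integral_cong_AE)
qed

lemma eta_borel_D: "(\<lambda>(t, x). eta (q t) x) \<in> borel_measurable borel_D"
  using meas2_borel_D[OF eta_meas2] by (simp add: case_prod_beta')

section \<open>Measurability and bounds of upper slice integrals\<close>

context
  fixes \<Delta> \<kappa>
  assumes \<kappa>: "disintegrates \<Delta> \<kappa>"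
begin

lemma slice_eta_integrable:
  assumes t: "t \<in> {0..1}"
  shows "integrable (\<kappa> t) (\<lambda>y. indicator {x..1} y * eta (q t) y)"
    and "integrable (\<kappa> t) (eta (q t))"
proof -
  interpret finite_measure "\<kappa> t" by (rule disintegrates_D(2)[OF \<kappa> t])
  obtain B where B: "\<forall>t\<in>{0..1}. \<forall>x\<in>{0..1}. \<bar>eta (q t) x\<bar> \<le> B" using eta_bdd2 unfolding bdd2_def by blast
  have m: "eta (q t) \<in> borel_measurable (\<kappa> t)"
    using disintegrates_section_measurable[OF \<kappa> t eta_borel_D] by simp
  show "integrable (\<kappa> t) (eta (q t))"
    using B t m by (intro integrable_const_bound[of _ B]) (auto simp: disintegrates_D(3)[OF \<kappa> t])
  have "(\<lambda>y. indicator {x..1} y :: real) \<in> borel_measurable (\<kappa> t)"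
    unfolding measurable_cong_sets[OF disintegrates_D(1)[OF \<kappa> t] refl] by (rule measurable_restrict_space1) measurable
  with m have "(\<lambda>y. indicator {x..1} y * eta (q t) y) \<in> borel_measurable (\<kappa> t)" by (intro borel_measurable_times)
  with \<open>integrable (\<kappa> t) (eta (q t))\<close> show "integrable (\<kappa> t) (\<lambda>y. indicator {x..1} y * eta (q t) y)"
    by (rule Bochner_Integration.integrable_bound) (auto simp: indicator_def)
qed

lemma slice_upper_measurable:
  "(\<lambda>t. LINT y|\<kappa> t. indicator {c..1} y * eta (q t) y) \<in> borel_measurable leb01"
proof -
  have "(\<lambda>z. indicator {c..1} (snd z) :: real) \<in> borel_measurable borel_D"
    by (rule measurable_restrict_space1) (simp add: borel_prod[symmetric])
  then have "(\<lambda>z. ennreal (indicator {c..1} (snd z) * eta (q (fst z)) (snd z))) \<in> borel_measurable borel_D"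
    using meas2_borel_D[OF eta_meas2] by (intro measurable_compose[OF borel_measurable_times measurable_ennreal])
  from disintegrates_nn_integral_measurable[OF \<kappa> this]
  have m: "(\<lambda>t. enn2real (\<integral>\<^sup>+y. ennreal (indicator {c..1} y * eta (q t) y) \<partial>\<kappa> t)) \<in> borel_measurable leb01"
    by simp
  have eq: "(LINT y|\<kappa> t. indicator {c..1} y * eta (q t) y) =
      enn2real (\<integral>\<^sup>+y. ennreal (indicator {c..1} y * eta (q t) y) \<partial>\<kappa> t)" if "t \<in> space leb01" for t
    using slice_eta_integrable(1)[of t c] that eta_pos[THEN less_imp_le]
    by (intro integral_eq_nn_integral) (auto simp: space_leb01)
  show ?thesis by (rule measurable_cong[THEN iffD2, rotated, OF m]) (rule eq)
qed

text \<open>The integral is left-continuous in \<open>x\<close>, hence a limit of functions that are step functions in \<open>x\<close>.\<close>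

lemma slice_upper_meas2: "meas2 (\<lambda>t x. LINT y|\<kappa> t. indicator {x..1} y * eta (q t) y)"
  unfolding meas2_def
proof (rule borel_measurable_LIMSEQ_real)
  let ?G = "\<lambda>t c. LINT y|\<kappa> t. indicator {c..1} y * eta (q t) y"
  \<comment> \<open>Rounding is downwards to the grid of mesh 1 / (n + 1): grid points strictly
    above \<open>snd z\<close> would lose a possible atom of the slice at
    \<open>snd z\<close>.\<close>
  let ?x = "\<lambda>n z. real_of_int \<lfloor>real (Suc n) * snd z\<rfloor> / real (Suc n)"
  show "(\<lambda>z. ?G (fst z) (?x n z)) \<in> borel_measurable leb2" for n
  proof (rule measurable_compose_countable[where f = "\<lambda>i z. ?G (fst z) (real_of_int i / real (Suc n))"])
    show "(\<lambda>z. ?G (fst z) (real_of_int i / real (Suc n))) \<in> borel_measurable leb2" for i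
      by (rule measurable_compose[OF measurable_fst slice_upper_measurable])
    have "(\<lambda>z. real (Suc n) * snd z) \<in> borel_measurable leb2"
      by (intro borel_measurable_times borel_measurable_const leb2_snd)
    then show "(\<lambda>z. \<lfloor>real (Suc n) * snd z\<rfloor>) \<in> measurable leb2 (count_space UNIV)"
      by (rule measurable_compose[OF _ measurable_real_floor])
  qed
  fix z assume "z \<in> space leb2"
  then have t: "fst z \<in> {0..1}" by (auto simp: space_leb2)
  have le: "?x n z \<le> snd z" for n
  proof -
    have "real_of_int \<lfloor>real (Suc n) * snd z\<rfloor> \<le> real (Suc n) * snd z" by (rule of_int_floor_le)
    then show ?thesis by (simp add: divide_le_eq mult.commute del: of_nat_Suc)
  qed
  have gt: "snd z - 1 / real (Suc n) < ?x n z" for n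
  proof -
    have "real (Suc n) * snd z - 1 < real_of_int \<lfloor>real (Suc n) * snd z\<rfloor>" by linarith
    then have "(real (Suc n) * snd z - 1) / real (Suc n) < ?x n z" by (rule divide_strict_right_mono) simp
    then show ?thesis by (simp add: diff_divide_distrib del: of_nat_Suc)
  qed
  show "(\<lambda>n. ?G (fst z) (?x n z)) \<longlonglongrightarrow> ?G (fst z) (snd z)"
  proof (rule integral_dominated_convergence[where w = "eta (q (fst z))"])
    show "AE y in \<kappa> (fst z). (\<lambda>n. indicator {?x n z..1} y * eta (q (fst z)) y) \<longlonglongrightarrow> indicator {snd z..1} y * eta (q (fst z)) y"
    proof (intro AE_I2 tendsto_mult_right tendsto_eventually)
      fix y :: real
      show "\<forall>\<^sub>F n in sequentially. indicator {?x n z..1} y = (indicator {snd z..1} y :: real)"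
      proof (cases "snd z \<le> y")
        case True
        then have "?x n z \<le> y" for n using le[of n] by linarith
        with True show ?thesis by (simp add: indicator_def)
      next
        case False
        then have "\<forall>\<^sub>F n in sequentially. 1 / real (Suc n) < snd z - y"
          using order_tendstoD(2)[OF LIMSEQ_inverse_real_of_nat, of "snd z - y"] by (simp add: inverse_eq_divide)
        then show ?thesis
        proof (rule eventually_mono)
          fix n assume "1 / real (Suc n) < snd z - y"
          then have "y < ?x n z" using gt[of n] by linarith
          with False show "indicator {?x n z..1} y = (indicator {snd z..1} y :: real)" by (simp add: indicator_def)
        qed
      qed
    qed
    show "AE y in \<kappa> (fst z). norm (indicator {?x n z..1} y * eta (q (fst z)) y) \<le> eta (q (fst z)) y" for n
      using eta_pos[THEN less_imp_le] by (intro AE_I2) (auto simp: indicator_def)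
  qed (use slice_eta_integrable[OF t] in auto)
qed

lemma slice_upper_bound:
  assumes t: "t \<in> {0..1}"
  shows "\<bar>LINT y|\<kappa> t. indicator {x..1} y * eta (q t) y\<bar> \<le> (LINT y|\<kappa> t. eta (q t) y)"
proof -
  have "\<bar>LINT y|\<kappa> t. indicator {x..1} y * eta (q t) y\<bar> \<le> (LINT y|\<kappa> t. \<bar>indicator {x..1} y * eta (q t) y\<bar>)"
    by (rule integral_abs_bound)
  also have "\<dots> \<le> (LINT y|\<kappa> t. eta (q t) y)"
    using slice_eta_integrable[OF t] eta_pos[THEN less_imp_le]
    by (intro integral_mono integrable_abs) (auto simp: indicator_def abs_mult abs_of_nonneg)
  finally show ?thesis .
qed

end

section \<open>Affine dependence of the acceleration on the measure\<close>

lemma U_meas_eq: "U_meas \<Delta> q t x = 1/2 * (LINT y|slice \<Delta> t. indicator {x..1} y * eta (q t) y)"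
  by (simp add: U_meas_def set_lebesgue_integral_def)

lemma U_meas_meas2: "disintegrates \<Delta> (slice \<Delta>) \<Longrightarrow> meas2 (U_meas \<Delta> q)"
  unfolding U_meas_eq[abs_def] by (intro meas2_mult meas2_const slice_upper_meas2)

text \<open>The bound may depend on \<open>t\<close>, since a disintegration does not control the
  slice masses uniformly. This suffices because the linearity of the projection is used at one time
  after the other.\<close>

lemma U_meas_bound:
  assumes "disintegrates \<Delta> (slice \<Delta>)" "t \<in> {0..1}"
  shows "\<exists>C. \<forall>x\<in>{0..1}. \<bar>U_meas \<Delta> q t x\<bar> \<le> C"
  using slice_upper_bound[OF assms]
  by (intro exI[of _ "1/2 * (LINT y|slice \<Delta> t. eta (q t) y)"]) (simp add: U_meas_eq abs_mult)

text \<open>Boundedness of the arguments supplies integrability; for non-integrable functions the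
  integral defaults to 0 and additivity may fail.\<close>

lemma eta_inner_lincomb:
  assumes t: "t \<in> {0..1}" and u: "u \<in> borel_measurable leb01" "\<forall>x\<in>{0..1}. \<bar>u x\<bar> \<le> C"
    and v: "v \<in> borel_measurable leb01" "\<forall>x\<in>{0..1}. \<bar>v x\<bar> \<le> C'" and h: "meas2 h" "bdd2 h"
  shows "eta_inner (q t) (\<lambda>x. c * u x + d * v x) (h t) = c * eta_inner (q t) u (h t) + d * eta_inner (q t) v (h t)"
proof -
  have int: "integrable leb01 (\<lambda>x. h t x * eta (q t) x)"
    by (rule bdd2_integrable[OF meas2_mult[OF h(1) eta_meas2] bdd2_mult[OF h(2) eta_bdd2] t])
  have prod: "integrable leb01 (\<lambda>x. w x * h t x * eta (q t) x)"
    if w: "w \<in> borel_measurable leb01" "\<forall>x\<in>{0..1}. \<bar>w x\<bar> \<le> K" for w K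
  proof -
    have "integrable leb01 (\<lambda>x. w x * (h t x * eta (q t) x))"
    proof (rule Bochner_Integration.integrable_bound)
      show "integrable leb01 (\<lambda>x. K * (h t x * eta (q t) x))" by (rule integrable_mult_right[OF int])
      show "(\<lambda>x. w x * (h t x * eta (q t) x)) \<in> borel_measurable leb01"
        by (rule borel_measurable_times[OF w(1) borel_measurable_integrable[OF int]])
      show "AE x in leb01. norm (w x * (h t x * eta (q t) x)) \<le> norm (K * (h t x * eta (q t) x))"
      proof (rule AE_I2)
        fix x assume "x \<in> space leb01"
        then have "\<bar>w x\<bar> \<le> K" using w(2) by (simp add: space_leb01)
        then have "\<bar>w x\<bar> \<le> \<bar>K\<bar>" by simp
        then show "norm (w x * (h t x * eta (q t) x)) \<le> norm (K * (h t x * eta (q t) x))"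
          unfolding real_norm_def abs_mult by (intro mult_right_mono) simp_all
      qed
    qed
    then show ?thesis by (simp add: mult.assoc)
  qed
  have "eta_inner (q t) (\<lambda>x. c * u x + d * v x) (h t) =
      (LINT x|leb01. c * (u x * h t x * eta (q t) x) + d * (v x * h t x * eta (q t) x))"
    unfolding eta_inner_def by (rule arg_cong[where f = "integral\<^sup>L leb01"]) (simp add: fun_eq_iff algebra_simps)
  then show ?thesis using prod[OF u] prod[OF v] by (simp add: eta_inner_def)
qed

lemma pi_star_lincomb:
  assumes t: "t \<in> {0..1}" and u: "u \<in> borel_measurable leb01" "\<forall>x\<in>{0..1}. \<bar>u x\<bar> \<le> C"
    and v: "v \<in> borel_measurable leb01" "\<forall>x\<in>{0..1}. \<bar>v x\<bar> \<le> C'"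
  shows "pi_star (q t) (\<lambda>x. c * u x + d * v x) x = c * pi_star (q t) u x + d * pi_star (q t) v x"
  using eta_inner_lincomb[OF t u v, of "\<lambda>t x. 1"] eta_inner_lincomb[OF t u v phi_meas2 phi_bdd2]
  unfolding pi_star_def H2inv_comb_eq by (simp add: algebra_simps)

definition acc :: "(real \<times> real) measure \<Rightarrow> real \<Rightarrow> real \<Rightarrow> real" where
  "acc \<Delta> t x = acc_flat p q t x + pi_star (q t) (U_meas \<Delta> q t) x"

lemma acc_meas2: "disintegrates \<Delta> (slice \<Delta>) \<Longrightarrow> meas2 (acc \<Delta>)"
  unfolding acc_def[abs_def] by (intro meas2_add L2_L2_meas2 acc_flat_L2_L2 pi_star_meas2 U_meas_meas2)

lemma energy_cong_AE:
  assumes "AE t in leb01. \<forall>x. f t x = g t x"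
  shows "energy f = energy g"
  unfolding energy_def
proof (rule nn_integral_cong_AE)
  show "AE t in leb01. cotangent_norm_sq (q t) (f t) = cotangent_norm_sq (q t) (g t)"
    using assms by eventually_elim (simp add: cotangent_norm_sq_def)
qed

text \<open>The weights sum to 1, which reproduces the part \<open>acc_flat\<close>. The identity
  holds at every x because, off a null set of times, the slice of the mixture equals the mixture of
  the slices as a measure.\<close>

lemma acc_mix:
  assumes M: "radon_pos M" "disintegrates M (slice M)" and N: "radon_pos N" "disintegrates N (slice N)"
    and mix: "disintegrates (mix_meas s M N) (slice (mix_meas s M N))" and s: "s \<in> {0..1}"
  shows "AE t in leb01. \<forall>x. acc (mix_meas s M N) t x = (1 - s) * acc M t x + s * acc N t x"
  using disintegrates_mix[OF M N mix s] AE_space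
proof eventually_elim
  case (elim t)
  then have t: "t \<in> {0..1}" by (simp add: space_leb01)
  have "sets (slice N t) = sets (slice M t)"
    using disintegrates_D(1)[OF M(2) t] disintegrates_D(1)[OF N(2) t] by simp
  then have "U_meas (mix_meas s M N) q t x = (1 - s) * U_meas M q t x + s * U_meas N q t x" for x
    unfolding U_meas_eq elim(1)
    using slice_eta_integrable(1)[OF M(2) t] slice_eta_integrable(1)[OF N(2) t] s
    by (subst integral_mix_meas) (auto simp: field_simps)
  then have eq: "U_meas (mix_meas s M N) q t = (\<lambda>x. (1 - s) * U_meas M q t x + s * U_meas N q t x)" by blast
  obtain C C' where C: "\<forall>x\<in>{0..1}. \<bar>U_meas M q t x\<bar> \<le> C" "\<forall>x\<in>{0..1}. \<bar>U_meas N q t x\<bar> \<le> C'"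
    using U_meas_bound[OF M(2) t] U_meas_bound[OF N(2) t] by blast
  show ?case
    unfolding acc_def eq
      pi_star_lincomb[OF t meas2_section[OF U_meas_meas2[OF M(2)] t] C(1) meas2_section[OF U_meas_meas2[OF N(2)] t] C(2)]
    by (simp add: algebra_simps)
qed

text \<open>The slices chosen for the zero measure vanish only at almost every time, so the
  acceleration term reduces to \<open>acc_flat\<close> almost everywhere, and its energy is finite
  by square integrability.\<close>

lemma energy_acc_zero_finite:
  assumes "disintegrates zero_meas (slice zero_meas)"
  shows "energy (acc zero_meas) < \<infinity>"
proof -
  have "AE t in leb01. \<forall>x. acc zero_meas t x = acc_flat p q t x"
    using disintegrates_zero[OF assms]
  proof eventually_elim
    case (elim t)
    then have U: "U_meas zero_meas q t = (\<lambda>x. 0)" by (simp add: U_meas_eq fun_eq_iff)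
    show ?case unfolding acc_def U by (simp add: pi_star_def eta_inner_def H2inv_comb_eq)
  qed
  from energy_cong_AE[OF this] energy_finite[OF acc_flat_L2_L2] show ?thesis by simp
qed

section \<open>Convexity of the functional and uniqueness of the minimum\<close>

definition FR_eta :: "(real \<times> real) measure \<Rightarrow> ennreal" where
  "FR_eta \<Delta> = FR (\<lambda>(t, x). eta (q t) x) (signed_of \<Delta>) (dt_meas \<Delta>)"

lemma F_functional_eq:
  assumes "has_dt \<Delta> \<delta>"
  shows "F_functional P \<Delta> p q = enn2ereal (FR_eta \<Delta> + energy (acc \<Delta>)) + ereal (P (p 1, q 1))"
proof -
  have ex: "\<exists>\<delta>. has_dt \<Delta> \<delta>" using assms by blast
  show ?thesis
    unfolding F_functional_def if_P[OF ex] FR_eta_def energy_def acc_def plus_ennreal.rep_eq ..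
qed

lemma F_functional_infinite: "\<nexists>\<delta>. has_dt \<Delta> \<delta> \<Longrightarrow> F_functional P \<Delta> p q = \<infinity>"
  by (simp add: F_functional_def)

text \<open>The derivative chosen by \<open>dt_meas\<close> for the mixture is replaced by the
  mixture of the two chosen derivatives; uniqueness as a set function makes this exchange invisible
  to \<open>FR\<close>.\<close>

lemma FR_eta_mix:
  assumes M: "radon_pos M" "has_dt M \<mu>" and N: "radon_pos N" "has_dt N \<nu>" and s: "s \<in> {0..1}"
  shows "FR_eta (mix_meas s M N) \<le> ennreal (1 - s) * FR_eta M + ennreal s * FR_eta N"
proof -
  note dM = has_dt_dt_meas[OF M(2)] and dN = has_dt_dt_meas[OF N(2)]
  have mix: "has_dt (mix_meas s M N) (mix_signed s (dt_meas M) (dt_meas N))"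
    by (rule has_dt_mix[OF M(1) N(1) dM dN s])
  have "FR_eta (mix_meas s M N) =
      FR (\<lambda>(t, x). eta (q t) x) (signed_of (mix_meas s M N)) (mix_signed s (dt_meas M) (dt_meas N))"
    unfolding FR_eta_def by (rule FR_cong) (rule has_dt_unique[OF has_dt_dt_meas[OF mix] mix])
  also have "\<dots> \<le> ennreal (1 - s) * FR_eta M + ennreal s * FR_eta N"
    unfolding FR_eta_def using s
    by (intro FR_convex M(1) N(1) has_dt_D(1)[OF dM] has_dt_D(1)[OF dN] eta_borel_D) auto
  finally show ?thesis .
qed

lemma FR_eta_zero: "FR_eta zero_meas = 0"
  unfolding FR_eta_def
proof (rule FR_zero[OF _ eta_borel_D])
  fix A assume "A \<in> sets borel_D"
  then show "smeasure (dt_meas zero_meas) A = 0"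
    using has_dt_unique[OF has_dt_dt_meas[OF has_dt_zero] has_dt_zero] by (simp add: smeasure_def)
qed

lemma energy_acc_mix:
  assumes M: "radon_pos M" "has_dt M \<mu>" and N: "radon_pos N" "has_dt N \<nu>" and s: "s \<in> {0..1}"
  shows "energy (acc (mix_meas s M N)) + ennreal (s * (1 - s)) * energy (\<lambda>t x. acc M t x - acc N t x) =
    ennreal (1 - s) * energy (acc M) + ennreal s * energy (acc N)"
proof -
  note dis = disintegrates_slice[OF M] disintegrates_slice[OF N]
    disintegrates_slice[OF radon_pos_mix[OF M(1) N(1)] has_dt_mix[OF M(1) N(1) M(2) N(2) s]]
  have "energy (acc (mix_meas s M N)) = energy (\<lambda>t x. (1 - s) * acc M t x + s * acc N t x)"
    by (rule energy_cong_AE[OF acc_mix[OF M(1) dis(1) N(1) dis(2) dis(3) s]])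
  then show ?thesis
    using energy_convex_identity[OF acc_meas2[OF dis(1)] acc_meas2[OF dis(2)]] s by simp
qed

text \<open>The terminal cost may be negative, so the sum leaves \<open>ennreal\<close>. It passes
  through the combination because the weights sum to 1, and with both weights positive an infinite
  value of either term makes the right-hand side infinite.\<close>

lemma ereal_convex_combination:
  fixes a b c :: ennreal
  assumes le: "c \<le> ennreal (1 - s) * a + ennreal s * b" and s: "0 < s" "s < 1"
  shows "enn2ereal c + ereal k \<le> ereal (1 - s) * (enn2ereal a + ereal k) + ereal s * (enn2ereal b + ereal k)"
proof (cases "a = top \<or> b = top")
  case True
  then have inf: "ereal (1 - s) * (enn2ereal a + ereal k) + ereal s * (enn2ereal b + ereal k) = \<infinity>"
    using s enn2ereal_nonneg[of a] enn2ereal_nonneg[of b]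
    by (cases "enn2ereal a"; cases "enn2ereal b") (auto simp: top_ennreal.rep_eq)
  show ?thesis unfolding inf by simp
next
  case False
  then obtain x y where x: "a = ennreal x" "0 \<le> x" and y: "b = ennreal y" "0 \<le> y"
    by (metis ennreal_cases)
  define W where "W = (1 - s) * x + s * y"
  have W: "0 \<le> W" unfolding W_def using s x y by (intro add_nonneg_nonneg mult_nonneg_nonneg) auto
  have "c \<le> ennreal W"
    unfolding W_def using le s x y by (simp add: ennreal_mult[symmetric] ennreal_plus[symmetric] del: ennreal_plus)
  then have "\<exists>w. c = ennreal w \<and> 0 \<le> w \<and> w \<le> W"
    using W by (cases c) (auto simp: top_unique)
  then obtain w where w: "c = ennreal w" "0 \<le> w" "w \<le> (1 - s) * x + s * y"
    unfolding W_def by blast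
  then have "w + k \<le> (1 - s) * (x + k) + s * (y + k)" by (simp add: algebra_simps)
  with w x y show ?thesis by simp
qed

lemma F_functional_convex: "convex_problem (\<lambda>\<Delta>. F_functional P \<Delta> p q) M0"
  unfolding convex_problem_def
proof (intro ballI conjI)
  fix M N :: "(real \<times> real) measure" and s :: real
  assume M: "M \<in> M0" and N: "N \<in> M0" and s: "s \<in> {0..1}"
  then show "mix_meas s M N \<in> M0" by (rule M0_mix)
  have rM: "radon_pos M" and rN: "radon_pos N" using M N by (auto simp: M0_def)
  have sets: "sets N = sets M" using radon_posD(1)[OF rM] radon_posD(1)[OF rN] by simp
  have not_minus: "F_functional P L p q \<noteq> - \<infinity>" for L
  proof (cases "\<exists>\<delta>. has_dt L \<delta>")
    case True
    then obtain \<delta> where "has_dt L \<delta>" by blast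
    then show ?thesis
      using enn2ereal_nonneg[of "FR_eta L + energy (acc L)"] F_functional_eq[of L \<delta> P] by auto
  qed (simp add: F_functional_infinite)
  \<comment> \<open>At the endpoints the weight 0 annihilates a possibly infinite value, so there
    the mixture has to be identified with one of the two measures.\<close>
  consider "s = 0" | "s = 1" | "0 < s" "s < 1" using s by fastforce
  then show "F_functional P (mix_meas s M N) p q \<le>
      ereal (1 - s) * F_functional P M p q + ereal s * F_functional P N p q"
  proof cases
    case 1
    then show ?thesis by (simp add: mix_meas_0[OF sets] zero_ereal_def[symmetric] one_ereal_def[symmetric])
  next
    case 2
    then show ?thesis by (simp add: mix_meas_1[OF sets] zero_ereal_def[symmetric] one_ereal_def[symmetric])
  next
    case 3
    show ?thesis
    proof (cases "(\<exists>\<delta>. has_dt M \<delta>) \<and> (\<exists>\<delta>. has_dt N \<delta>)")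
      case True
      then obtain \<mu> \<nu> where \<mu>: "has_dt M \<mu>" and \<nu>: "has_dt N \<nu>" by blast
      have "FR_eta (mix_meas s M N) + energy (acc (mix_meas s M N)) \<le>
          (ennreal (1 - s) * FR_eta M + ennreal s * FR_eta N) +
          (ennreal (1 - s) * energy (acc M) + ennreal s * energy (acc N))"
        unfolding energy_acc_mix[OF rM \<mu> rN \<nu> s, symmetric]
        by (intro add_mono FR_eta_mix[OF rM \<mu> rN \<nu> s]) simp
      also have "\<dots> = ennreal (1 - s) * (FR_eta M + energy (acc M)) + ennreal s * (FR_eta N + energy (acc N))"
        by (simp add: algebra_simps)
      finally show ?thesis
        unfolding F_functional_eq[OF \<mu>] F_functional_eq[OF \<nu>] F_functional_eq[OF has_dt_mix[OF rM rN \<mu> \<nu> s]]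
        by (rule ereal_convex_combination[OF _ 3])
    next
      case False
      then have "F_functional P M p q = \<infinity> \<or> F_functional P N p q = \<infinity>"
        using F_functional_infinite by blast
      then have inf: "ereal (1 - s) * F_functional P M p q + ereal s * F_functional P N p q = \<infinity>"
        using 3 not_minus[of M] not_minus[of N]
        by (cases "F_functional P M p q"; cases "F_functional P N p q") auto
      show ?thesis unfolding inf by simp
    qed
  qed
qed

lemma zero_unique_minimizer:
  assumes zero: "minimizer_on (\<lambda>\<Delta>. F_functional P \<Delta> p q) M0 zero_meas"
    and \<Delta>: "minimizer_on (\<lambda>\<Delta>. F_functional P \<Delta> p q) M0 \<Delta>"
  shows "\<Delta> = zero_meas"
proof -
  let ?F = "\<lambda>\<Delta>. F_functional P \<Delta> p q" and ?P = "ereal (P (p 1, q 1))"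
  note z = radon_pos_zero has_dt_zero
  have \<Delta>0: "\<Delta> \<in> M0" using \<Delta> by (simp add: minimizer_on_def)
  then have r: "radon_pos \<Delta>" by (simp add: M0_def)
  have le: "?F \<Delta> \<le> ?F zero_meas" using \<Delta> zero_in_M0 by (simp add: minimizer_on_def)
  let ?E0 = "energy (acc zero_meas)"
  have fin: "?E0 < \<infinity>" by (rule energy_acc_zero_finite[OF disintegrates_slice[OF z]])
  have F0: "?F zero_meas = enn2ereal ?E0 + ?P"
    unfolding F_functional_eq[OF z(2)] FR_eta_zero by simp
  \<comment> \<open>The terminal cost is a real number and cancels; from here on all comparisons
    take place in \<open>ennreal\<close>.\<close>
  have cancel: "enn2ereal a + ?P \<le> enn2ereal b + ?P \<longleftrightarrow> a \<le> b" for a b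
    by (simp add: ereal_add_le_add_iff2 less_eq_ennreal.rep_eq)
  have "?F \<Delta> \<noteq> \<infinity>"
    using le fin unfolding F0 by (auto simp: less_top)
  then obtain \<delta> where \<delta>: "has_dt \<Delta> \<delta>" using F_functional_infinite by blast
  have 1: "FR_eta \<Delta> + energy (acc \<Delta>) \<le> ?E0"
    using le unfolding F0 F_functional_eq[OF \<delta>] cancel .
  let ?h = "1/2 :: real" and ?mix = "mix_meas (1/2) zero_meas \<Delta>" and ?K = "energy (\<lambda>t x. acc zero_meas t x - acc \<Delta> t x)"
  have h: "?h \<in> {0..1}" by simp
  have "?mix \<in> M0" by (rule M0_mix[OF zero_in_M0 \<Delta>0 h])
  then have "?F zero_meas \<le> ?F ?mix" using zero by (simp add: minimizer_on_def)
  then have 2: "?E0 \<le> FR_eta ?mix + energy (acc ?mix)"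
    unfolding F0 F_functional_eq[OF has_dt_mix[OF z(1) r z(2) \<delta> h]] cancel .
  \<comment> \<open>The zero measure contributes nothing, so half of the Fisher-Rao term of \<Delta>
    remains, matching the half of its energy in the next identity.\<close>
  have 3: "FR_eta ?mix \<le> ennreal ?h * FR_eta \<Delta>"
    using FR_eta_mix[OF z r \<delta> h] by (simp add: FR_eta_zero)
  have 4: "energy (acc ?mix) + ennreal (1/4) * ?K = ennreal ?h * ?E0 + ennreal ?h * energy (acc \<Delta>)"
    using energy_acc_mix[OF z r \<delta> h] by simp
  \<comment> \<open>The chain bounds \<open>?E0\<close> plus a quarter of \<open>?K\<close> by
    \<open>?E0\<close>, which is finite, so \<open>?K\<close> is squeezed to 0. The constant 1/4 is
    s * (1 - s) at the midpoint.\<close>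
  have "?E0 + ennreal (1/4) * ?K \<le> FR_eta ?mix + (energy (acc ?mix) + ennreal (1/4) * ?K)"
    using add_right_mono[OF 2, of "ennreal (1/4) * ?K"] by (simp add: add.assoc)
  also have "\<dots> \<le> ennreal ?h * FR_eta \<Delta> + (ennreal ?h * ?E0 + ennreal ?h * energy (acc \<Delta>))"
    unfolding 4 by (intro add_mono 3 order_refl)
  also have "\<dots> = ennreal ?h * ?E0 + ennreal ?h * (FR_eta \<Delta> + energy (acc \<Delta>))"
    by (simp add: algebra_simps)
  also have "\<dots> \<le> ennreal ?h * ?E0 + ennreal ?h * ?E0"
    by (intro add_mono mult_left_mono 1 order_refl) simp
  also have "\<dots> = ?E0"
  proof -
    have "ennreal ?h + ennreal ?h = 1" by (subst ennreal_plus[symmetric]) auto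
    then show ?thesis unfolding distrib_right[symmetric] by simp
  qed
  finally have "?E0 + ennreal (1/4) * ?K \<le> ?E0 + 0" by simp
  then have "ennreal (1/4) * ?K \<le> 0"
    using fin by (subst (asm) ennreal_add_left_cancel_le) auto
  then have "?K = 0" by (simp add: ennreal_eq_0_iff)
  then have "?E0 = energy (acc \<Delta>)"
    by (rule energy_diff_zero[OF acc_meas2[OF disintegrates_slice[OF z]] acc_meas2[OF disintegrates_slice[OF r \<delta>]]])
  with 1 have "?E0 + FR_eta \<Delta> \<le> ?E0 + 0" by (simp add: add.commute)
  then have "FR_eta \<Delta> = 0"
    using fin by (subst (asm) ennreal_add_left_cancel_le) auto
  then have "smeasure (dt_meas \<Delta>) A = 0" if "A \<in> sets borel_D" for A
    unfolding FR_eta_def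
    using FR_eq_0_imp[OF r has_dt_D(1)[OF has_dt_dt_meas[OF \<delta>]] eta_borel_D _ _ that] eta_pos by auto
  then show ?thesis by (rule has_dt_zero_imp_zero[OF r has_dt_dt_meas[OF \<delta>]])
qed

end

theorem proposition7p2:
  fixes q0 p0 :: "real \<Rightarrow> real"
    and p q :: "real \<Rightarrow> real \<Rightarrow> real"
    and P :: "(real \<Rightarrow> real) \<times> (real \<Rightarrow> real) \<Rightarrow> real"
  assumes "q0 \<in> Q" and "p0 \<in> Tstar q0"
    and "(p, q) \<in> C0_paths q0 p0"
  shows "convex_problem (\<lambda>\<Delta>. F_functional P \<Delta> p q) M0 \<and>
    (minimizer_on (\<lambda>\<Delta>. F_functional P \<Delta> p q) M0 zero_meas \<longrightarrow>
      (\<forall>\<Delta>. minimizer_on (\<lambda>\<Delta>. F_functional P \<Delta> p q) M0 \<Delta> \<longrightarrow> \<Delta> = zero_meas))"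
proof -
  interpret cotangent_path q0 p0 p q by standard (rule assms(3))
  show ?thesis using F_functional_convex zero_unique_minimizer by blast
qed

end
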